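(* Let $F$ and $G$ be Siegel modular forms of degree $2$ and level $N$ which are Hecke eigenforms, of respective weights $(\lambda_1\ge\lambda_2)$ and $(\mu_1\ge\mu_2)$ satisfying $\lambda_1+\lambda_2\ne\mu_1+\mu_2$. Suppose that at least one of the Fourier coefficients $c_F(I)$ and $c_G(I)$ is nonzero, where $I$ is the $2\times2$ identity matrix. Let $p$ be a prime with $p\equiv3\pmod4$ not dividing $N$. Then there exists $r$ with $0\le r\le6$ such that $c_F(p^rI)\ne c_G(p^rI)$.
   Context: $J=\begin{pmatrix}0&I_2\\-I_2&0\end{pmatrix}$, $\Gamma_0(N)=\{\begin{pmatrix}A&B\\C&D\end{pmatrix}\in\mathrm{Sp}(4,\mathbb{Z}) : C\equiv0\pmod N\}$, $\mathbb{H}^2$ the Siegel upper half space of degree 2. For a polynomial representation $\rho\colon\mathrm{GL}_2(\mathbb{C})\to\mathrm{GL}(V)$ of highest weight $(\lambda_1\ge\lambda_2)$, a Siegel modular form of degree 2, weight $(\lambda_1\ge\lambda_2)$, level $N$ is a holomorphic $F\colon\mathbb{H}^2\to V$ with $F((Az+B)(Cz+D)^{-1})=\rho(Cz+D)F(z)$ for all elements of $\Gamma_0(N)$. Such $F$ has a Fourier expansion $F(z)=\sum_Sc_F(S)e^{2\pi i\operatorname{Tr}(Sz)}$, $c_F(S)\in V$, over all symmetric positive semidefinite half-integral $2\times2$ rational matrices $S$. For $\gamma=\begin{pmatrix}A&B\\C&D\end{pmatrix}\in\mathrm{GSp}(4,\mathbb{Q})$ with $\gamma J\gamma^t=\eta(\gamma)J$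 and positive determinant, $F|_{\gamma,\rho}(z)=\eta(\gamma)^{\lambda_1+\lambda_2-3}\rho(Cz+D)^{-1}F(\gamma\cdot z)$. For $p\nmid N$ and $K=\mathrm{Sp}(4,\mathbb{Z}_p)$, a double coset $K\gamma K=\coprod_iK\gamma_i$ acts by $F\mapsto\sum_iF|_{\gamma_i,\rho}$, extended linearly; $T(p^r)$ is the sum of the distinct double cosets $K\gamma K$ with $\gamma^tJ\gamma=p^rJ$, $\gamma$ integral. A Hecke eigenform is an eigenvector of all these operators. *)

theory Defs
  imports "HOL-Analysis.Analysis" "HOL-Computational_Algebra.Primes"
begin

section \<open>Symplectic groups\<close>

text \<open>
  The index type \<open>2 + 2\<close> (a sum type) gives the block structure: \<open>Inl\<close> indexes the first
  and \<open>Inr\<close> the last two rows or columns. All groups are realised inside rational matrices.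
\<close>

type_synonym mat4 = "rat^(2 + 2)^(2 + 2)"

definition J :: mat4 where
  "J = (\<chi> i j. case (i, j) of
          (Inl a, Inr b) \<Rightarrow> if a = b then 1 else 0
        | (Inr a, Inl b) \<Rightarrow> if a = b then -1 else 0
        | _ \<Rightarrow> 0)"

definition symplectic_similitude :: "mat4 \<Rightarrow> rat \<Rightarrow> bool" where
  "symplectic_similitude \<gamma> \<eta> \<longleftrightarrow> \<gamma> ** J ** transpose \<gamma> = mat \<eta> ** J"

definition multiplier :: "mat4 \<Rightarrow> rat" where
  "multiplier \<gamma> = (THE \<eta>. symplectic_similitude \<gamma> \<eta>)"

definition Gamma0 :: "nat \<Rightarrow> mat4 set" where
  "Gamma0 N = {\<gamma>. symplectic_similitude \<gamma> 1
      \<and> (\<forall>i j. \<gamma> $ i $ j \<in> \<int>)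
      \<and> (\<forall>i j. \<exists>k\<in>\<int>. \<gamma> $ Inr i $ Inl j = of_nat N * k)}"

definition block_A :: "mat4 \<Rightarrow> complex^2^2" where
  "block_A \<gamma> = (\<chi> i j. of_rat (\<gamma> $ Inl i $ Inl j))"

definition block_B :: "mat4 \<Rightarrow> complex^2^2" where
  "block_B \<gamma> = (\<chi> i j. of_rat (\<gamma> $ Inl i $ Inr j))"

definition block_C :: "mat4 \<Rightarrow> complex^2^2" where
  "block_C \<gamma> = (\<chi> i j. of_rat (\<gamma> $ Inr i $ Inl j))"

definition block_D :: "mat4 \<Rightarrow> complex^2^2" where
  "block_D \<gamma> = (\<chi> i j. of_rat (\<gamma> $ Inr i $ Inr j))"


section \<open>The Siegel upper half space\<close>

definition siegel_H2 :: "(complex^2^2) set" where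
  "siegel_H2 = {z. transpose z = z \<and>
      (\<forall>x::real^2. x \<noteq> 0 \<longrightarrow> 0 < x \<bullet> ((\<chi> i j. Im (z $ i $ j)) *v x))}"

definition automorphy_factor :: "mat4 \<Rightarrow> complex^2^2 \<Rightarrow> complex^2^2" where
  "automorphy_factor \<gamma> z = block_C \<gamma> ** z + block_D \<gamma>"

definition siegel_act :: "mat4 \<Rightarrow> complex^2^2 \<Rightarrow> complex^2^2" where
  "siegel_act \<gamma> z = (block_A \<gamma> ** z + block_B \<gamma>) ** matrix_inv (automorphy_factor \<gamma> z)"

text \<open>
  The half space is open in the three-dimensional complex space of symmetric matrices, so
  complex differentiability is taken within it. Off that space the derivative is not determined,
  but a complex linear map on symmetric matrices always extends.
\<close>

definition holomorphic_on_H2 :: "(complex^2^2 \<Rightarrow> complex^'n) \<Rightarrow> bool" where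
  "holomorphic_on_H2 F \<longleftrightarrow> (\<forall>z\<in>siegel_H2. \<exists>F'.
      (F has_derivative F') (at z within siegel_H2) \<and>
      (\<forall>c h. F' (\<chi> i j. c * h $ i $ j) = c *s F' h))"


section \<open>Polynomial representations of the complex general linear group of degree 2\<close>

inductive polynomial_in_entries :: "(complex^2^2 \<Rightarrow> complex) \<Rightarrow> bool" where
  const: "polynomial_in_entries (\<lambda>g. c)"
| entry: "polynomial_in_entries (\<lambda>g. g $ i $ j)"
| add: "polynomial_in_entries P \<Longrightarrow> polynomial_in_entries Q \<Longrightarrow> polynomial_in_entries (\<lambda>g. P g + Q g)"
| mult: "polynomial_in_entries P \<Longrightarrow> polynomial_in_entries Q \<Longrightarrow> polynomial_in_entries (\<lambda>g. P g * Q g)"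

text \<open>
  The representation space is a complex subspace \<open>V\<close> of some \<open>complex^'n\<close>. Two
  representations of different dimension may thus live in one ambient space, where their vectors
  can be compared. Only the values of \<open>\<rho> g\<close> on \<open>V\<close>, for invertible \<open>g\<close>,
  are relevant.
\<close>

definition polynomial_rep ::
    "(complex^'n) set \<Rightarrow> (complex^2^2 \<Rightarrow> complex^'n \<Rightarrow> complex^'n) \<Rightarrow> bool" where
  "polynomial_rep V \<rho> \<longleftrightarrow> vec.subspace V
    \<and> (\<forall>g v. invertible g \<longrightarrow> v \<in> V \<longrightarrow> \<rho> g v \<in> V)
    \<and> (\<forall>g v w. invertible g \<longrightarrow> v \<in> V \<longrightarrow> w \<in> V \<longrightarrow> \<rho> g (v + w) = \<rho> g v + \<rho> g w)
    \<and> (\<forall>g c v. invertible g \<longrightarrow> v \<in> V \<longrightarrow> \<rho> g (c *s v) = c *s \<rho> g v)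
    \<and> (\<forall>v. v \<in> V \<longrightarrow> \<rho> (mat 1) v = v)
    \<and> (\<forall>g h v. invertible g \<longrightarrow> invertible h \<longrightarrow> v \<in> V \<longrightarrow> \<rho> (g ** h) v = \<rho> g (\<rho> h v))
    \<and> (\<forall>v i. v \<in> V \<longrightarrow> (\<exists>P. polynomial_in_entries P \<and> (\<forall>g. invertible g \<longrightarrow> \<rho> g v $ i = P g)))"

definition irreducible_rep ::
    "(complex^'n) set \<Rightarrow> (complex^2^2 \<Rightarrow> complex^'n \<Rightarrow> complex^'n) \<Rightarrow> bool" where
  "irreducible_rep V \<rho> \<longleftrightarrow> V \<noteq> {0} \<and>
    (\<forall>W. vec.subspace W \<longrightarrow> W \<subseteq> V \<longrightarrow>
         (\<forall>g w. invertible g \<longrightarrow> w \<in> W \<longrightarrow> \<rho> g w \<in> W) \<longrightarrow> W = {0} \<or> W = V)"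

text \<open>Highest weights are taken with respect to the upper triangular Borel subgroup.\<close>

definition highest_weight_rep ::
    "(complex^'n) set \<Rightarrow> (complex^2^2 \<Rightarrow> complex^'n \<Rightarrow> complex^'n) \<Rightarrow> int \<Rightarrow> int \<Rightarrow> bool" where
  "highest_weight_rep V \<rho> l1 l2 \<longleftrightarrow>
     polynomial_rep V \<rho> \<and> irreducible_rep V \<rho> \<and> l2 \<le> l1 \<and>
     (\<exists>v\<in>V. v \<noteq> 0
        \<and> (\<forall>x. \<rho> (vector [vector [1, x], vector [0, 1]]) v = v)
        \<and> (\<forall>a b. a \<noteq> 0 \<longrightarrow> b \<noteq> 0 \<longrightarrow>
              \<rho> (vector [vector [a, 0], vector [0, b]]) v = (a powi l1 * b powi l2) *s v))"


section \<open>Siegel modular forms and their Fourier coefficients\<close>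

definition siegel_modular_form ::
    "nat \<Rightarrow> (complex^'n) set \<Rightarrow> (complex^2^2 \<Rightarrow> complex^'n \<Rightarrow> complex^'n) \<Rightarrow> int \<Rightarrow> int
      \<Rightarrow> (complex^2^2 \<Rightarrow> complex^'n) \<Rightarrow> bool" where
  "siegel_modular_form N V \<rho> l1 l2 F \<longleftrightarrow>
     highest_weight_rep V \<rho> l1 l2
     \<and> (\<forall>z\<in>siegel_H2. F z \<in> V)
     \<and> holomorphic_on_H2 F
     \<and> (\<forall>\<gamma>\<in>Gamma0 N. \<forall>z\<in>siegel_H2. F (siegel_act \<gamma> z) = \<rho> (automorphy_factor \<gamma> z) (F z))"

definition half_integral_psd :: "(rat^2^2) set" where
  "half_integral_psd = {S. transpose S = S
      \<and> (\<forall>i. S $ i $ i \<in> \<int>) \<and> (\<forall>i j. 2 * S $ i $ j \<in> \<int>)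
      \<and> (\<forall>x::real^2. 0 \<le> x \<bullet> ((\<chi> i j. of_rat (S $ i $ j)) *v x))}"

definition fourier_expansion ::
    "(complex^2^2 \<Rightarrow> complex^'n) \<Rightarrow> (rat^2^2 \<Rightarrow> complex^'n) \<Rightarrow> bool" where
  "fourier_expansion F c \<longleftrightarrow> (\<forall>z\<in>siegel_H2.
     ((\<lambda>S. exp (2 * of_real pi * \<i> * trace ((\<chi> i j. of_rat (S $ i $ j)) ** z)) *s c S)
        has_sum F z) half_integral_psd)"

text \<open>
  Coefficients outside the index set are set to zero; this normalisation makes the family unique.
\<close>

definition fourier_coeff :: "(complex^2^2 \<Rightarrow> complex^'n) \<Rightarrow> rat^2^2 \<Rightarrow> complex^'n" where
  "fourier_coeff F = (THE c. fourier_expansion F c \<and> (\<forall>S. S \<notin> half_integral_psd \<longrightarrow> c S = 0))"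


section \<open>Hecke operators\<close>

definition slash ::
    "(complex^2^2 \<Rightarrow> complex^'n \<Rightarrow> complex^'n) \<Rightarrow> int \<Rightarrow> int \<Rightarrow> (complex^2^2 \<Rightarrow> complex^'n) \<Rightarrow> mat4
      \<Rightarrow> complex^2^2 \<Rightarrow> complex^'n" where
  "slash \<rho> l1 l2 F \<gamma> z =
     (of_rat (multiplier \<gamma>) powi (l1 + l2 - 3)) *s
       \<rho> (matrix_inv (automorphy_factor \<gamma> z)) (F (siegel_act \<gamma> z))"

text \<open>
  \<open>Z_localized p\<close> is the ring of rational numbers that are p-adic integers, and
  \<open>local_K p\<close> the group of rational points of the p-adic group Sp(4,Z_p). Since Sp(4,Q) is
  dense in Sp(4,Q_p), intersecting with the rational matrices identifies the double and left
  cosets of Sp(4,Z_p) that contain a rational matrix with those of \<open>local_K p\<close>.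
\<close>

definition Z_localized :: "nat \<Rightarrow> rat set" where
  "Z_localized p = {x. \<not> int p dvd snd (quotient_of x)}"

definition local_K :: "nat \<Rightarrow> mat4 set" where
  "local_K p = {k. symplectic_similitude k 1 \<and> (\<forall>i j. k $ i $ j \<in> Z_localized p)}"

definition double_coset :: "nat \<Rightarrow> mat4 \<Rightarrow> mat4 set" where
  "double_coset p \<gamma> = {k ** \<gamma> ** k' | k k'. k \<in> local_K p \<and> k' \<in> local_K p}"

definition left_coset :: "nat \<Rightarrow> mat4 \<Rightarrow> mat4 set" where
  "left_coset p \<gamma> = {k ** \<gamma> | k. k \<in> local_K p}"

text \<open>
  A form of level \<open>N\<close> is invariant under \<open>Gamma0 N\<close> only, not under all of
  \<open>local_K p\<close>, so representatives have to satisfy the level condition at the primes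
  different from \<open>p\<close>: their entries lie in Z[1/p] and the lower left block is divisible
  by \<open>N\<close>. By strong approximation every left coset of p-power multiplier contains
  such a representative, unique up to left multiplication by \<open>Gamma0 N\<close>.
\<close>

definition Z_inverted :: "nat \<Rightarrow> rat set" where
  "Z_inverted p = {x. \<exists>m. of_nat p ^ m * x \<in> \<int>}"

definition level_matrices :: "nat \<Rightarrow> nat \<Rightarrow> mat4 set" where
  "level_matrices p N = {\<gamma>. (\<exists>k::int. symplectic_similitude \<gamma> (of_nat p powi k))
      \<and> (\<forall>i j. \<gamma> $ i $ j \<in> Z_inverted p)
      \<and> (\<forall>i j. \<exists>x\<in>Z_inverted p. \<gamma> $ Inr i $ Inl j = of_nat N * x)}"

definition hecke_operator ::
    "nat \<Rightarrow> nat \<Rightarrow> (complex^2^2 \<Rightarrow> complex^'n \<Rightarrow> complex^'n) \<Rightarrow> int \<Rightarrow> int \<Rightarrow> mat4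
      \<Rightarrow> (complex^2^2 \<Rightarrow> complex^'n) \<Rightarrow> complex^2^2 \<Rightarrow> complex^'n" where
  "hecke_operator p N \<rho> l1 l2 \<gamma> F z =
     (\<Sum>c \<in> left_coset p ` double_coset p \<gamma>.
        slash \<rho> l1 l2 F (SOME \<delta>. \<delta> \<in> c \<and> \<delta> \<in> level_matrices p N) z)"

text \<open>
  The double cosets span the Hecke algebra, so an eigenvector of all of them is also an
  eigenvector of their linear combinations, in particular of every T(p^r).
\<close>

definition hecke_eigenform ::
    "nat \<Rightarrow> (complex^2^2 \<Rightarrow> complex^'n \<Rightarrow> complex^'n) \<Rightarrow> int \<Rightarrow> int
      \<Rightarrow> (complex^2^2 \<Rightarrow> complex^'n) \<Rightarrow> bool" where
  "hecke_eigenform N \<rho> l1 l2 F \<longleftrightarrow>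
     (\<exists>z\<in>siegel_H2. F z \<noteq> 0) \<and>
     (\<forall>p \<gamma>. prime p \<longrightarrow> \<not> p dvd N \<longrightarrow>
        (\<exists>k::int. symplectic_similitude \<gamma> (of_nat p powi k)) \<longrightarrow>
        (\<exists>e. \<forall>z\<in>siegel_H2. hecke_operator p N \<rho> l1 l2 \<gamma> F z = e *s F z))"

end

theory Submission
  imports Defs "HOL-Complex_Analysis.Cauchy_Integral_Theorem" "HOL-Real_Asymp.Real_Asymp"
    "HOL-Number_Theory.Residues"
begin

text \<open>
  For a representative of a left coset with diagonal blocks \<open>A\<close>, \<open>D\<close> and \<open>A D\<^sup>T = \<eta>\<close>, the slash operator
  sends the \<open>T\<close>-th Fourier coefficient to a multiple of \<open>\<rho>(D)\<^sup>-\<^sup>1\<close> applied to the coefficient at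
  \<open>\<eta>\<^sup>-\<^sup>1 D T D\<^sup>T\<close>. Take \<open>T = p\<^sup>j I\<close>. As \<open>p \<equiv> 3 (mod 4)\<close>, the form \<open>x\<^sup>2 + y\<^sup>2\<close> is anisotropic
  modulo \<open>p\<close>, and so \<open>T(p)\<close> relates the coefficients \<open>c(p\<^sup>j\<^sup>-\<^sup>1 I)\<close>, \<open>c(p\<^sup>j\<^sup>+\<^sup>1 I)\<close> and one sum \<open>b\<^sub>j\<^sub>-\<^sub>1\<close> over the
  lattices of index \<open>p\<close>, whereas the double coset of \<open>diag(1, p, p\<^sup>2, p)\<close> relates \<open>b\<^sub>j\<close>, \<open>b\<^sub>j\<^sub>-\<^sub>2\<close> and
  \<open>c(p\<^sup>j I)\<close>. Eliminating the eigenvalues and the \<open>b\<^sub>j\<close> leaves a recursion for the \<open>c(p\<^sup>j I)\<close> whose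
  only parameter is \<open>q = p\<^bsup>\<lambda>\<^sub>1+\<lambda>\<^sub>2-3\<^esup>\<close>, and two different \<open>q\<close> are incompatible for \<open>j \<le> 6\<close>.
\<close>

text \<open>\<open>fourier_coeff\<close> is a definite description and \<open>hecke_operator\<close>
  uses chosen representatives, so nothing can be read off before an expansion is shown to exist, to
  be unique and to have half-integral positive semidefinite support, and before the choice is shown
  to be harmless. A single summand of a Hecke operator is periodic only under a sublattice of
  translations, hence uniqueness is proved for arbitrary rational frequencies. The condition modulo
  4 enters twice: \<open>y\<^sup>2 + 1\<close> is prime to \<open>p\<close>, so every term that
  would precede the start of the recursion has a non-integral diagonal entry and vanishes, and the
  exponential sum at \<open>j = 0\<close> can be evaluated. The matrices acting on
  \<open>c(p\<^sup>j I)\<close> itself are scalar, so by the central character the recursion holds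
  in each coordinate separately, and \<open>\<rho>\<close> and \<open>\<sigma>\<close> never have to
  be compared. The bound 6 arises because the second relation at index \<open>j\<close> involves
  \<open>b\<^sub>j\<close>, which contains the coefficient at \<open>j + 2\<close>: index 1 forces
  the coefficient at 1 to vanish, after which indices 2 and 4 reach the coefficients at 4 and
  6.\<close>

definition m2 :: "'a::zero \<Rightarrow> 'a \<Rightarrow> 'a \<Rightarrow> 'a \<Rightarrow> 'a^2^2" where
  "m2 a b c d = vector [vector [a, b], vector [c, d]]"

lemma m2_nth [simp]:
  "m2 a b c d $ 1 $ 1 = a" "m2 a b c d $ 1 $ 2 = b"
  "m2 a b c d $ 2 $ 1 = c" "m2 a b c d $ 2 $ 2 = d"
  by (simp_all add: m2_def)

lemma mat2_eq_iff: "(M :: 'a^2^2) = M' \<longleftrightarrow>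
   M$1$1 = M'$1$1 \<and> M$1$2 = M'$1$2 \<and> M$2$1 = M'$2$1 \<and> M$2$2 = M'$2$2"
  by (simp add: vec_eq_iff forall_2)

lemma m2_eta: "(M :: 'a::zero^2^2) = m2 (M$1$1) (M$1$2) (M$2$1) (M$2$2)"
  by (simp add: mat2_eq_iff)

lemma m2_inject [simp]: "m2 a b c d = m2 a' b' c' d' \<longleftrightarrow> a = a' \<and> b = b' \<and> c = c' \<and> d = d'"
  by (simp add: mat2_eq_iff)

lemma m2_cases: obtains a b c d where "(M :: 'a::zero^2^2) = m2 a b c d"
  using m2_eta by blast

lemma m2_mult [simp]: "m2 a b c d ** m2 a' b' c' d' =
    m2 (a*a' + b*c') (a*b' + b*d') (c*a' + d*c') ((c :: 'a::semiring_1)*b' + d*d')"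
  by (simp add: mat2_eq_iff matrix_matrix_mult_def sum_2)

lemma mult_2x2: "A ** B = m2 (A$1$1*B$1$1 + A$1$2*B$2$1) (A$1$1*B$1$2 + A$1$2*B$2$2)
    (A$2$1*B$1$1 + A$2$2*B$2$1) (A$2$1*B$1$2 + A$2$2*(B::'a::semiring_1^2^2)$2$2)"
  by (simp add: mat2_eq_iff matrix_matrix_mult_def sum_2)

lemma m2_add [simp]: "m2 a b c d + m2 a' b' c' d' = m2 (a+a') (b+b') (c+c') ((d::'a::monoid_add)+d')"
  by (simp add: mat2_eq_iff)

lemma m2_uminus [simp]: "- m2 a b c d = m2 (-a) (-b) (-c) (- (d::'a::group_add))"
  by (simp add: mat2_eq_iff)

lemma m2_transpose [simp]: "transpose (m2 a b c d) = m2 a c b d"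
  by (simp add: mat2_eq_iff transpose_def)

lemma mat_m2: "(mat c :: 'a::zero^2^2) = m2 c 0 0 c"
  by (simp add: mat2_eq_iff mat_def)

lemma zero_m2: "(0 :: 'a::zero^2^2) = m2 0 0 0 0"
  by (simp add: mat2_eq_iff)

lemma trace_m2 [simp]: "trace (m2 a b c d) = a + (d :: 'a::semiring_1)"
  by (simp add: trace_def sum_2)

lemma matrix_inv_both:
  fixes A :: "'a::semiring_1^'n^'n"
  assumes "invertible A"
  shows "A ** matrix_inv A = mat 1" "matrix_inv A ** A = mat 1"
proof -
  have "A ** matrix_inv A = mat 1 \<and> matrix_inv A ** A = mat 1"
    unfolding matrix_inv_def using assms unfolding invertible_def by (rule someI_ex)
  then show "A ** matrix_inv A = mat 1" "matrix_inv A ** A = mat 1" by auto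
qed

lemma matrix_inv_unique:
  fixes A :: "'a::field^'n^'n"
  assumes "A ** B = mat 1"
  shows "matrix_inv A = B" "invertible A"
proof -
  have 2: "B ** A = mat 1" using assms matrix_left_right_inverse by blast
  then show inv: "invertible A" using assms unfolding invertible_def by blast
  have "matrix_inv A = matrix_inv A ** (A ** B)" by (simp add: assms)
  also have "\<dots> = B" using inv by (simp add: matrix_mul_assoc matrix_inv_both)
  finally show "matrix_inv A = B" .
qed

lemma m2_invertible_iff: "invertible (m2 a b c d) \<longleftrightarrow> a * d - b * c \<noteq> (0::'a::field)"
  by (simp add: invertible_det_nz det_2)

lemma matrix_inv_mult:
  fixes A B :: "'a::field^'n^'n"
  assumes "invertible A" "invertible B"
  shows "matrix_inv (A ** B) = matrix_inv B ** matrix_inv A"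
proof (rule matrix_inv_unique)
  have "A ** B ** (matrix_inv B ** matrix_inv A) = A ** (B ** matrix_inv B) ** matrix_inv A"
    by (simp add: matrix_mul_assoc)
  also have "\<dots> = mat 1" using assms by (simp add: matrix_inv_both)
  finally show "A ** B ** (matrix_inv B ** matrix_inv A) = mat 1" .
qed

section \<open>Block matrices\<close>

definition blk :: "'a^2^2 \<Rightarrow> 'a^2^2 \<Rightarrow> 'a^2^2 \<Rightarrow> 'a^2^2 \<Rightarrow> 'a^(2+2)^(2+2)" where
  "blk A B C D = (\<chi> i j. case (i, j) of
      (Inl a, Inl b) \<Rightarrow> A $ a $ b | (Inl a, Inr b) \<Rightarrow> B $ a $ b
    | (Inr a, Inl b) \<Rightarrow> C $ a $ b | (Inr a, Inr b) \<Rightarrow> D $ a $ b)"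

lemma blk_nth [simp]:
  "blk A B C D $ Inl a $ Inl b = A $ a $ b" "blk A B C D $ Inl a $ Inr b = B $ a $ b"
  "blk A B C D $ Inr a $ Inl b = C $ a $ b" "blk A B C D $ Inr a $ Inr b = D $ a $ b"
  by (simp_all add: blk_def)

lemma all_sum_type: "(\<forall>i. P i) \<longleftrightarrow> (\<forall>a. P (Inl a)) \<and> (\<forall>b. P (Inr b))"
  by (metis sum.exhaust)

lemma sum_sum_type: "(\<Sum>i\<in>UNIV. f (i :: 'a::finite + 'b::finite)) = (\<Sum>a\<in>UNIV. f (Inl a)) + (\<Sum>b\<in>UNIV. f (Inr b))"
  by (simp add: UNIV_Plus_UNIV[symmetric] sum.Plus del: UNIV_Plus_UNIV)

lemma blk_inject [simp]: "blk A B C D = blk A' B' C' D' \<longleftrightarrow> A = A' \<and> B = B' \<and> C = C' \<and> D = D'"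
  by (auto simp: vec_eq_iff all_sum_type)

lemma blk_cases: obtains A B C D where "M = blk A B C D"
proof
  show "M = blk (\<chi> i j. M $ Inl i $ Inl j) (\<chi> i j. M $ Inl i $ Inr j)
                (\<chi> i j. M $ Inr i $ Inl j) (\<chi> i j. M $ Inr i $ Inr j)"
    by (auto simp: vec_eq_iff all_sum_type)
qed

lemma blk_mult [simp]: "blk A B C D ** blk A' B' C' D' =
   blk (A ** A' + B ** C') (A ** B' + B ** D') (C ** A' + D ** C') (C ** B' + D ** (D' :: 'a::semiring_1^2^2))"
  by (simp add: vec_eq_iff all_sum_type matrix_matrix_mult_def sum_sum_type)

lemma blk_transpose [simp]: "transpose (blk A B C D) =
   blk (transpose A) (transpose C) (transpose B) (transpose D)"
  by (simp add: vec_eq_iff all_sum_type transpose_def)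

lemma blk_mat: "mat c = blk (mat c) 0 0 (mat c)"
  by (simp add: vec_eq_iff all_sum_type mat_def)

lemma J_blk: "J = blk 0 (mat 1) (- mat 1) 0"
  by (auto simp: vec_eq_iff all_sum_type J_def mat_def)

text \<open>The relation says that A B^T and C D^T are symmetric and that A D^T - B C^T is the
  scalar \<open>\<eta>\<close>. A skew matrix of size two has one free entry, so six scalar
  equations remain.\<close>

lemma symplectic_similitude_blk:
  "symplectic_similitude (blk (m2 a1 a2 a3 a4) (m2 b1 b2 b3 b4) (m2 c1 c2 c3 c4) (m2 d1 d2 d3 d4)) \<eta> \<longleftrightarrow>
    a1*b3 + a2*b4 = b1*a3 + b2*a4 \<and> c1*d3 + c2*d4 = d1*c3 + d2*c4 \<and>
    a1*d1 + a2*d2 - (b1*c1 + b2*c2) = \<eta> \<and> a1*d3 + a2*d4 - (b1*c3 + b2*c4) = 0 \<and>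
    a3*d1 + a4*d2 - (b3*c1 + b4*c2) = 0 \<and> a3*d3 + a4*d4 - (b3*c3 + b4*c4) = \<eta>"
  by (auto simp: symplectic_similitude_def J_blk blk_mat mat_m2 zero_m2 algebra_simps)

lemma symplectic_similitude_mult:
  assumes "symplectic_similitude g a" "symplectic_similitude h b"
  shows "symplectic_similitude (g ** h) (a * b)"
proof -
  \<comment> \<open>Scalar matrices are central, so the multiplier of \<open>h\<close> can be pulled
    out from between \<open>g\<close> and its transpose.\<close>
  have c: "g ** mat b = mat b ** g" for g :: mat4 and b
    by (cases g rule: blk_cases) (simp add: blk_mat mat2_eq_iff mat_m2 zero_m2 mult_2x2)
  have "g ** h ** J ** transpose (g ** h) = g ** (h ** J ** transpose h) ** transpose g"
    by (simp add: matrix_transpose_mul matrix_mul_assoc)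
  also have "\<dots> = g ** (mat b ** J) ** transpose g"
    using assms(2) by (simp add: symplectic_similitude_def)
  also have "\<dots> = (g ** mat b) ** J ** transpose g"
    by (simp only: matrix_mul_assoc)
  also have "\<dots> = mat b ** (g ** J ** transpose g)"
    by (simp only: matrix_mul_assoc c)
  also have "\<dots> = mat b ** (mat a ** J)"
    using assms(1) by (simp add: symplectic_similitude_def)
  also have "\<dots> = mat (a * b) ** J"
    by (simp add: J_blk blk_mat mat_m2 zero_m2 mult.commute)
  finally show ?thesis by (simp add: symplectic_similitude_def)
qed

lemma multiplier_eq:
  assumes "symplectic_similitude g a"
  shows "multiplier g = a"
proof -
  have "b = a" if "symplectic_similitude g b" for b
    using that assms by (auto simp: symplectic_similitude_def J_blk blk_mat mat_m2 zero_m2)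
  then show ?thesis unfolding multiplier_def using assms by blast
qed

section \<open>Trigonometric series on the Siegel half space\<close>

definition ee :: "complex \<Rightarrow> complex" where "ee t = exp (2 * of_real pi * \<i> * t)"

lemma ee_add: "ee (s + t) = ee s * ee t"
  by (simp add: ee_def exp_add distrib_left)

lemma ee_0 [simp]: "ee 0 = 1" by (simp add: ee_def)

lemma ee_of_int [simp]: "ee (of_int n) = 1"
  using exp_integer_2pi[of "of_int n"] by (simp add: ee_def mult_ac)

lemma ee_nonzero [simp]: "ee t \<noteq> 0"
  by (simp add: ee_def)

lemma norm_ee: "norm (ee t) = exp (- 2 * pi * Im t)"
  by (simp add: ee_def)

lemma ee_real: "ee (of_real x) = cis (2 * pi * x)"
  by (simp add: ee_def cis_conv_exp mult_ac)

lemma ee_eq_iff: "ee (of_real x) = ee (of_real y) \<longleftrightarrow> (\<exists>k::int. x = y + of_int k)"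
proof
  assume "ee (of_real x) = ee (of_real y)"
  then obtain n :: int where "2 * of_real pi * \<i> * of_real x = 2 * of_real pi * \<i> * of_real y + of_real (of_int (2 * n) * pi) * \<i>"
    unfolding ee_def exp_eq by blast
  then have "2 * of_real pi * \<i> * complex_of_real x = 2 * of_real pi * \<i> * (of_real y + of_int n)"
    by (simp add: algebra_simps)
  then have "complex_of_real x = of_real (y + of_int n)" by simp
  then show "\<exists>k::int. x = y + of_int k" using of_real_eq_iff by blast
next
  assume "\<exists>k::int. x = y + of_int k"
  then show "ee (of_real x) = ee (of_real y)" by (auto simp: ee_add)
qed

lemma continuous_on_ee [continuous_intros]:
  "continuous_on S f \<Longrightarrow> continuous_on S (\<lambda>x. ee (f x))"
  unfolding ee_def by (intro continuous_intros)

lemma holomorphic_on_ee [holomorphic_intros]: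
  "f holomorphic_on S \<Longrightarrow> (\<lambda>x. ee (f x)) holomorphic_on S"
  unfolding ee_def by (intro holomorphic_intros)

section \<open>Completeness of the trigonometric system on the three-dimensional torus\<close>

abbreviation cube :: "(real \<times> real \<times> real) set" where "cube \<equiv> cbox (0,0,0) (1,1,1)"

text \<open>Equals tr(S z) for S with diagonal \<open>n\<close>, \<open>m\<close> and off-diagonal
  entry \<open>r / 2\<close>: the half cancels against the two off-diagonal positions, so
  half-integral matrices become integer triples.\<close>

definition lin3 :: "int \<Rightarrow> int \<Rightarrow> int \<Rightarrow> 'a::ring_1 \<times> 'a \<times> 'a \<Rightarrow> 'a" where
  "lin3 n r m x = of_int n * fst x + of_int r * fst (snd x) + of_int m * snd (snd x)"

inductive trig_poly :: "(real \<times> real \<times> real \<Rightarrow> complex) \<Rightarrow> bool" where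
  monomial: "trig_poly (\<lambda>x. c * ee (of_real (lin3 n r m x)))"
| add: "trig_poly f \<Longrightarrow> trig_poly g \<Longrightarrow> trig_poly (\<lambda>x. f x + g x)"

lemma trig_poly_mult_monomial:
  assumes "trig_poly f" shows "trig_poly (\<lambda>x. c * ee (of_real (lin3 n r m x)) * f x)"
  using assms
proof induction
  case (monomial c' n' r' m')
  have "(\<lambda>x. c * ee (of_real (lin3 n r m x)) * (c' * ee (of_real (lin3 n' r' m' x)))) =
     (\<lambda>x. (c * c') * ee (of_real (lin3 (n + n') (r + r') (m + m') x)))"
    by (auto simp: lin3_def algebra_simps ee_add)
  then show ?case using trig_poly.monomial by metis
next
  case (add f g)
  then show ?case using trig_poly.add by (simp add: distrib_left)
qed

lemma trig_poly_mult:
  assumes "trig_poly f" "trig_poly g" shows "trig_poly (\<lambda>x. f x * g x)"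
  using assms
proof induction
  case (monomial c n r m)
  then show ?case by (rule trig_poly_mult_monomial)
next
  case (add f g)
  then show ?case using trig_poly.add by (simp add: distrib_right)
qed

lemma trig_poly_const: "trig_poly (\<lambda>x. c)"
  using trig_poly.monomial[of c 0 0 0] by (simp add: lin3_def)

lemma trig_poly_cmult: "trig_poly f \<Longrightarrow> trig_poly (\<lambda>x. c * f x)"
  using trig_poly_mult[OF trig_poly_const] .

text \<open>Realises the quotient of R^3 by Z^3 as a compact subset of C^3. Real polynomials in the
  coordinates restrict to trigonometric polynomials, which makes the polynomial Stone-Weierstrass
  theorem applicable.\<close>

definition torus :: "real \<times> real \<times> real \<Rightarrow> complex \<times> complex \<times> complex" where
  "torus x = (ee (of_real (fst x)), ee (of_real (fst (snd x))), ee (of_real (snd (snd x))))"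

lemma Re_Im_ee:
  "of_real (Re (ee (of_real t))) = 1/2 * ee (of_real t) + 1/2 * ee (of_real (- t))"
  "of_real (Im (ee (of_real t))) = -\<i>/2 * ee (of_real t) + \<i>/2 * ee (of_real (- t))"
  by (simp_all only: ee_real) (simp_all add: complex_eq_iff)

lemma trig_poly_real_polynomial_function:
  assumes "real_polynomial_function P"
  shows "trig_poly (\<lambda>x. of_real (P (torus x)))"
  using assms
proof induction
  case (linear f)
  interpret bounded_linear f by fact
  have f0: "f w = Re (fst w) * f (1,0,0) + Im (fst w) * f (\<i>,0,0) + Re (fst (snd w)) * f (0,1,0)
      + Im (fst (snd w)) * f (0,\<i>,0) + Re (snd (snd w)) * f (0,0,1) + Im (snd (snd w)) * f (0,0,\<i>)" for w
  proof -
    have "w = Re (fst w) *\<^sub>R (1,0,0) + Im (fst w) *\<^sub>R (\<i>,0,0) + Re (fst (snd w)) *\<^sub>R (0,1,0)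
      + Im (fst (snd w)) *\<^sub>R (0,\<i>,0) + Re (snd (snd w)) *\<^sub>R (0,0,1) + Im (snd (snd w)) *\<^sub>R (0,0,\<i>)"
      by (cases w) (simp add: complex_eq_iff zero_prod_def)
    then have "f w = f (Re (fst w) *\<^sub>R (1,0,0) + Im (fst w) *\<^sub>R (\<i>,0,0) + Re (fst (snd w)) *\<^sub>R (0,1,0)
      + Im (fst (snd w)) *\<^sub>R (0,\<i>,0) + Re (snd (snd w)) *\<^sub>R (0,0,1) + Im (snd (snd w)) *\<^sub>R (0,0,\<i>))"
      by simp
    then show ?thesis by (simp only: add scaleR) simp
  qed
  obtain a1 a2 a3 a4 a5 a6 where f: "\<And>w. f w = Re (fst w) * a1 + Im (fst w) * a2 + Re (fst (snd w)) * a3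
      + Im (fst (snd w)) * a4 + Re (snd (snd w)) * a5 + Im (snd (snd w)) * a6"
    using f0 by blast
  have 1: "trig_poly (\<lambda>x. c * ee (of_real (fst x)) + c' * ee (of_real (- fst x)))" for c c'
    using trig_poly.add[OF trig_poly.monomial[of c 1 0 0] trig_poly.monomial[of c' "-1" 0 0]]
    by (simp add: lin3_def)
  have 2: "trig_poly (\<lambda>x. c * ee (of_real (fst (snd x))) + c' * ee (of_real (- fst (snd x))))" for c c'
    using trig_poly.add[OF trig_poly.monomial[of c 0 1 0] trig_poly.monomial[of c' 0 "-1" 0]]
    by (simp add: lin3_def)
  have 3: "trig_poly (\<lambda>x. c * ee (of_real (snd (snd x))) + c' * ee (of_real (- snd (snd x))))" for c c'
    using trig_poly.add[OF trig_poly.monomial[of c 0 0 1] trig_poly.monomial[of c' 0 0 "-1"]]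
    by (simp add: lin3_def)
  show ?case
    unfolding f torus_def fst_conv snd_conv of_real_add of_real_mult Re_Im_ee
    by (intro trig_poly.add trig_poly_mult trig_poly_const 1 2 3)
next
  case (const c)
  show ?case by (rule trig_poly_const)
next
  case (add f g)
  then show ?case by (simp add: trig_poly.add)
next
  case (mult f g)
  then show ?case by (simp add: trig_poly_mult)
qed

lemma continuous_on_trig_poly: "trig_poly f \<Longrightarrow> continuous_on S f"
  by (induction rule: trig_poly.induct) (auto intro!: continuous_intros simp: lin3_def)

lemma integral_trig_poly_zero:
  assumes cont: "continuous_on cube h"
    and zero: "\<And>n r m. integral cube (\<lambda>x. h x * ee (of_real (lin3 n r m x))) = 0"
    and "trig_poly f"
  shows "integral cube (\<lambda>x. h x * f x) = 0"
  using \<open>trig_poly f\<close>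
proof induction
  case (monomial c n r m)
  have "(\<lambda>x. h x * (c * ee (of_real (lin3 n r m x)))) = (\<lambda>x. c * (h x * ee (of_real (lin3 n r m x))))"
    by (simp add: mult_ac)
  then show ?case using zero by simp
next
  case (add f g)
  have "(\<lambda>x. h x * f x) integrable_on cube" "(\<lambda>x. h x * g x) integrable_on cube"
    by (intro integrable_continuous continuous_intros cont continuous_on_trig_poly add)+
  then show ?case using add by (simp add: distrib_left integral_add)
qed

lemma continuous_on_torus: "continuous_on S torus"
  unfolding torus_def by (intro continuous_intros)

lemma periodic_int:
  fixes g :: "real \<Rightarrow> 'a"
  assumes "\<And>x. g (x + 1) = g x" shows "g (x + of_int k) = g x"
proof -
  have nat: "g (x + of_nat n) = g x" for n x
  proof (induction n)
    case (Suc n) then show ?case using assms[of "x + of_nat n"] by (simp add: add_ac)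
  qed simp
  show ?thesis
  proof (cases "k \<ge> 0")
    case True then show ?thesis using nat[of x "nat k"] by simp
  next
    case False then show ?thesis using nat[of "x + of_int k" "nat (-k)"] by simp
  qed
qed

text \<open>Uniform approximation of the conjugate of \<open>h\<close> by trigonometric polynomials
  turns the vanishing of all Fourier integrals into the vanishing of the integral of |h|^2;
  periodicity carries the conclusion from the cube to the whole space.\<close>

lemma fourier_zero:
  fixes h :: "real \<times> real \<times> real \<Rightarrow> complex"
  assumes cont: "continuous_on UNIV h"
    and per: "\<And>a b c. h (a + 1, b, c) = h (a, b, c)" "\<And>a b c. h (a, b + 1, c) = h (a, b, c)"
      "\<And>a b c. h (a, b, c + 1) = h (a, b, c)"
    and zero: "\<And>n r m. integral cube (\<lambda>x. h x * ee (of_real (lin3 n r m x))) = 0"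
  shows "h x = 0"
proof -
  have hper: "h (a + of_int k, b + of_int l, c + of_int m) = h (a, b, c)" for a b c k l m
    using periodic_int[of "\<lambda>a. h (a, b + of_int l, c + of_int m)" a k]
      periodic_int[of "\<lambda>b. h (a, b, c + of_int m)" b l] periodic_int[of "\<lambda>c. h (a, b, c)" c m] per
    by metis
  have hE: "h x = h y" if "torus x = torus y" for x y
  proof -
    obtain a b c a' b' c' where xy: "x = (a, b, c)" "y = (a', b', c')" by (metis prod.exhaust)
    then have "ee (of_real a) = ee (of_real a')" "ee (of_real b) = ee (of_real b')" "ee (of_real c) = ee (of_real c')"
      using that by (auto simp: torus_def)
    then obtain k l m where "a = a' + of_int k" "b = b' + of_int l" "c = c' + of_int m"
      unfolding ee_eq_iff by blast
    then show ?thesis using hper xy by simp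
  qed
  \<comment> \<open>\<open>h\<close> descends to a function on the compact image of
    \<open>torus\<close>; by \<open>hE\<close> any preimage in the cube may be chosen.\<close>
  define G where "G w = h (SOME x. x \<in> cube \<and> torus x = w)" for w
  have G: "G (torus x) = h x" if "x \<in> cube" for x
  proof -
    have "(SOME y. y \<in> cube \<and> torus y = torus x) \<in> cube \<and> torus (SOME y. y \<in> cube \<and> torus y = torus x) = torus x"
      by (rule someI[of _ x]) (use that in simp)
    then show ?thesis unfolding G_def using hE by blast
  qed
  have compT: "compact (torus ` cube)"
    by (intro compact_continuous_image continuous_on_torus compact_cbox)
  \<comment> \<open>The preimage of a closed set under \<open>G\<close> is the image under
    \<open>torus\<close> of a compact part of the cube, hence closed.\<close>
  have contG: "continuous_on (torus ` cube) G"
  proof -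
    have "closed (G -` B \<inter> torus ` cube)" if "closed B" for B
    proof -
      have eq: "G -` B \<inter> torus ` cube = torus ` (h -` B \<inter> cube)"
        using G by auto
      have "closed (h -` B)" using continuous_on_closed_vimage[of UNIV h] cont that by simp
      then have "compact (h -` B \<inter> cube)" by (simp add: closed_Int_compact)
      then show ?thesis unfolding eq
        by (intro compact_imp_closed compact_continuous_image continuous_on_torus)
    qed
    then show ?thesis
      using continuous_on_closed_vimage[OF compact_imp_closed[OF compT]] by blast
  qed
  have contc: "continuous_on cube h" using cont continuous_on_subset by blast
  obtain B where B: "\<And>x. x \<in> cube \<Longrightarrow> norm (h x) \<le> B" "B > 0"
    using compact_imp_bounded[OF compact_continuous_image[OF contc compact_cbox]]
    by (auto simp: bounded_pos)
  have "norm (integral cube (\<lambda>x. h x * cnj (h x))) \<le> e" if "e > 0" for e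
  proof -
    define d where "d = e / (2 * B)"
    have d: "d > 0" using that B by (simp add: d_def)
    obtain P where P: "real_polynomial_function P" "\<And>w. w \<in> torus ` cube \<Longrightarrow> \<bar>Re (G w) - P w\<bar> < d"
      using Stone_Weierstrass_real_polynomial_function[OF compT continuous_on_Re[OF contG] d] by blast
    obtain Q where Q: "real_polynomial_function Q" "\<And>w. w \<in> torus ` cube \<Longrightarrow> \<bar>Im (G w) - Q w\<bar> < d"
      using Stone_Weierstrass_real_polynomial_function[OF compT continuous_on_Im[OF contG] d] by blast
    \<comment> \<open>\<open>t\<close> approximates the conjugate of \<open>h\<close>, hence the
      sign of the imaginary part; the error is at most \<open>2 * d\<close>, and \<open>d\<close> is
      scaled so that the final bound is \<open>e\<close>.\<close>
    define t where "t x = of_real (P (torus x)) + (-\<i>) * of_real (Q (torus x))" for x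
    have tp: "trig_poly t" unfolding t_def
      by (intro trig_poly.add trig_poly_cmult trig_poly_real_polynomial_function P Q)
    have "integral cube (\<lambda>x. h x * t x) = 0"
      by (rule integral_trig_poly_zero[OF contc zero tp])
    moreover have "(\<lambda>x. h x * t x) integrable_on cube" "(\<lambda>x. h x * cnj (h x)) integrable_on cube"
      by (intro integrable_continuous continuous_intros contc continuous_on_trig_poly tp)+
    ultimately have eq: "integral cube (\<lambda>x. h x * cnj (h x)) = integral cube (\<lambda>x. h x * (cnj (h x) - t x))"
      by (simp add: right_diff_distrib integral_diff)
    have bd: "norm (h x * (cnj (h x) - t x)) \<le> B * (2 * d)" if "x \<in> cube" for x
    proof -
      have "norm (cnj (h x) - t x) \<le> \<bar>Re (cnj (h x) - t x)\<bar> + \<bar>Im (cnj (h x) - t x)\<bar>"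
        by (rule cmod_le)
      also have "\<dots> = \<bar>Re (G (torus x)) - P (torus x)\<bar> + \<bar>Im (G (torus x)) - Q (torus x)\<bar>"
        by (simp add: t_def G[OF that])
      also have "\<dots> \<le> 2 * d" using P(2)[of "torus x"] Q(2)[of "torus x"] that by force
      finally show ?thesis unfolding norm_mult using B that by (intro mult_mono) auto
    qed
    have "norm (integral cube (\<lambda>x. h x * (cnj (h x) - t x))) \<le> B * (2 * d) * measure lborel cube"
      by (rule has_integral_bound[OF _ integrable_integral])
        (use bd B d in \<open>auto intro!: integrable_continuous continuous_intros contc continuous_on_trig_poly[OF tp]\<close>)
    also have "measure lborel cube = 1" by (simp add: content_Pair)
    also have "B * (2 * d) * 1 = e" using B by (simp add: d_def)
    finally show ?thesis unfolding eq .
  qed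
  then have 0: "integral cube (\<lambda>x. h x * cnj (h x)) = 0"
    using field_le_epsilon[of "norm (integral cube (\<lambda>x. h x * cnj (h x)))" 0] by simp
  have "integral cube (\<lambda>x. (norm (h x))\<^sup>2) = 0"
  proof -
    have "integral cube (\<lambda>x. (norm (h x))\<^sup>2) = integral cube (\<lambda>x. Re (h x * cnj (h x)))"
      by (simp add: complex_mult_cnj cmod_power2)
    also have "\<dots> = Re (integral cube (\<lambda>x. h x * cnj (h x)))"
      by (intro integral_linear[OF _ bounded_linear_Re, unfolded o_def] integrable_continuous continuous_intros contc)
    finally show ?thesis by (simp add: 0)
  qed
  moreover have "(1/2::real,1/2::real,1/2::real) \<in> box (0,0,0) (1,1,1)"
    by (auto simp: mem_box Basis_prod_def)
  then have "box (0::real,0::real,0::real) (1,1,1) \<noteq> {}" by blast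
  moreover have "continuous_on cube (\<lambda>x. (norm (h x))\<^sup>2)"
    by (intro continuous_intros contc)
  ultimately have h0: "h x = 0" if "x \<in> cube" for x
    using integral_cbox_eq_0_iff[of "(0,0,0)" "(1,1,1)" "\<lambda>x. (norm (h x))\<^sup>2"] that by auto
  obtain a b c where x: "x = (a, b, c)" by (metis prod.exhaust)
  have "h x = h (frac a, frac b, frac c)"
    using hper[of "frac a" "\<lfloor>a\<rfloor>" "frac b" "\<lfloor>b\<rfloor>" "frac c" "\<lfloor>c\<rfloor>"] by (simp add: x frac_def)
  also have "\<dots> = 0"
    by (rule h0) (simp add: cbox_Pair_eq frac_lt_1 less_imp_le)
  finally show ?thesis .
qed

section \<open>Periodic holomorphic functions in the coordinates of the Siegel half space\<close>

definition pd :: "real \<Rightarrow> real \<Rightarrow> real \<Rightarrow> bool" where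
  "pd y1 y2 y3 \<longleftrightarrow> 0 < y1 \<and> 0 < y3 \<and> y2\<^sup>2 < y1 * y3"

text \<open>Coordinates (z11, z12, z22) of a symmetric matrix whose imaginary part is positive
  definite, with \<open>pd\<close> as the criterion by principal minors.\<close>

definition H3 :: "(complex \<times> complex \<times> complex) set" where
  "H3 = {(a, b, c). pd (Im a) (Im b) (Im c)}"

text \<open>A primitive on the convex strip changes by a constant under translation by 1, because
  the derivative of the difference vanishes by periodicity. That constant is the integral over a
  period at every height.\<close>

lemma periodic_holomorphic_integral_shift:
  assumes T: "open T" "convex T" "y \<in> T" "y' \<in> T"
    and hol: "\<phi> holomorphic_on {z. Im z \<in> T}"
    and per: "\<And>z. Im z \<in> T \<Longrightarrow> \<phi> (z + 1) = \<phi> z"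
  shows "integral (cbox 0 1) (\<lambda>x. \<phi> (Complex x y)) = integral (cbox 0 1) (\<lambda>x. \<phi> (Complex x y'))"
proof -
  let ?S = "{z. Im z \<in> T}"
  have S: "?S = Im -` T" by auto
  have opS: "open ?S" unfolding S by (intro open_vimage T continuous_intros)
  have convS: "convex ?S" using \<open>convex T\<close> unfolding convex_def by auto
  obtain \<Phi> where \<Phi>: "\<And>z. z \<in> ?S \<Longrightarrow> (\<Phi> has_field_derivative \<phi> z) (at z within ?S)"
    using holomorphic_convex_primitive'[OF convS opS hol] by blast
  then have \<Phi>': "(\<Phi> has_field_derivative \<phi> z) (at z)" if "Im z \<in> T" for z
    using that opS by (metis at_within_open mem_Collect_eq)
  have "\<exists>c. \<forall>z\<in>?S. \<Phi> (z + 1) - \<Phi> z = c"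
  proof (rule has_field_derivative_zero_constant[OF convS])
    fix z assume z: "z \<in> ?S"
    have "((\<lambda>z. \<Phi> (z + 1)) has_field_derivative \<phi> (z + 1)) (at z)"
      using \<Phi>'[of "z + 1"] z by (simp add: DERIV_shift[symmetric] add.commute)
    then have "((\<lambda>z. \<Phi> (z + 1) - \<Phi> z) has_field_derivative \<phi> (z + 1) - \<phi> z) (at z)"
      using \<Phi>'[of z] z by (intro DERIV_diff) auto
    then show "((\<lambda>z. \<Phi> (z + 1) - \<Phi> z) has_field_derivative 0) (at z within ?S)"
      using per z by (simp add: has_field_derivative_at_within)
  qed
  then obtain c where c: "\<And>z. Im z \<in> T \<Longrightarrow> \<Phi> (z + 1) - \<Phi> z = c" by auto
  have "integral (cbox 0 1) (\<lambda>x. \<phi> (Complex x y)) = c" if "y \<in> T" for y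
  proof -
    have "((\<lambda>x. \<Phi> (Complex x y)) has_vector_derivative \<phi> (Complex x y)) (at x within {0..1})" for x
    proof -
      have "((\<lambda>x. Complex x y) has_vector_derivative 1) (at x within {0..1})"
        by (auto simp: Complex_eq intro!: derivative_eq_intros)
      from field_vector_diff_chain_within[OF this has_field_derivative_at_within[OF \<Phi>'[of "Complex x y"]]]
      show ?thesis using that by (simp add: o_def)
    qed
    then have "((\<lambda>x. \<phi> (Complex x y)) has_integral (\<Phi> (Complex 1 y) - \<Phi> (Complex 0 y))) {0..1}"
      by (intro fundamental_theorem_of_calculus) auto
    moreover have "Complex 1 y = Complex 0 y + 1" by (simp add: complex_eq_iff)
    then have "\<Phi> (Complex 1 y) - \<Phi> (Complex 0 y) = c" using c[of "Complex 0 y"] that by simp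
    ultimately show ?thesis by (simp add: integral_unique)
  qed
  then show ?thesis using T by simp
qed

definition cpt :: "real \<times> real \<times> real \<Rightarrow> real \<times> real \<times> real \<Rightarrow> complex \<times> complex \<times> complex" where
  "cpt y x = (Complex (fst x) (fst y), Complex (fst (snd x)) (fst (snd y)), Complex (snd (snd x)) (snd (snd y)))"

lemma cpt_H3: "cpt (y1, y2, y3) x \<in> H3 \<longleftrightarrow> pd y1 y2 y3"
  by (simp add: cpt_def H3_def)

lemma continuous_on_cpt: "continuous_on S (\<lambda>x. cpt y x)"
  unfolding cpt_def by (intro continuous_intros)

text \<open>Joint continuity with holomorphy in each variable separately suffices: contours are
  shifted in one variable at a time, and Fubini needs only continuity.\<close>

locale periodic_hol =
  fixes f :: "complex \<times> complex \<times> complex \<Rightarrow> complex"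
  assumes cont: "continuous_on H3 f"
    and hol1: "\<And>b c. (\<lambda>a. f (a, b, c)) holomorphic_on {a. (a, b, c) \<in> H3}"
    and hol2: "\<And>a c. (\<lambda>b. f (a, b, c)) holomorphic_on {b. (a, b, c) \<in> H3}"
    and hol3: "\<And>a b. (\<lambda>c. f (a, b, c)) holomorphic_on {c. (a, b, c) \<in> H3}"
    and per1: "\<And>a b c. (a, b, c) \<in> H3 \<Longrightarrow> f (a + 1, b, c) = f (a, b, c)"
    and per2: "\<And>a b c. (a, b, c) \<in> H3 \<Longrightarrow> f (a, b + 1, c) = f (a, b, c)"
    and per3: "\<And>a b c. (a, b, c) \<in> H3 \<Longrightarrow> f (a, b, c + 1) = f (a, b, c)"
begin

text \<open>The zeroth Fourier coefficient at height \<open>y\<close>. \<open>mean_const\<close>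
  shows that it does not depend on \<open>y\<close>; the other coefficients follow by
  twisting.\<close>

definition mean :: "real \<times> real \<times> real \<Rightarrow> complex" where
  "mean y = integral cube (\<lambda>x. f (cpt y x))"

lemma continuous_on_slice:
  assumes "pd y1 y2 y3" shows "continuous_on S (\<lambda>x. f (cpt (y1, y2, y3) x))"
proof -
  have "continuous_on UNIV (\<lambda>x. f (cpt (y1, y2, y3) x))"
    by (rule continuous_on_compose2[OF cont continuous_on_cpt]) (use assms cpt_H3 in auto)
  then show ?thesis using continuous_on_subset by blast
qed

text \<open>Fubini in the three orders that place the variable to be shifted innermost.\<close>

lemma mean_iterated:
  assumes "pd y1 y2 y3"
  shows "mean (y1, y2, y3) = integral (cbox (0,0) (1,1)) (\<lambda>q. integral (cbox 0 1)
      (\<lambda>x1. f (cpt (y1, y2, y3) (x1, fst q, snd q))))" (is ?A)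
    and "mean (y1, y2, y3) = integral (cbox 0 1) (\<lambda>x1. integral (cbox 0 1) (\<lambda>x3.
      integral (cbox 0 1) (\<lambda>x2. f (cpt (y1, y2, y3) (x1, x2, x3)))))" (is ?B)
    and "mean (y1, y2, y3) = integral (cbox 0 1) (\<lambda>x1. integral (cbox 0 1) (\<lambda>x2.
      integral (cbox 0 1) (\<lambda>x3. f (cpt (y1, y2, y3) (x1, x2, x3)))))" (is ?C)
proof -
  let ?g = "\<lambda>x. f (cpt (y1, y2, y3) x)"
  note cs = continuous_on_slice[OF assms]
  have 0: "mean (y1, y2, y3) = integral (cbox 0 1) (\<lambda>x1. integral (cbox (0,0) (1,1)) (\<lambda>q. ?g (x1, q)))"
    unfolding mean_def by (rule integral_prod_continuous) (rule cs)
  also have "\<dots> = integral (cbox (0,0) (1,1)) (\<lambda>q. integral (cbox 0 1) (\<lambda>x1. ?g (x1, q)))"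
    by (rule integral_swap_continuous) (simp add: case_prod_beta' cs)
  finally show ?A by simp
  have c2: "continuous_on S (\<lambda>q. ?g (x1, q))" for S x1
    by (rule continuous_on_compose2[OF cs[of UNIV]]) (auto intro!: continuous_intros)
  have 1: "integral (cbox (0,0) (1,1)) (\<lambda>q. ?g (x1, q)) =
      integral (cbox 0 1) (\<lambda>x2. integral (cbox 0 1) (\<lambda>x3. ?g (x1, x2, x3)))" for x1
    by (rule integral_prod_continuous) (rule c2)
  then show ?C using 0 by simp
  have "integral (cbox 0 1) (\<lambda>x2. integral (cbox 0 1) (\<lambda>x3. ?g (x1, x2, x3)))
     = integral (cbox 0 1) (\<lambda>x3. integral (cbox 0 1) (\<lambda>x2. ?g (x1, x2, x3)))" for x1
    by (rule integral_swap_continuous) (simp add: case_prod_beta' c2)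
  then show ?B using 0 1 by simp
qed

lemma mean_shift1:
  assumes "pd y1 y2 y3" "pd y1' y2 y3" shows "mean (y1, y2, y3) = mean (y1', y2, y3)"
  unfolding mean_iterated(1)[OF assms(1)] mean_iterated(1)[OF assms(2)]
proof (rule integral_cong)
  fix q
  let ?T = "{y. pd y y2 y3}"
  have "0 < x" if "y2\<^sup>2 < x * y3" "0 < y3" for x
    using that by (metis zero_le_power2 order_le_less_trans zero_less_mult_pos2)
  \<comment> \<open>The admissible heights in this variable form an open half-line, hence an open
    convex set, as the contour shift requires.\<close>
  then have T: "?T = {y2\<^sup>2 / y3 <..}" using assms by (auto simp: pd_def field_simps)
  have "(\<lambda>a. f (a, Complex (fst q) y2, Complex (snd q) y3)) holomorphic_on {a. Im a \<in> ?T}"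
    using hol1[of "Complex (fst q) y2" "Complex (snd q) y3"] by (simp add: H3_def)
  then show "integral (cbox 0 1) (\<lambda>x1. f (cpt (y1, y2, y3) (x1, fst q, snd q))) =
      integral (cbox 0 1) (\<lambda>x1. f (cpt (y1', y2, y3) (x1, fst q, snd q)))"
    unfolding cpt_def fst_conv snd_conv
    by (intro periodic_holomorphic_integral_shift[where T = ?T and \<phi> = "\<lambda>a. f (a, Complex (fst q) y2, Complex (snd q) y3)"] per1)
       (use assms T in \<open>auto simp: H3_def\<close>)
qed

lemma mean_shift2:
  assumes "pd y1 y2 y3" "pd y1 y2' y3" shows "mean (y1, y2, y3) = mean (y1, y2', y3)"
proof -
  let ?T = "{y. pd y1 y y3}"
  have T: "?T = {- sqrt (y1 * y3) <..< sqrt (y1 * y3)}"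
  proof -
    have "y\<^sup>2 < y1 * y3 \<longleftrightarrow> \<bar>y\<bar> < sqrt (y1 * y3)" for y
      using real_sqrt_less_iff[of "y\<^sup>2" "y1 * y3"] by (simp only: real_sqrt_abs)
    then have "pd y1 y y3 \<longleftrightarrow> \<bar>y\<bar> < sqrt (y1 * y3)" for y using assms by (simp only: pd_def simp_thms)
    moreover have "{y. \<bar>y\<bar> < s} = {- s <..< s}" for s :: real by auto
    ultimately show ?thesis by (simp only:)
  qed
  have "integral (cbox 0 1) (\<lambda>x2. f (cpt (y1, y2, y3) (x1, x2, x3))) =
      integral (cbox 0 1) (\<lambda>x2. f (cpt (y1, y2', y3) (x1, x2, x3)))" for x1 x3
  proof -
    have "(\<lambda>b. f (Complex x1 y1, b, Complex x3 y3)) holomorphic_on {a. Im a \<in> ?T}"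
      using hol2[of "Complex x1 y1" "Complex x3 y3"] by (simp add: H3_def)
    then show ?thesis
    unfolding cpt_def fst_conv snd_conv
    by (intro periodic_holomorphic_integral_shift[where T = ?T and \<phi> = "\<lambda>a. f (Complex x1 y1, a, Complex x3 y3)"] per2)
       (use assms T in \<open>auto simp: H3_def\<close>)
  qed
  then show ?thesis unfolding mean_iterated(2)[OF assms(1)] mean_iterated(2)[OF assms(2)] by simp
qed

lemma mean_shift3:
  assumes "pd y1 y2 y3" "pd y1 y2 y3'" shows "mean (y1, y2, y3) = mean (y1, y2, y3')"
proof -
  let ?T = "{y. pd y1 y2 y}"
  have "0 < x" if "y2\<^sup>2 < y1 * x" "0 < y1" for x
    using that by (metis zero_le_power2 order_le_less_trans zero_less_mult_pos)
  then have T: "?T = {y2\<^sup>2 / y1 <..}" using assms by (auto simp: pd_def field_simps)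
  have "integral (cbox 0 1) (\<lambda>x3. f (cpt (y1, y2, y3) (x1, x2, x3))) =
      integral (cbox 0 1) (\<lambda>x3. f (cpt (y1, y2, y3') (x1, x2, x3)))" for x1 x2
  proof -
    have "(\<lambda>b. f (Complex x1 y1, Complex x2 y2, b)) holomorphic_on {a. Im a \<in> ?T}"
      using hol3[of "Complex x1 y1" "Complex x2 y2"] by (simp add: H3_def)
    then show ?thesis
    unfolding cpt_def fst_conv snd_conv
    by (intro periodic_holomorphic_integral_shift[where T = ?T and \<phi> = "\<lambda>a. f (Complex x1 y1, Complex x2 y2, a)"] per3)
       (use assms T in \<open>auto simp: H3_def\<close>)
  qed
  then show ?thesis unfolding mean_iterated(3)[OF assms(1)] mean_iterated(3)[OF assms(2)] by simp
qed

lemma mean_const: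
  assumes "pd y1 y2 y3" "pd y1' y2' y3'" shows "mean (y1, y2, y3) = mean (y1', y2', y3')"
proof -
  \<comment> \<open>Any two positive definite heights are joined by changing one coordinate at a
    time: both diagonal entries are raised to \<open>M\<close>, which leaves room to change
    \<open>y2\<close>, and are then lowered again.\<close>
  define M where "M = 1 + max (max y1 y1') (max y3 y3')"
  have M: "y1 < M" "y1' < M" "y3 < M" "y3' < M" "M > 0" using assms by (auto simp: M_def pd_def)
  have le: "a * b \<le> a * M" "a * M \<le> M * M" if "a > 0" "a < M" "b < M" for a b
    using that by (auto intro!: mult_left_mono mult_right_mono)
  have 1: "pd y1 y2 M" "pd y1' y2' M" and 2: "pd M y2 M" "pd M y2' M"
    using assms M le unfolding pd_def by (meson order_less_le_trans)+
  have "mean (y1, y2, y3) = mean (y1, y2, M)" by (rule mean_shift3) fact+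
  also have "\<dots> = mean (M, y2, M)" by (rule mean_shift1) fact+
  also have "\<dots> = mean (M, y2', M)" by (rule mean_shift2) fact+
  also have "\<dots> = mean (y1', y2', M)" by (rule mean_shift1) fact+
  also have "\<dots> = mean (y1', y2', y3')" by (rule mean_shift3) fact+
  finally show ?thesis .
qed

end

section \<open>Absolute convergence and the Fourier expansion\<close>

lemma summable_exp_int:
  assumes "(c::real) > 0" shows "(\<lambda>n::int. exp (- c * \<bar>of_int n\<bar>)) summable_on UNIV"
proof -
  let ?g = "\<lambda>n::int. exp (- c * \<bar>of_int n\<bar>)"
  have "summable (\<lambda>n. exp (- c) ^ n)" using assms by (intro summable_geometric) auto
  then have nat: "(\<lambda>n::nat. exp (- c) ^ n) summable_on UNIV"
    by (intro norm_summable_imp_summable_on) simp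
  have e: "exp (- c) ^ n = exp (- c * of_nat n)" for n by (simp add: exp_of_nat_mult[symmetric] mult.commute)
  have nat': "(\<lambda>n::nat. exp (- c * of_nat n)) summable_on UNIV"
    using nat by (simp only: e)
  have eq: "?g \<circ> int = (\<lambda>n::nat. exp (- c * of_nat n))" "?g \<circ> (\<lambda>n. - int n) = (\<lambda>n::nat. exp (- c * of_nat n))"
    by (simp_all add: fun_eq_iff)
  have inj: "inj (\<lambda>n. - int n)" by (simp add: inj_def)
  have "?g summable_on range int"
    unfolding summable_on_reindex[OF inj_of_nat] eq by (rule nat')
  moreover have "?g summable_on range (\<lambda>n. - int n)"
    unfolding summable_on_reindex[OF inj] eq by (rule nat')
  ultimately have "?g summable_on (range int \<union> range (\<lambda>n. - int n))"
    by (intro summable_on_union)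
  moreover have "x \<in> range int \<union> range (\<lambda>n. - int n)" for x
    by (cases x rule: int_cases2) auto
  then have "range int \<union> range (\<lambda>n. - int n) = UNIV" by blast
  ultimately show ?thesis by simp
qed

lemma summable_on_Times_product:
  fixes f :: "'a \<Rightarrow> real" and g :: "'b \<Rightarrow> real"
  assumes "f summable_on UNIV" "g summable_on UNIV" "\<And>x. f x \<ge> 0" "\<And>x. g x \<ge> 0"
  shows "(\<lambda>(x, y). f x * g y) summable_on UNIV"
proof -
  have "(\<lambda>(x, y). f x * g y) summable_on (SIGMA x:UNIV. UNIV)"
  proof (rule summable_on_SigmaI)
    show "((\<lambda>y. case (x, y) of (x, y) \<Rightarrow> f x * g y) has_sum f x * infsum g UNIV) UNIV" for x
      using assms(2) by (simp add: has_sum_cmult_right)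
    show "(\<lambda>x. f x * infsum g UNIV) summable_on UNIV"
      by (intro summable_on_cmult_left assms)
  qed (use assms in auto)
  then show ?thesis by simp
qed

text \<open>Positive definiteness is an open condition, so all eight corners of a small cube around
  the height are admissible. The corners provide the decay in
  \<open>coeff_abs_summable\<close>.\<close>

lemma pd_nbhd:
  assumes "pd y1 y2 y3"
  obtains e where "e > 0" "\<And>s1 s2 s3. {s1, s2, s3} \<subseteq> {-1, 1} \<Longrightarrow> pd (y1 + s1 * e) (y2 + s2 * e) (y3 + s3 * e)"
proof -
  have "\<forall>\<^sub>F e in at_right 0. pd (y1 + s1 * e) (y2 + s2 * e) (y3 + s3 * e)" for s1 s2 s3
  proof -
    have L: "((\<lambda>e. y1 + s1 * e) \<longlongrightarrow> y1 + s1 * 0) (at_right 0)"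
      "((\<lambda>e. y3 + s3 * e) \<longlongrightarrow> y3 + s3 * 0) (at_right 0)"
      "((\<lambda>e. (y1 + s1 * e) * (y3 + s3 * e) - (y2 + s2 * e)\<^sup>2) \<longlongrightarrow> (y1 + s1 * 0) * (y3 + s3 * 0) - (y2 + s2 * 0)\<^sup>2) (at_right 0)"
      by (intro tendsto_intros)+
    have "\<forall>\<^sub>F e in at_right 0. 0 < y1 + s1 * e" "\<forall>\<^sub>F e in at_right 0. 0 < y3 + s3 * e"
      "\<forall>\<^sub>F e in at_right 0. 0 < (y1 + s1 * e) * (y3 + s3 * e) - (y2 + s2 * e)\<^sup>2"
      using assms order_tendstoD(1)[OF L(1), of 0] order_tendstoD(1)[OF L(2), of 0] order_tendstoD(1)[OF L(3), of 0]
      by (simp_all add: pd_def)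
    then show ?thesis by eventually_elim (simp add: pd_def)
  qed
  note ev = this
  have "\<forall>\<^sub>F e in at_right 0. \<forall>s \<in> {-1,1}\<times>{-1,1}\<times>{-1,1}. pd (y1 + fst s * e) (y2 + fst (snd s) * e) (y3 + snd (snd s) * e)"
    by (intro eventually_ball_finite ballI ev) simp
  moreover have "\<forall>\<^sub>F e in at_right (0::real). e > 0" by (simp add: eventually_at_right_less)
  ultimately have "\<forall>\<^sub>F e in at_right 0. e > 0 \<and> (\<forall>s \<in> {-1,1}\<times>{-1,1}\<times>{-1,1}. pd (y1 + fst s * e) (y2 + fst (snd s) * e) (y3 + snd (snd s) * e))"
    by eventually_elim simp
  then obtain e where "e > 0" "\<forall>s \<in> {-1,1}\<times>{-1,1}\<times>{-1,1}. pd (y1 + fst s * e) (y2 + fst (snd s) * e) (y3 + snd (snd s) * e)"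
    using eventually_happens[of _ "at_right (0::real)"] by auto
  then show ?thesis by (intro that[of e]) (simp, force)
qed

lemma lin3_cpt: "lin3 n r m (cpt y x) = of_real (lin3 n r m x) + \<i> * of_real (lin3 n r m y)"
  by (simp add: lin3_def cpt_def Complex_eq algebra_simps)

lemma lin3_add: "lin3 (n + n') (r + r') (m + m') x = lin3 n r m x + lin3 n' r' m' (x :: 'a::comm_ring_1 \<times> 'a \<times> 'a)"
  by (simp add: lin3_def algebra_simps)

lemma lin3_uminus: "lin3 (- n) (- r) (- m) x = - lin3 n r m (x :: 'a::comm_ring_1 \<times> 'a \<times> 'a)"
  by (simp add: lin3_def algebra_simps)

lemma holomorphic_on_lin3 [holomorphic_intros]:
  "(\<lambda>a. lin3 n r m (a, b, c)) holomorphic_on S" "(\<lambda>b. lin3 n r m (a, b, c)) holomorphic_on S"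
  "(\<lambda>c. lin3 n r m (a, b, c)) holomorphic_on S"
  unfolding lin3_def by (auto intro!: holomorphic_intros)

lemma continuous_on_lin3 [continuous_intros]:
  fixes f :: "_ \<Rightarrow> 'a::{real_normed_algebra_1,comm_ring_1} \<times> 'a \<times> 'a"
  shows "continuous_on S f \<Longrightarrow> continuous_on S (\<lambda>x. lin3 n r m (f x))"
  unfolding lin3_def by (intro continuous_intros)

context periodic_hol begin

text \<open>A character of integral frequency is invariant under the unit translations, so the
  twisted function satisfies the same hypotheses, and its mean is a Fourier coefficient of
  \<open>f\<close>.\<close>

lemma twist: "periodic_hol (\<lambda>w. f w * ee (- lin3 n r m w))"
proof
  show "continuous_on H3 (\<lambda>w. f w * ee (- lin3 n r m w))"
    by (intro continuous_intros cont)
  show "(\<lambda>a. f (a, b, c) * ee (- lin3 n r m (a, b, c))) holomorphic_on {a. (a, b, c) \<in> H3}" for b c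
    by (intro holomorphic_intros hol1)
  show "(\<lambda>b. f (a, b, c) * ee (- lin3 n r m (a, b, c))) holomorphic_on {b. (a, b, c) \<in> H3}" for a c
    by (intro holomorphic_intros hol2)
  show "(\<lambda>c. f (a, b, c) * ee (- lin3 n r m (a, b, c))) holomorphic_on {c. (a, b, c) \<in> H3}" for a b
    by (intro holomorphic_intros hol3)
  have e: "ee (- lin3 n r m (a + 1, b, c)) = ee (- lin3 n r m (a, b, c))"
    "ee (- lin3 n r m (a, b + 1, c)) = ee (- lin3 n r m (a, b, c))"
    "ee (- lin3 n r m (a, b, c + 1)) = ee (- lin3 n r m (a, b, c))" for a b c
    using ee_add[of "- lin3 n r m (a, b, c)" "of_int (- n)"] ee_add[of "- lin3 n r m (a, b, c)" "of_int (- r)"]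
      ee_add[of "- lin3 n r m (a, b, c)" "of_int (- m)"]
    unfolding ee_of_int by (simp_all add: lin3_def algebra_simps)
  fix a b c :: complex assume "(a, b, c) \<in> H3"
  then show "f (a + 1, b, c) * ee (- lin3 n r m (a + 1, b, c)) = f (a, b, c) * ee (- lin3 n r m (a, b, c))"
    "f (a, b + 1, c) * ee (- lin3 n r m (a, b + 1, c)) = f (a, b, c) * ee (- lin3 n r m (a, b, c))"
    "f (a, b, c + 1) * ee (- lin3 n r m (a, b, c + 1)) = f (a, b, c) * ee (- lin3 n r m (a, b, c))"
    by (simp_all only: e per1 per2 per3)
qed

text \<open>The imaginary part is the identity matrix here; by \<open>coeff_eq\<close> any other
  admissible height gives the same number.\<close>

definition coeff :: "int \<Rightarrow> int \<Rightarrow> int \<Rightarrow> complex" where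
  "coeff n r m = integral cube (\<lambda>x. f (cpt (1, 0, 1) x) * ee (- lin3 n r m (cpt (1, 0, 1) x)))"

lemma coeff_eq:
  assumes "pd y1 y2 y3"
  shows "coeff n r m = integral cube (\<lambda>x. f (cpt (y1, y2, y3) x) * ee (- lin3 n r m (cpt (y1, y2, y3) x)))"
proof -
  interpret t: periodic_hol "\<lambda>w. f w * ee (- lin3 n r m w)" by (rule twist)
  show ?thesis using t.mean_const[OF _ assms, of 1 0 1] by (simp add: coeff_def t.mean_def pd_def)
qed

lemma coeff_bound:
  assumes "pd y1 y2 y3"
  obtains C where "C \<ge> 0" "\<And>n r m. norm (coeff n r m) \<le> C * exp (2 * pi * lin3 n r m (y1, y2, y3))"
proof -
  obtain C where C: "\<And>x. x \<in> cube \<Longrightarrow> norm (f (cpt (y1, y2, y3) x)) \<le> C" "C > 0"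
    using compact_imp_bounded[OF compact_continuous_image[OF continuous_on_slice[OF assms] compact_cbox]]
    unfolding bounded_pos by (metis imageI)
  have "norm (coeff n r m) \<le> C * exp (2 * pi * lin3 n r m (y1, y2, y3))" for n r m
  proof -
    interpret t: periodic_hol "\<lambda>w. f w * ee (- lin3 n r m w)" by (rule twist)
    have "norm (coeff n r m) \<le> C * exp (2 * pi * lin3 n r m (y1, y2, y3)) * measure lborel cube"
      unfolding coeff_eq[OF assms]
    proof (rule has_integral_bound[OF _ integrable_integral])
      show "(\<lambda>x. f (cpt (y1, y2, y3) x) * ee (- lin3 n r m (cpt (y1, y2, y3) x))) integrable_on cube"
        by (rule integrable_continuous[OF t.continuous_on_slice[OF assms]])
      show "cmod (f (cpt (y1, y2, y3) x) * ee (- lin3 n r m (cpt (y1, y2, y3) x)))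
         \<le> C * exp (2 * pi * lin3 n r m (y1, y2, y3))" if "x \<in> cube" for x
        unfolding norm_mult norm_ee by (intro mult_mono C that) (use C in \<open>auto simp: lin3_cpt\<close>)
    qed (use C in auto)
    then show ?thesis by (simp add: content_Pair)
  qed
  with C show ?thesis using that[of C] by simp
qed

text \<open>The coefficients may be bounded at any height near \<open>y\<close>. Choosing for each
  index the corner whose shifts have signs opposite to \<open>n\<close>, \<open>r\<close>,
  \<open>m\<close> gains the factor exp(-2 pi e (|n| + |r| + |m|)).\<close>

lemma coeff_abs_summable:
  assumes "pd y1 y2 y3"
  shows "(\<lambda>(n, r, m). norm (coeff n r m) * exp (- 2 * pi * lin3 n r m (y1, y2, y3))) summable_on UNIV"
proof -
  obtain e where e: "e > 0" "\<And>s1 s2 s3. {s1, s2, s3} \<subseteq> {-1, 1} \<Longrightarrow> pd (y1 + s1 * e) (y2 + s2 * e) (y3 + s3 * e)"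
    using pd_nbhd[OF assms] by blast
  let ?I = "{-1,1::real}\<times>{-1,1::real}\<times>{-1,1::real}"
  have "\<forall>s\<in>?I. \<exists>C\<ge>0. \<forall>n r m. norm (coeff n r m) \<le> C * exp (2 * pi * lin3 n r m (y1 + fst s * e, y2 + fst (snd s) * e, y3 + snd (snd s) * e))"
  proof
    fix s assume "s \<in> ?I"
    then have "pd (y1 + fst s * e) (y2 + fst (snd s) * e) (y3 + snd (snd s) * e)"
      by (intro e(2)) auto
    from coeff_bound[OF this] obtain K where "K \<ge> 0" "\<And>n r m. norm (coeff n r m) \<le>
        K * exp (2 * pi * lin3 n r m (y1 + fst s * e, y2 + fst (snd s) * e, y3 + snd (snd s) * e))" by blast
    then show "\<exists>C\<ge>0. \<forall>n r m. norm (coeff n r m) \<le> C * exp (2 * pi * lin3 n r m (y1 + fst s * e, y2 + fst (snd s) * e, y3 + snd (snd s) * e))"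
      by (intro exI[of _ K]) simp
  qed
  from bchoice[OF this] obtain C where C': "\<forall>s\<in>?I. 0 \<le> C s \<and> (\<forall>n r m. norm (coeff n r m) \<le> C s * exp (2 * pi * lin3 n r m (y1 + fst s * e, y2 + fst (snd s) * e, y3 + snd (snd s) * e)))"
    by blast
  then have C: "\<And>s. s \<in> ?I \<Longrightarrow> C s \<ge> 0" "\<And>s n r m. s \<in> ?I \<Longrightarrow>
     norm (coeff n r m) \<le> C s * exp (2 * pi * lin3 n r m (y1 + fst s * e, y2 + fst (snd s) * e, y3 + snd (snd s) * e))"
    by (blast, blast)
  define D where "D = sum C ?I"
  have D: "C s \<le> D" if "s \<in> ?I" for s unfolding D_def by (rule member_le_sum[OF that]) (use C in auto)
  have bd: "norm (coeff n r m) * exp (- 2 * pi * lin3 n r m (y1, y2, y3)) \<le>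
     D * (exp (- (2 * pi * e) * \<bar>of_int n\<bar>) * (exp (- (2 * pi * e) * \<bar>of_int r\<bar>) * exp (- (2 * pi * e) * \<bar>of_int m\<bar>)))" for n r m
  proof -
    define sg where "sg k = (if k \<ge> 0 then -1 else 1 :: real)" for k :: int
    have sg: "of_int k * sg k = - \<bar>of_int k\<bar>" "sg k \<in> {-1, 1}" for k by (auto simp: sg_def)
    define s where "s = (sg n, sg r, sg m)"
    have s: "s \<in> ?I" unfolding s_def by (intro SigmaI sg)
    have "lin3 n r m (y1 + fst s * e, y2 + fst (snd s) * e, y3 + snd (snd s) * e) =
        lin3 n r m (y1, y2, y3) + e * (of_int n * sg n + of_int r * sg r + of_int m * sg m)"
      by (simp add: lin3_def s_def algebra_simps)
    also have "\<dots> = lin3 n r m (y1, y2, y3) - e * (\<bar>of_int n\<bar> + \<bar>of_int r\<bar> + \<bar>of_int m\<bar>)"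
      unfolding sg by (simp add: algebra_simps)
    finally have l: "lin3 n r m (y1 + fst s * e, y2 + fst (snd s) * e, y3 + snd (snd s) * e) = \<dots>" .
    have "norm (coeff n r m) \<le> D * exp (2 * pi * (lin3 n r m (y1, y2, y3) - e * (\<bar>of_int n\<bar> + \<bar>of_int r\<bar> + \<bar>of_int m\<bar>)))"
      by (rule order_trans[OF C(2)[OF s, of n r m, unfolded l] mult_right_mono[OF D[OF s]]]) simp
    then have "norm (coeff n r m) * exp (- 2 * pi * lin3 n r m (y1, y2, y3)) \<le>
       D * exp (2 * pi * (lin3 n r m (y1, y2, y3) - e * (\<bar>of_int n\<bar> + \<bar>of_int r\<bar> + \<bar>of_int m\<bar>))) * exp (- 2 * pi * lin3 n r m (y1, y2, y3))"
      by (intro mult_right_mono) auto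
    also have "\<dots> = D * exp (- (2 * pi * e) * \<bar>of_int n\<bar> + (- (2 * pi * e) * \<bar>of_int r\<bar> + - (2 * pi * e) * \<bar>of_int m\<bar>))"
      unfolding mult.assoc[of D] exp_add[symmetric] by (simp add: algebra_simps)
    finally show ?thesis unfolding exp_add .
  qed
  have c: "2 * pi * e > 0" using e by simp
  let ?E = "\<lambda>k::int. exp (- (2 * pi * e) * \<bar>of_int k\<bar>)"
  have "(\<lambda>(r, m). ?E r * ?E m) summable_on UNIV"
    by (intro summable_on_Times_product summable_exp_int[OF c] exp_ge_zero)
  then have "(\<lambda>(n, q). ?E n * (case q of (r, m) \<Rightarrow> ?E r * ?E m)) summable_on UNIV"
    by (intro summable_on_Times_product summable_exp_int[OF c]) auto
  then have "(\<lambda>(n, r, m). D * (?E n * (?E r * ?E m))) summable_on UNIV"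
    using summable_on_cmult_right[of "\<lambda>(n, r, m). ?E n * (?E r * ?E m)" UNIV D] by (simp add: case_prod_beta')
  then show ?thesis
    by (rule summable_on_comparison_test) (use bd in auto)
qed

lemma integral_cube_ee:
  "integral cube (\<lambda>x. ee (of_real (lin3 n r m x))) = (if n = 0 \<and> r = 0 \<and> m = 0 then 1 else 0)"
proof -
  have I1: "((\<lambda>x. ee (of_real (of_int n * x))) has_integral (if n = 0 then 1 else 0)) {0..1::real}" for n :: int
  proof (cases "n = 0")
    case True then show ?thesis using has_integral_const_real[of "1::complex" 0 1] by simp
  next
    case False
    let ?k = "2 * of_real pi * \<i> * of_int n"
    have k: "?k \<noteq> 0" using False by simp
    have "((\<lambda>x. ee (of_real (of_int n * x)) / ?k) has_vector_derivative ee (of_real (of_int n * x))) (at x within {0..1})" for x :: real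
    proof -
      have "((\<lambda>z. exp (?k * z) / ?k) has_field_derivative exp (?k * of_real x)) (at (of_real x))"
        using k by (auto intro!: derivative_eq_intros)
      from has_vector_derivative_real_field[OF this]
      show ?thesis by (simp add: ee_def o_def has_vector_derivative_at_within mult_ac)
    qed
    then have "((\<lambda>x. ee (of_real (of_int n * x))) has_integral
       ee (of_real (of_int n * 1)) / ?k - ee (of_real (of_int n * 0)) / ?k) {0..1::real}"
      by (intro fundamental_theorem_of_calculus) auto
    then show ?thesis using False by simp
  qed
  have I: "integral (cbox 0 1) (\<lambda>x. ee (of_real (of_int n * x))) = (if n = 0 then 1 else 0)" for n :: int
    using integral_unique[OF I1] by simp
  have s: "ee (of_real (lin3 n r m (x1, x2, x3))) =
     ee (of_real (of_int n * x1)) * (ee (of_real (of_int r * x2)) * ee (of_real (of_int m * x3)))" for x1 x2 x3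
    by (simp add: lin3_def ee_add mult.assoc)
  have "integral cube (\<lambda>x. ee (of_real (lin3 n r m x))) =
     integral (cbox 0 1) (\<lambda>x1. integral (cbox (0,0) (1,1)) (\<lambda>q. ee (of_real (lin3 n r m (x1, q)))))"
    by (rule integral_prod_continuous) (intro continuous_intros)
  also have "\<dots> = integral (cbox 0 1) (\<lambda>x1. integral (cbox 0 1) (\<lambda>x2. integral (cbox 0 1) (\<lambda>x3. ee (of_real (lin3 n r m (x1, x2, x3))))))"
    by (intro integral_cong integral_prod_continuous continuous_intros)
  also have "\<dots> = (if n = 0 \<and> r = 0 \<and> m = 0 then 1 else 0)"
    unfolding s integral_mult_right I integral_mult_left by auto
  finally show ?thesis .
qed

text \<open>At a fixed height the series converges uniformly in the real part to a continuous
  function \<open>s\<close>. The difference of \<open>f\<close> and \<open>s\<close> is continuous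
  and periodic with vanishing Fourier integrals, so \<open>fourier_zero\<close> applies.\<close>

theorem fourier_has_sum:
  assumes "(a, b, c) \<in> H3"
  shows "((\<lambda>(n, r, m). coeff n r m * ee (lin3 n r m (a, b, c))) has_sum f (a, b, c)) UNIV"
proof -
  define y where "y = (Im a, Im b, Im c)"
  have y: "pd (Im a) (Im b) (Im c)" using assms by (simp add: H3_def)
  let ?u = "\<lambda>k x. case k of (n, r, m) \<Rightarrow> coeff n r m * ee (lin3 n r m (cpt y x))"
  define M where "M = (\<lambda>(n, r, m). norm (coeff n r m) * exp (- 2 * pi * lin3 n r m y))"
  have M: "M summable_on UNIV" using coeff_abs_summable[OF y] by (simp add: M_def y_def)
  have uM: "norm (?u k x) \<le> M k" for k x
    by (cases k) (simp add: M_def norm_mult norm_ee lin3_cpt)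
  define s where "s x = (\<Sum>\<^sub>\<infinity>k. ?u k x)" for x
  have lim: "uniform_limit UNIV (\<lambda>X x. \<Sum>k\<in>X. ?u k x) s (finite_subsets_at_top UNIV)"
    unfolding s_def by (rule Weierstrass_m_test_general[OF uM M])
  have contu: "continuous_on S (?u k)" for S k
    by (cases k) (auto intro!: continuous_intros continuous_on_cpt)
  have conts: "continuous_on S s" for S
  proof -
    have "continuous_on UNIV s"
    proof (rule uniform_limit_theorem[OF _ lim])
      show "\<forall>\<^sub>F X in finite_subsets_at_top UNIV. continuous_on UNIV (\<lambda>x. \<Sum>k\<in>X. ?u k x)"
        by (intro always_eventually allI continuous_on_sum contu)
    qed simp
    then show ?thesis using continuous_on_subset by blast
  qed
  have contf: "continuous_on S (\<lambda>x. f (cpt y x))" for S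
    unfolding y_def by (rule continuous_on_slice[OF y])
  define h where "h x = f (cpt y x) - s x" for x
  have conth: "continuous_on S h" for S unfolding h_def by (intro continuous_intros contf conts)
  have zero: "integral cube (\<lambda>x. h x * ee (of_real (lin3 n r m x))) = 0" for n r m
  proof -
    have "norm (integral cube (\<lambda>x. h x * ee (of_real (lin3 n r m x)))) \<le> e" if "e > 0" for e
    proof -
      have "\<forall>\<^sub>F X in finite_subsets_at_top UNIV. \<forall>x\<in>UNIV. dist (\<Sum>k\<in>X. ?u k x) (s x) < e"
        using lim that unfolding uniform_limit_iff by blast
      then obtain X0 where X0: "finite X0" "\<And>X. finite X \<Longrightarrow> X0 \<subseteq> X \<Longrightarrow> \<forall>x. dist (\<Sum>k\<in>X. ?u k x) (s x) < e"
        unfolding eventually_finite_subsets_at_top by auto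
      \<comment> \<open>Integration against the character of frequency (n, r, m) retains only the
        opposite index, so that index is put into the finite set; the partial sum then has the same
        integral as \<open>f\<close>.\<close>
      define X where "X = insert (- n, - r, - m) X0"
      have X: "finite X" "(- n, - r, - m) \<in> X" using X0(1) by (simp_all add: X_def)
      have X3: "dist (\<Sum>k\<in>X. ?u k x) (s x) < e" for x
        using X0(2)[OF X(1)] by (simp only: X_def subset_insertI simp_thms)
      let ?E = "\<lambda>x. ee (of_real (lin3 n r m x))"
      have "integral cube (\<lambda>x. (\<Sum>k\<in>X. ?u k x) * ?E x) = (\<Sum>k\<in>X. integral cube (\<lambda>x. ?u k x * ?E x))"
        unfolding sum_distrib_right
        by (intro integral_sum X integrable_continuous continuous_intros contu)
      also have "\<dots> = (\<Sum>k\<in>X. if k = (- n, - r, - m) then coeff (-n) (-r) (-m) * ee (\<i> * of_real (lin3 (-n) (-r) (-m) y)) else 0)"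
      proof (rule sum.cong[OF refl])
        fix k assume "k \<in> X"
        obtain n' r' m' where k: "k = (n', r', m')" by (rule prod_cases3)
        have "integral cube (\<lambda>x. ?u k x * ?E x) = integral cube (\<lambda>x. coeff n' r' m' * ee (\<i> * of_real (lin3 n' r' m' y)) * ee (of_real (lin3 (n' + n) (r' + r) (m' + m) x)))"
          by (simp add: k lin3_cpt lin3_add ee_add mult_ac)
        then show "integral cube (\<lambda>x. ?u k x * ?E x) = (if k = (- n, - r, - m) then coeff (-n) (-r) (-m) * ee (\<i> * of_real (lin3 (-n) (-r) (-m) y)) else 0)"
          unfolding integral_mult_right integral_cube_ee k by (auto simp: add_eq_0_iff2)
      qed
      also have "\<dots> = coeff (-n) (-r) (-m) * ee (\<i> * of_real (lin3 (-n) (-r) (-m) y))"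
        using X by simp
      also have "\<dots> = integral cube (\<lambda>x. f (cpt y x) * ?E x)"
      proof -
        have "ee (- lin3 (-n) (-r) (-m) (cpt y x)) * ee (\<i> * of_real (lin3 (-n) (-r) (-m) y)) = ?E x" for x
          by (simp add: ee_add[symmetric] lin3_cpt lin3_uminus)
        then have "f (cpt y x) * ?E x = f (cpt y x) * ee (- lin3 (-n) (-r) (-m) (cpt y x)) * ee (\<i> * of_real (lin3 (-n) (-r) (-m) y))" for x
          by (simp only: mult.assoc)
        then show ?thesis unfolding coeff_eq[OF y] y_def[symmetric] by (simp only: integral_mult_left)
      qed
      finally have eq: "integral cube (\<lambda>x. (\<Sum>k\<in>X. ?u k x) * ?E x) = integral cube (\<lambda>x. f (cpt y x) * ?E x)" .
      have "integral cube (\<lambda>x. h x * ?E x) = integral cube (\<lambda>x. f (cpt y x) * ?E x) - integral cube (\<lambda>x. s x * ?E x)"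
        unfolding h_def left_diff_distrib
        by (intro integral_diff integrable_continuous continuous_intros contf conts)
      also have "\<dots> = integral cube (\<lambda>x. ((\<Sum>k\<in>X. ?u k x) - s x) * ?E x)"
        unfolding eq[symmetric] left_diff_distrib
        by (intro integral_diff[symmetric] integrable_continuous continuous_intros conts contu)
      finally have eq2: "integral cube (\<lambda>x. h x * ?E x) = \<dots>" .
      have "norm (integral cube (\<lambda>x. ((\<Sum>k\<in>X. ?u k x) - s x) * ?E x)) \<le> e * measure lborel cube"
      proof (rule has_integral_bound[OF _ integrable_integral])
        show "(\<lambda>x. ((\<Sum>k\<in>X. ?u k x) - s x) * ?E x) integrable_on cube"
          by (intro integrable_continuous continuous_intros conts contu)
        show "norm (((\<Sum>k\<in>X. ?u k x) - s x) * ?E x) \<le> e" for x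
          using X3[of x] by (simp add: norm_mult norm_ee dist_norm)
      qed (use that in simp)
      then show ?thesis unfolding eq2 by (simp add: content_Pair)
    qed
    then show ?thesis using field_le_epsilon[of "norm (integral cube (\<lambda>x. h x * ee (of_real (lin3 n r m x))))" 0] by simp
  qed
  have pp: "(\<exists>a b c. w = (a, b, c) \<and> w' = (a + 1, b, c) \<and> w \<in> H3) \<or> (\<exists>a b c. w = (a, b, c) \<and> w' = (a, b + 1, c) \<and> w \<in> H3)
      \<or> (\<exists>a b c. w = (a, b, c) \<and> w' = (a, b, c + 1) \<and> w \<in> H3) \<Longrightarrow> f w = f w' \<and> ee (lin3 n r m w) = ee (lin3 n r m w')" for w w' n r m
    using ee_add[of "lin3 n r m w" "of_int n"] ee_add[of "lin3 n r m w" "of_int r"] ee_add[of "lin3 n r m w" "of_int m"]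
    by (auto simp: per1 per2 per3) (auto simp: lin3_def algebra_simps)
  have hp: "h x = h x'" if "cpt y x = (a, b, c)" "cpt y x' = (a + 1, b, c) \<or> cpt y x' = (a, b + 1, c) \<or> cpt y x' = (a, b, c + 1)" for x x' a b c
  proof -
    have "cpt y x \<in> H3" unfolding y_def cpt_H3 by (rule y)
    then have "f (cpt y x) = f (cpt y x') \<and> ee (lin3 n r m (cpt y x)) = ee (lin3 n r m (cpt y x'))" for n r m
      by (intro pp) (use that in auto)
    then show ?thesis by (simp add: h_def s_def)
  qed
  have "h (Re a, Re b, Re c) = 0"
  proof (rule fourier_zero[OF conth])
    fix a b c :: real
    show "h (a + 1, b, c) = h (a, b, c)" "h (a, b + 1, c) = h (a, b, c)" "h (a, b, c + 1) = h (a, b, c)"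
      using hp[of "(a, b, c)" "Complex a (fst y)" "Complex b (fst (snd y))" "Complex c (snd (snd y))" "(a + 1, b, c)"]
        hp[of "(a, b, c)" "Complex a (fst y)" "Complex b (fst (snd y))" "Complex c (snd (snd y))" "(a, b + 1, c)"]
        hp[of "(a, b, c)" "Complex a (fst y)" "Complex b (fst (snd y))" "Complex c (snd (snd y))" "(a, b, c + 1)"]
      by (simp_all add: cpt_def complex_eq_iff)
  qed (rule zero)
  moreover have c: "cpt y (Re a, Re b, Re c) = (a, b, c)" by (simp add: cpt_def y_def)
  ultimately have "f (a, b, c) = s (Re a, Re b, Re c)" by (simp add: h_def)
  moreover have "(\<lambda>k. ?u k (Re a, Re b, Re c)) summable_on UNIV"
    by (rule abs_summable_summable, rule summable_on_comparison_test[OF M]) (use uM in auto)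
  ultimately show ?thesis using has_sum_infsum[of "\<lambda>k. ?u k (Re a, Re b, Re c)" UNIV] by (simp add: s_def c)
qed

end

section \<open>Uniqueness of expansions with rational frequencies\<close>

lemma sqrt2_times_rat_not_int:
  assumes "sqrt 2 * real_of_rat q = of_int k" shows "q = 0"
proof (rule ccontr)
  assume q: "q \<noteq> 0"
  obtain a b where ab: "quotient_of q = (a, b)" by (cases "quotient_of q")
  then have q_eq: "q = of_int a / of_int b" and b: "b > 0"
    using quotient_of_div quotient_of_denom_pos by blast+
  have a: "a \<noteq> 0" using q q_eq by auto
  have "sqrt 2 * of_int a = of_int k * real_of_int b"
    using assms b by (simp add: q_eq of_rat_divide field_simps)
  then have "(sqrt 2 * of_int a)\<^sup>2 = (of_int k * real_of_int b)\<^sup>2" by simp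
  then have "real_of_int (2 * a\<^sup>2) = of_int ((k * b)\<^sup>2)" by (simp add: power_mult_distrib)
  then have eq: "2 * a\<^sup>2 = (k * b)\<^sup>2" using of_int_eq_iff by blast
  then have kb: "k * b \<noteq> 0" using a by auto
  \<comment> \<open>The two sides have 2-adic valuations of opposite parity.\<close>
  have p2: "prime_elem (2::int)" by (simp add: prime_elem_iff_prime_abs)
  have "multiplicity 2 (2 * a\<^sup>2) = 1 + 2 * multiplicity 2 a"
    using a p2 by (simp add: prime_elem_multiplicity_mult_distrib prime_elem_multiplicity_power_distrib)
  moreover have "multiplicity 2 ((k * b)\<^sup>2) = 2 * multiplicity 2 (k * b)"
    using kb p2 by (simp add: prime_elem_multiplicity_power_distrib)
  ultimately have "1 + 2 * multiplicity 2 a = 2 * multiplicity 2 (k * b)" using eq by simp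
  then show False by presburger
qed

text \<open>Average of a character of frequency \<open>q\<close> over translates by multiples of
  sqrt 2. A single irrational step separates zero from every nonzero rational frequency, whatever
  its denominator; a rational step would not.\<close>

definition avg :: "rat \<Rightarrow> nat \<Rightarrow> complex" where
  "avg q M = (\<Sum>k<Suc M. ee (of_real (sqrt 2 * of_rat q)) ^ k) / of_nat (Suc M)"

lemma avg_0: "avg 0 M = 1"
  by (simp add: avg_def del: sum.lessThan_Suc of_nat_Suc)

lemma norm_avg_le: "norm (avg q M) \<le> 1"
proof -
  have "norm (\<Sum>k<Suc M. ee (of_real (sqrt 2 * of_rat q)) ^ k) \<le> (\<Sum>k<Suc M. 1)"
    by (rule order_trans[OF norm_sum]) (rule sum_mono, simp add: norm_power norm_ee)
  then show ?thesis by (simp add: avg_def norm_divide del: sum.lessThan_Suc of_nat_Suc)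
qed

text \<open>The geometric sum with a ratio of norm 1 other than 1 is bounded independently of its
  length.\<close>

lemma avg_tendsto_0:
  assumes "q \<noteq> 0" shows "avg q \<longlonglongrightarrow> 0"
proof -
  define w where "w = ee (of_real (sqrt 2 * of_rat q))"
  have w: "w \<noteq> 1"
  proof
    assume "w = 1"
    then have "ee (of_real (sqrt 2 * of_rat q)) = ee (of_real 0)" by (simp add: w_def)
    then obtain k where "sqrt 2 * of_rat q = of_int k" unfolding ee_eq_iff by auto
    then show False using sqrt2_times_rat_not_int assms by blast
  qed
  have nw: "norm w = 1" by (simp add: w_def norm_ee)
  have bd: "norm (avg q M) \<le> 2 / norm (1 - w) / real (Suc M)" for M
  proof -
    have "avg q M = (1 - w ^ Suc M) / (1 - w) / of_nat (Suc M)"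
      unfolding avg_def w_def[symmetric] by (subst sum_gp_strict) (use w in simp)
    moreover have "norm (1 - w ^ Suc M) \<le> 2"
      using norm_triangle_ineq4[of 1 "w ^ Suc M"] nw by (simp add: norm_power norm_mult)
    ultimately show ?thesis
      by (simp only: norm_divide norm_of_nat) (intro divide_right_mono norm_ge_zero of_nat_0_le_iff)
  qed
  have "(\<lambda>M. 2 / norm (1 - w) / real (Suc M)) \<longlonglongrightarrow> 0"
    by (rule LIMSEQ_Suc) (rule lim_const_over_n)
  then show ?thesis
    by (rule Lim_null_comparison[rotated]) (use bd in auto)
qed

definition cm :: "rat^2^2 \<Rightarrow> complex^2^2" where "cm A = (\<chi> i j. of_rat (A $ i $ j))"

definition tr :: "rat^2^2 \<Rightarrow> complex^2^2 \<Rightarrow> complex" where "tr S z = trace (cm S ** z)"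

lemma cm_m2 [simp]: "cm (m2 a b c d) = m2 (of_rat a) (of_rat b) (of_rat c) (of_rat d)"
  by (simp add: cm_def mat2_eq_iff)

lemma cm_mult: "cm (A ** B) = cm A ** cm B"
  by (cases A rule: m2_cases; cases B rule: m2_cases) (simp add: of_rat_add of_rat_mult)

lemma cm_add: "cm (A + B) = cm A + cm B"
  by (simp add: cm_def mat2_eq_iff of_rat_add)

lemma cm_mat: "cm (mat a) = mat (of_rat a)"
  by (simp add: mat_m2)

lemma tr_m2 [simp]: "tr (m2 a b c d) (m2 a' b' c' d') = of_rat a * a' + of_rat b * c' + of_rat c * b' + of_rat d * d'"
  by (simp add: tr_def)

lemma tr_add: "tr S (z + w) = tr S z + tr S w"
  by (cases S rule: m2_cases; cases z rule: m2_cases; cases w rule: m2_cases) (simp add: algebra_simps)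

lemma tr_conj: "tr S (cm A ** z ** cm B) = tr (B ** S ** A) z"
  by (cases S rule: m2_cases; cases A rule: m2_cases; cases B rule: m2_cases; cases z rule: m2_cases)
     (simp add: algebra_simps of_rat_add of_rat_mult)

lemma has_sum_finite_sum:
  fixes f :: "'i \<Rightarrow> 'a \<Rightarrow> 'b::topological_comm_monoid_add"
  assumes "finite A" "\<And>i. i \<in> A \<Longrightarrow> (f i has_sum s i) B"
  shows "((\<lambda>x. \<Sum>i\<in>A. f i x) has_sum (\<Sum>i\<in>A. s i)) B"
  using assms by (induction A rule: finite_induct) (auto intro!: has_sum_add)

lemma of_real_of_rat: "complex_of_real (of_rat q) = of_rat q"
  by (cases q) (simp add: of_rat_rat)

lemma symmetricE:
  fixes S :: "'a::zero^2^2"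
  assumes "transpose S = S" obtains a b c where "S = m2 a b b c"
proof -
  have "S$2$1 = S$1$2" by (subst assms[symmetric]) (simp add: transpose_def)
  then have "S = m2 (S$1$1) (S$1$2) (S$1$2) (S$2$2)" by (simp add: mat2_eq_iff)
  then show ?thesis by (rule that)
qed

lemma siegel_H2_iff: "z \<in> siegel_H2 \<longleftrightarrow> (\<exists>a b c. z = m2 a b b c \<and> (a, b, c) \<in> H3)"
proof -
  have quad: "x \<bullet> (Y *v x) = Y$1$1 * x$1 * x$1 + (Y$1$2 + Y$2$1) * x$1 * x$2 + Y$2$2 * x$2 * x$2"
    for Y :: "real^2^2" and x
    by (simp add: inner_vec_def sum_2 matrix_vector_mult_def algebra_simps)
  have "(\<forall>x::real^2. x \<noteq> 0 \<longrightarrow> 0 < x \<bullet> ((\<chi> i j. Im (m2 a b b c $ i $ j)) *v x)) \<longleftrightarrow> pd (Im a) (Im b) (Im c)" (is "?L \<longleftrightarrow> _") for a b c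
  proof
    assume L: ?L
    have ne: "(vector [s, t] :: real^2) \<noteq> 0 \<longleftrightarrow> s \<noteq> 0 \<or> t \<noteq> 0" for s t
      by (simp add: vec_eq_iff forall_2)
    have q: "0 < Im a * s * s + (Im b + Im b) * s * t + Im c * t * t" if "s \<noteq> 0 \<or> t \<noteq> 0" for s t
      using L[rule_format, of "vector [s, t]"] that unfolding quad ne by simp
    have a: "0 < Im a" and c: "0 < Im c" using q[of 1 0] q[of 0 1] by simp_all
    \<comment> \<open>The vector (Im b, - Im a) gives the form the value Im a times the
      determinant.\<close>
    have "0 < Im a * (Im a * Im c - (Im b)\<^sup>2)"
      using q[of "Im b" "- Im a"] a by (simp add: algebra_simps power2_eq_square)
    then show "pd (Im a) (Im b) (Im c)"
      using a c by (simp add: pd_def zero_less_mult_iff)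
  next
    assume P: "pd (Im a) (Im b) (Im c)"
    show ?L
    proof (intro allI impI)
      fix x :: "real^2" assume "x \<noteq> 0"
      then have x: "x$1 \<noteq> 0 \<or> x$2 \<noteq> 0" by (simp add: vec_eq_iff forall_2)
      let ?Q = "Im a * x$1 * x$1 + (Im b + Im b) * x$1 * x$2 + Im c * x$2 * x$2"
      have eq: "Im a * ?Q = (Im a * x$1 + Im b * x$2)\<^sup>2 + (Im a * Im c - (Im b)\<^sup>2) * (x$2)\<^sup>2"
        by (simp add: algebra_simps power2_eq_square)
      have "0 < Im a * ?Q"
      proof (cases "x$2 = 0")
        case True
        then show ?thesis unfolding eq using x P by (simp add: pd_def)
      next
        case False
        then have "0 < (Im a * Im c - (Im b)\<^sup>2) * (x$2)\<^sup>2" using P by (simp add: pd_def)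
        then show ?thesis unfolding eq by (simp add: add_nonneg_pos)
      qed
      then have "0 < ?Q" using P by (simp add: pd_def zero_less_mult_iff)
      then show "0 < x \<bullet> ((\<chi> i j. Im (m2 a b b c $ i $ j)) *v x)" unfolding quad by simp
    qed
  qed
  then have iff: "m2 a b b c \<in> siegel_H2 \<longleftrightarrow> (a, b, c) \<in> H3" for a b c
    unfolding siegel_H2_def H3_def by (simp only: mem_Collect_eq case_prod_conv m2_transpose simp_thms)
  show ?thesis
  proof
    assume z: "z \<in> siegel_H2"
    then have "transpose z = z" by (simp add: siegel_H2_def)
    then obtain a b c where "z = m2 a b b c" by (rule symmetricE)
    with z iff[of a b c] show "\<exists>a b c. z = m2 a b b c \<and> (a, b, c) \<in> H3" by auto
  next
    assume "\<exists>a b c. z = m2 a b b c \<and> (a, b, c) \<in> H3"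
    then obtain a b c where "z = m2 a b b c" "(a, b, c) \<in> H3" by (elim exE conjE)
    then show "z \<in> siegel_H2" using iff[of a b c] by (simp only:)
  qed
qed

lemma ee_tr_fourier_unique:
  fixes d :: "rat^2^2 \<Rightarrow> complex"
  assumes sum: "\<And>z. z \<in> siegel_H2 \<Longrightarrow> ((\<lambda>S. ee (tr S z) * d S) has_sum 0) UNIV"
    and sym: "\<And>S. transpose S \<noteq> S \<Longrightarrow> d S = 0"
  shows "d T = 0"
proof (cases "transpose T = T")
  case True
  define z0 where "z0 = m2 \<i> 0 0 \<i>"
  define t where "t S = ee (tr S z0) * d S" for S
  \<comment> \<open>The off-diagonal entry occurs twice in the trace, hence the factor 2.\<close>
  define \<theta> where "\<theta> S = (S$1$1 - T$1$1, 2 * (S$1$2 - T$1$2), S$2$2 - T$2$2)" for S :: "rat^2^2"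
  define w where "w M S = avg (fst (\<theta> S)) M * avg (fst (snd (\<theta> S))) M * avg (snd (snd (\<theta> S))) M" for M S
  have z0: "z0 \<in> siegel_H2" unfolding siegel_H2_iff z0_def by (auto simp: H3_def pd_def)
  have zero: "((\<lambda>S. w M S * t S) has_sum 0) UNIV" for M
  proof -
    let ?X = "\<lambda>q. of_real (sqrt 2 * of_rat q) :: complex"
    have k: "((\<lambda>S. ee (?X (fst (\<theta> S))) ^ k1 * ee (?X (fst (snd (\<theta> S)))) ^ k2 * ee (?X (snd (snd (\<theta> S)))) ^ k3 * t S) has_sum 0) UNIV" for k1 k2 k3
    proof -
      let ?x = "m2 (of_real (sqrt 2 * real k1)) (of_real (sqrt 2 * real k2)) (of_real (sqrt 2 * real k2)) (of_real (sqrt 2 * real k3)) :: complex^2^2"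
      have "z0 + ?x \<in> siegel_H2" unfolding siegel_H2_iff z0_def by (auto simp: H3_def pd_def)
      then have "((\<lambda>S. ee (- tr T ?x) * (ee (tr S (z0 + ?x)) * d S)) has_sum ee (- tr T ?x) * 0) UNIV"
        by (intro has_sum_cmult_right sum)
      moreover have "ee (- tr T ?x) * (ee (tr S (z0 + ?x)) * d S) =
          ee (?X (fst (\<theta> S))) ^ k1 * ee (?X (fst (snd (\<theta> S)))) ^ k2 * ee (?X (snd (snd (\<theta> S)))) ^ k3 * t S" for S
      proof (cases "transpose S = S")
        case False then show ?thesis by (simp add: sym t_def)
      next
        case S: True
        obtain s1 s2 s3 where S': "S = m2 s1 s2 s2 s3" using S by (rule symmetricE)
        obtain t1 t2 t3 where T': "T = m2 t1 t2 t2 t3" using True by (rule symmetricE)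
        have pw: "ee u ^ n = ee (of_nat n * u)" for u n
          by (induction n) (simp_all add: distrib_right ee_add)
        have "- tr T ?x + tr S ?x = of_nat k1 * ?X (fst (\<theta> S)) + of_nat k2 * ?X (fst (snd (\<theta> S))) + of_nat k3 * ?X (snd (snd (\<theta> S)))"
          by (simp add: S' T' \<theta>_def of_rat_diff of_rat_mult of_real_of_rat algebra_simps)
        then have "ee (- tr T ?x) * ee (tr S ?x) = ee (?X (fst (\<theta> S))) ^ k1 * ee (?X (fst (snd (\<theta> S)))) ^ k2 * ee (?X (snd (snd (\<theta> S)))) ^ k3"
          unfolding pw ee_add[symmetric] by simp
        then show ?thesis by (simp add: tr_add ee_add t_def mult_ac)
      qed
      ultimately show ?thesis by simp
    qed
    have "((\<lambda>S. (1 / of_nat (Suc M) ^ 3) * (\<Sum>k1<Suc M. \<Sum>k2<Suc M. \<Sum>k3<Suc M. ee (?X (fst (\<theta> S))) ^ k1 * ee (?X (fst (snd (\<theta> S)))) ^ k2 * ee (?X (snd (snd (\<theta> S)))) ^ k3 * t S)) has_sum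
         (1 / of_nat (Suc M) ^ 3) * (\<Sum>k1<Suc M. \<Sum>k2<Suc M. \<Sum>k3<Suc M. 0)) UNIV"
      by (intro has_sum_cmult_right has_sum_finite_sum finite_lessThan k)
    moreover have "(1 / of_nat (Suc M) ^ 3) * (\<Sum>k1<Suc M. \<Sum>k2<Suc M. \<Sum>k3<Suc M. ee (?X (fst (\<theta> S))) ^ k1 * ee (?X (fst (snd (\<theta> S)))) ^ k2 * ee (?X (snd (snd (\<theta> S)))) ^ k3 * t S)
        = w M S * t S" for S
    proof -
      have "(\<Sum>k1<Suc M. \<Sum>k2<Suc M. \<Sum>k3<Suc M. a ^ k1 * b ^ k2 * c ^ k3 * u) =
         (\<Sum>k1<Suc M. a ^ k1) * (\<Sum>k1<Suc M. b ^ k1) * (\<Sum>k1<Suc M. c ^ k1) * u" for a b c u :: complex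
        unfolding sum_distrib_right[symmetric] sum_distrib_left[symmetric] ..
      then show ?thesis unfolding w_def avg_def by (simp only: power3_eq_cube) (simp add: field_simps del: sum.lessThan_Suc of_nat_Suc)
    qed
    ultimately show ?thesis by simp
  qed
  have nw: "norm (w M S) \<le> 1" for M S
    unfolding w_def norm_mult by (intro mult_le_one norm_avg_le mult_nonneg_nonneg norm_ge_zero)
  have wT: "w M T = 1" for M by (simp add: w_def \<theta>_def avg_0)
  have w0: "(\<lambda>M. w M S * t S) \<longlonglongrightarrow> 0" if "S \<noteq> T" for S
  proof (cases "transpose S = S")
    case False then show ?thesis by (simp add: sym t_def)
  next
    case S: True
    obtain s1 s2 s3 where S': "S = m2 s1 s2 s2 s3" using S by (rule symmetricE)
    obtain t1 t2 t3 where T': "T = m2 t1 t2 t2 t3" using True by (rule symmetricE)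
    have nb: "(\<lambda>M. norm (avg q M)) \<longlonglongrightarrow> 0" if "q \<noteq> 0" for q using avg_tendsto_0[OF that] tendsto_norm_zero by blast
    let ?b = "\<lambda>M. norm (t S)"
    have g: "a * b * c * u \<le> a * u" "a * b * c * u \<le> b * u" "a * b * c * u \<le> c * u"
      if "0 \<le> a" "0 \<le> b" "0 \<le> c" "a \<le> 1" "b \<le> 1" "c \<le> 1" "0 \<le> u" for a b c u :: real
    proof -
      have "a * (b * c) \<le> a * 1" "b * (a * c) \<le> b * 1" "c * (a * b) \<le> c * 1"
        by (intro mult_left_mono mult_le_one that)+
      then have "a * b * c \<le> a" "a * b * c \<le> b" "a * b * c \<le> c" by (simp_all only: mult_ac mult_1_right)
      then show "a * b * c * u \<le> a * u" "a * b * c * u \<le> b * u" "a * b * c * u \<le> c * u"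
        using that by (simp_all add: mult_right_mono)
    qed
    have le: "norm (w M S * t S) \<le> norm (avg (fst (\<theta> S)) M) * norm (t S)" "norm (w M S * t S) \<le> norm (avg (fst (snd (\<theta> S))) M) * norm (t S)"
       "norm (w M S * t S) \<le> norm (avg (snd (snd (\<theta> S))) M) * norm (t S)" for M
      unfolding w_def norm_mult by (intro g norm_ge_zero norm_avg_le)+
    have "s1 \<noteq> t1 \<or> s2 \<noteq> t2 \<or> s3 \<noteq> t3" using that by (simp add: S' T')
    then have "fst (\<theta> S) \<noteq> 0 \<or> fst (snd (\<theta> S)) \<noteq> 0 \<or> snd (snd (\<theta> S)) \<noteq> 0" by (simp add: \<theta>_def S' T')
    then show ?thesis
      by (elim disjE) (rule Lim_null_comparison[OF always_eventually tendsto_mult_left_zero[OF nb]], use le in blast, assumption)+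
  qed
  have "norm (t T) \<le> e" if "e > 0" for e
  proof -
    \<comment> \<open>An unconditional sum of complex numbers converges absolutely, which gives a
      majorant independent of \<open>M\<close>.\<close>
    have ab: "(\<lambda>S. norm (t S)) summable_on UNIV"
      using sum[OF z0] unfolding t_def[symmetric]
      using has_sum_imp_summable summable_on_iff_abs_summable_on_complex by blast
    have "uniform_limit UNIV (\<lambda>X M. \<Sum>S\<in>X. w M S * t S) (\<lambda>M. \<Sum>\<^sub>\<infinity>S. w M S * t S) (finite_subsets_at_top UNIV)"
      by (rule Weierstrass_m_test_general[OF _ ab]) (use nw in \<open>auto simp: norm_mult intro: mult_left_le_one_le\<close>)
    moreover have "(\<Sum>\<^sub>\<infinity>S. w M S * t S) = 0" for M using infsumI[OF zero] by simp
    ultimately have "\<forall>\<^sub>F X in finite_subsets_at_top UNIV. \<forall>M\<in>UNIV. dist (\<Sum>S\<in>X. w M S * t S) 0 < e"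
      using that unfolding uniform_limit_iff by simp
    then obtain X0 where X0: "finite X0" "\<And>X. finite X \<Longrightarrow> X0 \<subseteq> X \<Longrightarrow> \<forall>M. dist (\<Sum>S\<in>X. w M S * t S) 0 < e"
      unfolding eventually_finite_subsets_at_top by auto
    define X where "X = insert T X0"
    have fX: "finite X" and TX: "T \<in> X" using X0(1) by (simp_all add: X_def)
    have X: "norm (\<Sum>S\<in>X. w M S * t S) \<le> e" for M
      using X0(2)[OF fX] by (auto simp: X_def subset_insertI less_imp_le)
    have "(\<lambda>M. \<Sum>S\<in>X. w M S * t S) \<longlonglongrightarrow> (\<Sum>S\<in>X. if S = T then t T else 0)"
      by (intro tendsto_sum) (use w0 in \<open>auto simp: wT\<close>)
    then have "(\<lambda>M. \<Sum>S\<in>X. w M S * t S) \<longlonglongrightarrow> t T" using fX TX by simp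
    then show ?thesis by (rule Lim_bounded[OF tendsto_norm]) (use X in auto)
  qed
  then have "t T = 0" using field_le_epsilon[of "norm (t T)" 0] by simp
  then show ?thesis by (simp add: t_def)
qed (rule sym)

text \<open>Unlike in \<open>fourier_expansion\<close>, the sum runs over all rational matrices,
  with zero coefficients off the symmetric ones. The notion is thereby stable under substitutions in
  \<open>z\<close> that move half-integral frequencies to other rational ones.\<close>

definition expands :: "(complex^2^2 \<Rightarrow> complex^'n) \<Rightarrow> (rat^2^2 \<Rightarrow> complex^'n) \<Rightarrow> bool" where
  "expands F c \<longleftrightarrow> (\<forall>S. transpose S \<noteq> S \<longrightarrow> c S = 0) \<and>
     (\<forall>z\<in>siegel_H2. ((\<lambda>S. ee (tr S z) *s c S) has_sum F z) UNIV)"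

lemma has_sum_vec_iff:
  fixes g :: "'a \<Rightarrow> complex^'n"
  shows "(g has_sum s) A \<longleftrightarrow> (\<forall>i. ((\<lambda>x. g x $ i) has_sum s $ i) A)"
proof
  assume "(g has_sum s) A"
  then have "(sum g \<longlongrightarrow> s) (finite_subsets_at_top A)" by (simp add: has_sum_def)
  then have "((\<lambda>X. sum g X $ i) \<longlongrightarrow> s $ i) (finite_subsets_at_top A)" for i by (rule tendsto_vec_nth)
  then show "\<forall>i. ((\<lambda>x. g x $ i) has_sum s $ i) A" by (simp add: has_sum_def sum_component)
next
  assume "\<forall>i. ((\<lambda>x. g x $ i) has_sum s $ i) A"
  then have "((\<lambda>X. sum g X $ i) \<longlongrightarrow> s $ i) (finite_subsets_at_top A)" for i by (simp add: has_sum_def sum_component)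
  then show "(g has_sum s) A" unfolding has_sum_def by (rule vec_tendstoI)
qed

lemma expands_iff:
  "expands F c \<longleftrightarrow> (\<forall>S. transpose S \<noteq> S \<longrightarrow> c S = 0) \<and>
     (\<forall>z\<in>siegel_H2. \<forall>i. ((\<lambda>S. ee (tr S z) * c S $ i) has_sum F z $ i) UNIV)"
  by (simp add: expands_def has_sum_vec_iff)

lemma expands_matrix:
  fixes c :: "rat^2^2 \<Rightarrow> complex^'n" and A :: "complex^'n^'m"
  assumes "expands F c" shows "expands (\<lambda>z. A *v F z) (\<lambda>S. A *v c S)"
proof -
  have "((\<lambda>S. ee (tr S z) * (A *v c S) $ i) has_sum (A *v F z) $ i) UNIV" if "z \<in> siegel_H2" for z i
  proof -
    have "((\<lambda>S. \<Sum>j\<in>UNIV. A$i$j * (ee (tr S z) * c S $ j)) has_sum (\<Sum>j\<in>UNIV. A$i$j * F z $ j)) UNIV"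
      by (intro has_sum_finite_sum has_sum_cmult_right finite_class.finite_UNIV)
         (use assms that in \<open>simp add: expands_iff\<close>)
    then show ?thesis by (simp add: matrix_vector_mult_def sum_distrib_left mult_ac)
  qed
  with assms show ?thesis by (simp add: expands_iff)
qed

lemma expands_smult:
  assumes "expands F c" shows "expands (\<lambda>z. k *s F z) (\<lambda>S. k *s c S)"
proof -
  have "((\<lambda>S. ee (tr S z) * (k * c S $ i)) has_sum k * F z $ i) UNIV" if "z \<in> siegel_H2" for z i
    using has_sum_cmult_right[of "\<lambda>S. ee (tr S z) * c S $ i" UNIV "F z $ i" k] assms that
    by (simp add: expands_iff mult_ac)
  with assms show ?thesis by (simp add: expands_iff)
qed

lemma expands_sum:
  assumes "finite I" "\<And>i. i \<in> I \<Longrightarrow> expands (F i) (c i)"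
  shows "expands (\<lambda>z. \<Sum>i\<in>I. F i z) (\<lambda>S. \<Sum>i\<in>I. c i S)"
proof -
  have "((\<lambda>S. \<Sum>i\<in>I. ee (tr S z) * c i S $ j) has_sum (\<Sum>i\<in>I. F i z $ j)) UNIV" if "z \<in> siegel_H2" for z j
    by (intro has_sum_finite_sum) (use assms that in \<open>simp_all add: expands_iff\<close>)
  moreover have "(\<Sum>i\<in>I. c i S) = 0" if "transpose S \<noteq> S" for S
    by (rule sum.neutral) (use assms that in \<open>auto simp: expands_iff\<close>)
  ultimately show ?thesis by (simp add: expands_iff sum_component sum_distrib_left)
qed

lemma expands_cong:
  assumes "expands F c" "\<And>z. z \<in> siegel_H2 \<Longrightarrow> F z = G z" shows "expands G c"
  using assms by (simp add: expands_def)

lemma expands_unique: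
  fixes c c' :: "rat^2^2 \<Rightarrow> complex^'n"
  assumes "expands F c" "expands F c'" shows "c = c'"
proof -
  have "c T $ i - c' T $ i = 0" for T i
  proof (rule ee_tr_fourier_unique[of "\<lambda>S. c S $ i - c' S $ i"])
    fix z assume z: "z \<in> siegel_H2"
    then have "((\<lambda>S. ee (tr S z) * c S $ i + (-1) * (ee (tr S z) * c' S $ i)) has_sum (F z $ i + (-1) * F z $ i)) UNIV"
      using assms by (intro has_sum_add has_sum_cmult_right) (simp_all add: expands_iff)
    then show "((\<lambda>S. ee (tr S z) * (c S $ i - c' S $ i)) has_sum 0) UNIV"
      by (simp add: right_diff_distrib)
  qed (use assms in \<open>simp add: expands_def\<close>)
  then have "c T = c' T" for T by (simp add: vec_eq_iff)
  then show ?thesis by (rule ext)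
qed

lemma pd_iff: "pd y1 y2 y3 \<longleftrightarrow> 0 < y1 \<and> 0 < y1 * y3 - y2\<^sup>2"
proof -
  have "0 < y3" if "0 < y1" "y2\<^sup>2 < y1 * y3"
  proof -
    have "0 < y1 * y3" using that(2) zero_le_power2[of y2] by linarith
    then show ?thesis using that(1) by (simp add: zero_less_mult_iff)
  qed
  then show ?thesis unfolding pd_def by auto
qed

text \<open>The imaginary part Y is replaced by k A Y A^T, whose leading entry is positive by
  completing the square and whose determinant is k^2 det(A)^2 det(Y).\<close>

lemma siegel_H2_affine:
  assumes z: "z \<in> siegel_H2" and A: "det A \<noteq> 0" and k: "k > 0" and X: "transpose X = X"
  shows "cm (mat k ** A) ** z ** cm (transpose A) + cm X \<in> siegel_H2"
proof -
  obtain a b c where z': "z = m2 a b b c" "pd (Im a) (Im b) (Im c)"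
    using z by (auto simp: siegel_H2_iff H3_def)
  obtain p q r s where A': "A = m2 p q r s" by (rule m2_cases)
  obtain x1 x2 x3 where X': "X = m2 x1 x2 x2 x3" using X by (rule symmetricE)
  have im: "Im (of_rat u) = 0" "Re (of_rat u) = of_rat u" for u by (simp_all add: of_real_of_rat[symmetric])
  define P Q R S K where d: "P = (of_rat p :: real)" "Q = (of_rat q :: real)" "R = (of_rat r :: real)" "S = (of_rat s :: real)" "K = (of_rat k :: real)"
  define y1 y2 y3 where y: "y1 = Im a" "y2 = Im b" "y3 = Im c"
  let ?y1 = "K * (P\<^sup>2 * y1 + 2 * P * Q * y2 + Q\<^sup>2 * y3)"
  let ?y2 = "K * (P * R * y1 + (P * S + Q * R) * y2 + Q * S * y3)"
  let ?y3 = "K * (R\<^sup>2 * y1 + 2 * R * S * y2 + S\<^sup>2 * y3)"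
  have "of_rat (det A) \<noteq> (0::real)" using A by simp
  then have det: "P * S - Q * R \<noteq> 0" by (simp add: A' det_2 d of_rat_diff of_rat_mult)
  have K: "K > 0" using k by (simp add: d)
  have D: "y1 > 0" "y1 * y3 - y2\<^sup>2 > 0" using z'(2) by (simp_all add: y pd_iff)
  have "y1 * ?y1 = K * ((P * y1 + Q * y2)\<^sup>2 + Q\<^sup>2 * (y1 * y3 - y2\<^sup>2))"
    by (simp add: power2_eq_square algebra_simps)
  also have "\<dots> > 0"
  proof (rule mult_pos_pos[OF K])
    show "0 < (P * y1 + Q * y2)\<^sup>2 + Q\<^sup>2 * (y1 * y3 - y2\<^sup>2)"
    proof (cases "Q = 0")
      case True then show ?thesis using det D by auto
    next
      case False then have "0 < Q\<^sup>2 * (y1 * y3 - y2\<^sup>2)" using D by simp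
      then show ?thesis by (simp add: add_nonneg_pos)
    qed
  qed
  finally have 1: "?y1 > 0" using D(1) zero_less_mult_pos by blast
  have "?y1 * ?y3 - ?y2\<^sup>2 = K\<^sup>2 * (P * S - Q * R)\<^sup>2 * (y1 * y3 - y2\<^sup>2)"
    by (simp add: power2_eq_square algebra_simps)
  also have "\<dots> > 0" using K det D by simp
  finally have pd: "pd ?y1 ?y2 ?y3" using 1 by (simp add: pd_iff)
  have "cm (mat k ** A) ** z ** cm (transpose A) + cm X =
     m2 (of_rat k * (of_rat p * (of_rat p * a + of_rat q * b) + of_rat q * (of_rat p * b + of_rat q * c)) + of_rat x1)
        (of_rat k * (of_rat p * (of_rat r * a + of_rat s * b) + of_rat q * (of_rat r * b + of_rat s * c)) + of_rat x2)
        (of_rat k * (of_rat p * (of_rat r * a + of_rat s * b) + of_rat q * (of_rat r * b + of_rat s * c)) + of_rat x2)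
        (of_rat k * (of_rat r * (of_rat r * a + of_rat s * b) + of_rat s * (of_rat r * b + of_rat s * c)) + of_rat x3)"
    (is "_ = m2 ?a ?b ?b ?c")
    by (simp add: z' A' X' mat_m2 of_rat_mult algebra_simps)
  moreover have "Im ?a = ?y1" "Im ?b = ?y2" "Im ?c = ?y3"
    by (simp_all add: im d y power2_eq_square algebra_simps)
  then have "(?a, ?b, ?c) \<in> H3" using pd by (simp add: H3_def)
  ultimately show ?thesis unfolding siegel_H2_iff by blast
qed

text \<open>By cyclicity of the trace, tr(S (k A z A^T)) = tr((k A^T S A) z), so the frequencies are
  reindexed by the bijection from S to k A^T S A; the translation by \<open>X\<close> contributes
  the constant exponential.\<close>

lemma expands_subst:
  assumes F: "expands F c" and A: "A ** A' = mat 1" and k: "k > 0" and X: "transpose X = X"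
  shows "expands (\<lambda>z. F (cm (mat k ** A) ** z ** cm (transpose A) + cm X))
     (\<lambda>T. ee (tr (mat (1/k) ** transpose A' ** T ** A') (cm X)) *s c (mat (1/k) ** transpose A' ** T ** A'))"
proof -
  let ?h = "\<lambda>T. mat (1/k) ** transpose A' ** T ** A'"
  let ?h' = "\<lambda>S. transpose A ** S ** (mat k ** A)"
  have A2: "A' ** A = mat 1" using A matrix_left_right_inverse by blast
  have "det A * det A' = 1" using arg_cong[OF A, of det] by (simp add: det_mul)
  then have detA: "det A \<noteq> 0" by auto
  have cmt: "M ** mat u = mat u ** M" for u :: rat and M :: "rat^2^2"
    by (cases M rule: m2_cases) (simp add: mat_m2 mult.commute)
  have pull: "M ** (mat u ** Q) = mat u ** (M ** Q)" for u :: rat and M Q :: "rat^2^2"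
  proof -
    have "M ** (mat u ** Q) = (M ** mat u) ** Q" by (rule matrix_mul_assoc)
    also have "\<dots> = mat u ** (M ** Q)" unfolding cmt[of M u] by (rule matrix_mul_assoc[symmetric])
    finally show ?thesis .
  qed
  have mm: "mat u ** (mat v ** Q) = Q" if "u * v = 1" for u v :: rat and Q :: "rat^2^2"
  proof -
    have "mat u ** mat v = (mat 1 :: rat^2^2)" using that by (simp add: mat_m2)
    then show ?thesis by (simp add: matrix_mul_assoc)
  qed
  have kk: "1 / k * k = 1" "k * (1 / k) = 1" using k by simp_all
  have tA: "transpose A' ** transpose A = mat 1" "transpose A ** transpose A' = mat 1"
    using A A2 by (simp_all add: matrix_transpose_mul[symmetric])
  have h'h: "?h' (?h T) = T" for T
  proof -
    have "?h' (?h T) = (transpose A ** (mat (1/k) ** (transpose A' ** T ** A'))) ** (mat k ** A)"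
      by (simp only: matrix_mul_assoc)
    also have "\<dots> = mat (1/k) ** ((transpose A ** (transpose A' ** T ** A')) ** (mat k ** A))"
      unfolding pull[of "transpose A"] by (rule matrix_mul_assoc[symmetric])
    also have "\<dots> = (transpose A ** (transpose A' ** T ** A')) ** A"
      unfolding pull[of _ k A] by (rule mm[OF kk(1)])
    also have "\<dots> = (transpose A ** transpose A') ** T ** (A' ** A)" by (simp only: matrix_mul_assoc)
    finally show ?thesis by (simp add: tA A2)
  qed
  have hh': "?h (?h' S) = S" for S
  proof -
    have "?h (?h' S) = mat (1/k) ** ((transpose A' ** transpose A ** S) ** (mat k ** (A ** A')))"
      by (simp only: matrix_mul_assoc)
    also have "\<dots> = S" unfolding pull[of _ k] by (simp add: tA A mm[OF kk(2)] mm[OF kk(1)])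
    finally show ?thesis .
  qed
  have bij: "bij ?h" using h'h hh' by (intro o_bij[of ?h']) (auto simp: o_def fun_eq_iff)
  have sym: "transpose (?h T) = ?h (transpose T)" for T
    by (cases T rule: m2_cases; cases A' rule: m2_cases) (simp add: mat_m2 algebra_simps)
  show ?thesis unfolding expands_def
  proof (intro conjI ballI allI impI)
    fix T :: "rat^2^2" assume "transpose T \<noteq> T"
    then have "transpose (?h T) \<noteq> ?h T" unfolding sym using bij by (auto simp: bij_def inj_def)
    then show "ee (tr (?h T) (cm X)) *s c (?h T) = 0" using F by (simp add: expands_def)
  next
    fix z assume z: "z \<in> siegel_H2"
    let ?w = "cm (mat k ** A) ** z ** cm (transpose A) + cm X"
    have "((\<lambda>S. ee (tr S ?w) *s c S) has_sum F ?w) UNIV"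
      using F siegel_H2_affine[OF z detA k X] by (simp add: expands_def)
    then have "((\<lambda>T. ee (tr (?h T) ?w) *s c (?h T)) has_sum F ?w) UNIV"
      by (rule has_sum_reindex_bij_betw[OF bij, of "\<lambda>S. ee (tr S ?w) *s c S", THEN iffD2])
    moreover have "tr (?h T) ?w = tr T z + tr (?h T) (cm X)" for T
      by (simp only: tr_add tr_conj h'h)
    ultimately show "((\<lambda>T. ee (tr T z) *s (ee (tr (?h T) (cm X)) *s c (?h T))) has_sum F ?w) UNIV"
      by (simp add: ee_add)
  qed
qed

section \<open>Existence of the Fourier expansion\<close>

text \<open>The index set forced by periodicity alone; positivity is added later by the Koecher
  principle.\<close>

definition half_integral :: "rat^2^2 \<Rightarrow> bool" where
  "half_integral S \<longleftrightarrow> (\<exists>n r m::int. S = m2 (of_int n) (of_int r / 2) (of_int r / 2) (of_int m))"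

lemma blocks_blk [simp]: "block_A (blk A B C D) = cm A" "block_B (blk A B C D) = cm B"
  "block_C (blk A B C D) = cm C" "block_D (blk A B C D) = cm D"
  by (simp_all add: block_A_def block_B_def block_C_def block_D_def cm_def)

lemma matrix_inv_mat1 [simp]: "matrix_inv (mat 1 :: 'a::field^'n^'n) = mat 1"
  by (rule matrix_inv_unique) simp

lemma Gamma0_translation:
  assumes "b1 \<in> \<int>" "b2 \<in> \<int>" "b3 \<in> \<int>"
  shows "blk (mat 1) (m2 b1 b2 b2 b3) 0 (mat 1) \<in> Gamma0 N"
  using assms unfolding Gamma0_def mat_m2 zero_m2
  by (auto simp: symplectic_similitude_blk all_sum_type forall_2 intro!: bexI[of _ 0])

lemma siegel_form_translation:
  assumes "siegel_modular_form N V \<rho> l1 l2 F" "z \<in> siegel_H2" "b1 \<in> \<int>" "b2 \<in> \<int>" "b3 \<in> \<int>"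
  shows "F (z + cm (m2 b1 b2 b2 b3)) = F z"
proof -
  let ?g = "blk (mat 1) (m2 b1 b2 b2 b3) 0 (mat 1)"
  have c0: "cm 0 = 0" "cm (mat 1) = mat 1" by (simp_all add: zero_m2 mat_m2)
  have au: "automorphy_factor ?g z = mat 1" by (simp add: automorphy_factor_def c0)
  have "siegel_act ?g z = z + cm (m2 b1 b2 b2 b3)" unfolding siegel_act_def au by (simp add: c0)
  moreover have "F (siegel_act ?g z) = \<rho> (mat 1) (F z)"
    using assms(1,2) Gamma0_translation[OF assms(3-5), of N] unfolding siegel_modular_form_def au[symmetric] by blast
  moreover have "\<rho> (mat 1) (F z) = F z"
    using assms unfolding siegel_modular_form_def highest_weight_rep_def polynomial_rep_def by blast
  ultimately show ?thesis by simp
qed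

text \<open>Each coordinate of \<open>F\<close> is treated as a function of the entries (z11, z12,
  z22). Along a complex line of symmetric matrices the derivative of \<open>F\<close> is complex
  linear, which yields holomorphy in each variable.\<close>

lemma siegel_form_periodic_hol:
  assumes F: "siegel_modular_form N V \<rho> l1 l2 F"
  shows "periodic_hol (\<lambda>(a, b, c). F (m2 a b b c) $ i)"
proof -
  have hol: "holomorphic_on_H2 F" using F by (simp add: siegel_modular_form_def)
  have cont: "continuous_on siegel_H2 F"
    using hol has_derivative_continuous unfolding holomorphic_on_H2_def continuous_on_eq_continuous_within by blast
  have inH: "m2 a b b c \<in> siegel_H2 \<longleftrightarrow> (a, b, c) \<in> H3" for a b c by (auto simp: siegel_H2_iff)
  have slice: "(\<lambda>t. F (z0 + m2 (e1 * t) (e2 * t) (e2 * t) (e3 * t)) $ i) holomorphic_on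
     {t. z0 + m2 (e1 * t) (e2 * t) (e2 * t) (e3 * t) \<in> siegel_H2}" (is "?f holomorphic_on ?S") for z0 e1 e2 e3
    unfolding holomorphic_on_def
  proof
    fix t assume t: "t \<in> ?S"
    let ?g = "\<lambda>t. z0 + m2 (e1 * t) (e2 * t) (e2 * t) (e3 * t)"
    obtain F' where F': "(F has_derivative F') (at (?g t) within siegel_H2)" "\<And>c h. F' (\<chi> i j. c * h $ i $ j) = c *s F' h"
      using hol t unfolding holomorphic_on_H2_def by blast
    have "m2 (e1 * t) (e2 * t) (e2 * t) (e3 * t) = (\<chi> i j. t * m2 e1 e2 e2 e3 $ i $ j)" for t
      by (simp add: mat2_eq_iff mult.commute)
    then have lin: "F' (m2 (e1 * h) (e2 * h) (e2 * h) (e3 * h)) = h *s F' (m2 e1 e2 e2 e3)" for h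
      using F'(2) by simp
    have bl: "bounded_linear (\<lambda>h. m2 (e1 * h) (e2 * h) (e2 * h) (e3 * h))"
      unfolding linear_conv_bounded_linear[symmetric]
      by (rule linearI) (simp_all add: mat2_eq_iff algebra_simps)
    then have g: "(?g has_derivative (\<lambda>h. m2 (e1 * h) (e2 * h) (e2 * h) (e3 * h))) (at t within ?S)"
      by (intro has_derivative_add[OF has_derivative_const, simplified] bounded_linear_imp_has_derivative)
    have "(F has_derivative F') (at (?g t) within ?g ` ?S)"
      by (rule has_derivative_subset[OF F'(1)]) auto
    from has_derivative_in_compose[OF g this]
    have "((\<lambda>t. F (?g t)) has_derivative (\<lambda>h. F' (m2 (e1 * h) (e2 * h) (e2 * h) (e3 * h)))) (at t within ?S)" .
    then have "(?f has_derivative (\<lambda>h. F' (m2 (e1 * h) (e2 * h) (e2 * h) (e3 * h)) $ i)) (at t within ?S)"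
      by (rule bounded_linear.has_derivative[OF bounded_linear_vec_nth])
    then have "(?f has_field_derivative F' (m2 e1 e2 e2 e3) $ i) (at t within ?S)"
      by (rule has_derivative_imp_has_field_derivative) (simp add: lin)
    then show "?f field_differentiable at t within ?S" unfolding field_differentiable_def by blast
  qed
  have per: "F (m2 (a + of_int k1) (b + of_int k2) (b + of_int k2) (c + of_int k3)) = F (m2 a b b c)" if "(a, b, c) \<in> H3" for a b c k1 k2 k3
    using siegel_form_translation[OF F, of "m2 a b b c" "of_int k1" "of_int k2" "of_int k3"] that by (simp add: inH)
  show ?thesis
  proof
    have "continuous_on H3 (\<lambda>w. F (m2 (fst w) (fst (snd w)) (fst (snd w)) (snd (snd w))) $ i)"
    proof (rule bounded_linear.continuous_on[OF bounded_linear_vec_nth continuous_on_compose2[OF cont]])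
      show "continuous_on H3 (\<lambda>w. m2 (fst w) (fst (snd w)) (fst (snd w)) (snd (snd w)))"
        by (rule linear_continuous_on, unfold linear_conv_bounded_linear[symmetric], rule linearI)
           (simp_all add: mat2_eq_iff)
    qed (auto simp: inH)
    then show "continuous_on H3 (\<lambda>(a, b, c). F (m2 a b b c) $ i)" by (simp add: case_prod_beta')
    show "(\<lambda>a. case (a, b, c) of (a, b, c) \<Rightarrow> F (m2 a b b c) $ i) holomorphic_on {a. (a, b, c) \<in> H3}" for b c
      using slice[of "m2 0 b b c" 1 0 0] by (simp add: inH)
    show "(\<lambda>b. case (a, b, c) of (a, b, c) \<Rightarrow> F (m2 a b b c) $ i) holomorphic_on {b. (a, b, c) \<in> H3}" for a c
      using slice[of "m2 a 0 0 c" 0 1 0] by (simp add: inH)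
    show "(\<lambda>c. case (a, b, c) of (a, b, c) \<Rightarrow> F (m2 a b b c) $ i) holomorphic_on {c. (a, b, c) \<in> H3}" for a b
      using slice[of "m2 a b b 0" 0 0 1] by (simp add: inH)
    fix a b c assume "(a, b, c) \<in> H3"
    note p = per[OF this]
    show "(case (a + 1, b, c) of (a, b, c) \<Rightarrow> F (m2 a b b c) $ i) = (case (a, b, c) of (a, b, c) \<Rightarrow> F (m2 a b b c) $ i)"
      using p[of 1 0 0] by simp
    show "(case (a, b + 1, c) of (a, b, c) \<Rightarrow> F (m2 a b b c) $ i) = (case (a, b, c) of (a, b, c) \<Rightarrow> F (m2 a b b c) $ i)"
      using p[of 0 1 0] by simp
    show "(case (a, b, c + 1) of (a, b, c) \<Rightarrow> F (m2 a b b c) $ i) = (case (a, b, c) of (a, b, c) \<Rightarrow> F (m2 a b b c) $ i)"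
      using p[of 0 0 1] by simp
  qed
qed

lemma siegel_form_expands:
  fixes F :: "complex^2^2 \<Rightarrow> complex^'n"
  assumes F: "siegel_modular_form N V \<rho> l1 l2 F"
  shows "\<exists>c. expands F c \<and> (\<forall>S. c S \<noteq> 0 \<longrightarrow> half_integral S)"
proof -
  let ?f = "\<lambda>i (a, b, c). F (m2 a b b c) $ i"
  let ?h = "\<lambda>(n, r, m). m2 (of_int n) (of_int r / 2) (of_int r / 2) (of_int m) :: rat^2^2"
  \<comment> \<open>The floors recover the integers \<open>n\<close>, \<open>r\<close>,
    \<open>m\<close> from a half-integral matrix.\<close>
  define c where "c S = (\<chi> i. if half_integral S then periodic_hol.coeff (?f i) \<lfloor>S$1$1\<rfloor> \<lfloor>2 * S$1$2\<rfloor> \<lfloor>S$2$2\<rfloor> else 0)" for S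
  have hi: "half_integral S \<longleftrightarrow> S \<in> range ?h" for S by (auto simp: half_integral_def image_iff)
  have inj: "inj ?h" by (auto simp: inj_def)
  have hik: "half_integral (m2 (of_int n) (of_int r / 2) (of_int r / 2) (of_int m))" for n r m
    unfolding half_integral_def by blast
  have ch: "c (m2 (of_int n) (of_int r / 2) (of_int r / 2) (of_int m)) $ i = periodic_hol.coeff (?f i) n r m" for n r m i
    using hik[of n r m] by (simp add: c_def)
  have "((\<lambda>S. ee (tr S z) * c S $ i) has_sum F z $ i) UNIV" if zH: "z \<in> siegel_H2" for z i
  proof -
    interpret periodic_hol "?f i" by (rule siegel_form_periodic_hol[OF F])
    obtain a b c' where z: "z = m2 a b b c'" "(a, b, c') \<in> H3" using zH by (auto simp: siegel_H2_iff)
    have "((\<lambda>(n, r, m). coeff n r m * ee (lin3 n r m (a, b, c'))) has_sum F z $ i) UNIV"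
      using fourier_has_sum[OF z(2)] by (simp add: z)
    moreover have "(\<lambda>(n, r, m). coeff n r m * ee (lin3 n r m (a, b, c'))) = (\<lambda>S. ee (tr S z) * c S $ i) \<circ> ?h"
      by (auto simp: fun_eq_iff ch z lin3_def of_rat_divide mult.commute algebra_simps)
    ultimately have "((\<lambda>S. ee (tr S z) * c S $ i) has_sum F z $ i) (range ?h)"
      by (simp only: has_sum_reindex[OF inj])
    then show ?thesis
      by (rule has_sum_cong_neutral[THEN iffD1, rotated -1]) (auto simp: c_def hi)
  qed
  moreover have s0: "c S = 0" if "\<not> half_integral S" for S using that by (simp add: c_def vec_eq_iff)
  moreover have "transpose S = S" if "half_integral S" for S using that by (auto simp: half_integral_def)
  ultimately have "expands F c" unfolding expands_iff by blast
  then show ?thesis using s0 by blast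
qed

section \<open>The Koecher principle and the support of the Fourier coefficients\<close>

locale siegel_form =
  fixes N :: nat and V :: "(complex^'n) set" and \<rho> :: "complex^2^2 \<Rightarrow> complex^'n \<Rightarrow> complex^'n"
    and l1 l2 :: int and F :: "complex^2^2 \<Rightarrow> complex^'n"
  assumes form: "siegel_modular_form N V \<rho> l1 l2 F"
begin

lemma rep: "highest_weight_rep V \<rho> l1 l2" and F_V: "z \<in> siegel_H2 \<Longrightarrow> F z \<in> V"
  and modular: "\<gamma> \<in> Gamma0 N \<Longrightarrow> z \<in> siegel_H2 \<Longrightarrow> F (siegel_act \<gamma> z) = \<rho> (automorphy_factor \<gamma> z) (F z)"
  using form by (simp_all add: siegel_modular_form_def)

lemma poly_rep: "polynomial_rep V \<rho>" using rep by (simp add: highest_weight_rep_def)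

lemma subspace_V: "vec.subspace V"
  and rho_V: "invertible g \<Longrightarrow> v \<in> V \<Longrightarrow> \<rho> g v \<in> V"
  and rho_add: "invertible g \<Longrightarrow> v \<in> V \<Longrightarrow> w \<in> V \<Longrightarrow> \<rho> g (v + w) = \<rho> g v + \<rho> g w"
  and rho_smult: "invertible g \<Longrightarrow> v \<in> V \<Longrightarrow> \<rho> g (c *s v) = c *s \<rho> g v"
  and rho_1: "v \<in> V \<Longrightarrow> \<rho> (mat 1) v = v"
  and rho_mult: "invertible g \<Longrightarrow> invertible h \<Longrightarrow> v \<in> V \<Longrightarrow> \<rho> (g ** h) v = \<rho> g (\<rho> h v)"
  and rho_poly: "v \<in> V \<Longrightarrow> \<exists>P. polynomial_in_entries P \<and> (\<forall>g. invertible g \<longrightarrow> \<rho> g v $ i = P g)"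
  using poly_rep unfolding polynomial_rep_def by simp_all

lemma V_projection: "\<exists>P :: complex^'n^'n. (\<forall>v. P *v v \<in> V) \<and> (\<forall>v\<in>V. P *v v = v)"
proof -
  have "Vector_Spaces.linear (*s) (*s) (\<lambda>v :: complex^'n. v)"
    by (rule vec.linear_ident)
  from vec.linear_exists_left_inverse_on[OF this subspace_V]
  obtain g :: "complex^'n \<Rightarrow> complex^'n" where g: "range g \<subseteq> V" "Vector_Spaces.linear (*s) (*s) g" "\<forall>v\<in>V. g v = v"
    by auto
  have "matrix g *v v = g v" for v by (rule matrix_works[OF g(2)])
  then show ?thesis using g by (intro exI[of _ "matrix g"]) auto
qed

text \<open>\<open>\<rho> g\<close> is only linear on \<open>V\<close>; composing with a projection onto \<open>V\<close> turns it into a matrix.\<close>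

definition proj :: "complex^'n^'n" where
  "proj = (SOME P. (\<forall>v. P *v v \<in> V) \<and> (\<forall>v\<in>V. P *v v = v))"

lemma proj_V: "proj *v v \<in> V" and proj_id: "v \<in> V \<Longrightarrow> proj *v v = v"
  using someI_ex[OF V_projection] unfolding proj_def by blast+

definition R :: "complex^2^2 \<Rightarrow> complex^'n^'n" where "R g = matrix (\<lambda>v. \<rho> g (proj *v v))"

lemma R_works:
  assumes "invertible g" shows "R g *v v = \<rho> g (proj *v v)"
  unfolding R_def
proof (rule matrix_works)
  show "Vector_Spaces.linear (*s) (*s) (\<lambda>v. \<rho> g (proj *v v))"
    by unfold_locales
       (simp_all add: matrix_vector_right_distrib vector_scalar_commute rho_add[OF assms] rho_smult[OF assms] proj_V)
qed

lemma R_V: "invertible g \<Longrightarrow> v \<in> V \<Longrightarrow> R g *v v = \<rho> g v"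
  by (simp add: R_works proj_id)

text \<open>\<open>proj\<close> fixes the values of \<open>F\<close>, so by uniqueness of the
  expansion it fixes the coefficients.\<close>

lemma expands_F_V:
  assumes "expands F c" shows "c S \<in> V"
proof -
  have "expands (\<lambda>z. proj *v F z) (\<lambda>S. proj *v c S)" by (rule expands_matrix[OF assms])
  then have "expands F (\<lambda>S. proj *v c S)" by (rule expands_cong) (simp add: F_V proj_id)
  then have "c = (\<lambda>S. proj *v c S)" by (rule expands_unique[OF assms])
  then have "c S = proj *v c S" by (rule fun_cong)
  then show ?thesis using proj_V by metis
qed

text \<open>Schur's argument: the eigenspace of \<open>\<rho> (mat a)\<close> through the highest
  weight vector is stable under the whole group, since scalars are central, and irreducibility makes
  it all of \<open>V\<close>.\<close>

lemma scalar_action: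
  assumes a: "a \<noteq> 0" and v: "v \<in> V"
  shows "\<rho> (mat a) v = (a powi (l1 + l2)) *s v"
proof -
  obtain v0 where v0: "v0 \<in> V" "v0 \<noteq> 0"
    "\<And>a b. a \<noteq> 0 \<Longrightarrow> b \<noteq> 0 \<Longrightarrow> \<rho> (vector [vector [a, 0], vector [0, b]]) v0 = (a powi l1 * b powi l2) *s v0"
    using rep unfolding highest_weight_rep_def by blast
  have ma: "(mat a :: complex^2^2) = vector [vector [a, 0], vector [0, a]]" by (simp add: mat_m2 m2_def)
  have inv: "invertible (mat a :: complex^2^2)" using a by (simp add: mat_m2 m2_invertible_iff)
  define W where "W = {v \<in> V. \<rho> (mat a) v = (a powi (l1 + l2)) *s v}"
  have z: "0 \<in> V" using subspace_V vec.subspace_0 by blast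
  have "vec.subspace W"
    unfolding vec.subspace_def
  proof (intro conjI ballI allI)
    have "\<rho> (mat a) (0 *s 0) = 0 *s \<rho> (mat a) 0" by (rule rho_smult[OF inv z])
    then show "0 \<in> W" using z by (simp add: W_def)
  next
    fix x y assume "x \<in> W" "y \<in> W"
    then show "x + y \<in> W" using rho_add[OF inv] vec.subspace_add[OF subspace_V]
      by (simp add: W_def vector_add_ldistrib)
  next
    fix c x assume "x \<in> W"
    then show "c *s x \<in> W" using rho_smult[OF inv] vec.subspace_scale[OF subspace_V]
      by (simp add: W_def mult.commute)
  qed
  moreover have "W \<subseteq> V" by (auto simp: W_def)
  moreover have "\<rho> g w \<in> W" if "invertible g" "w \<in> W" for g w
  proof -
    have w: "w \<in> V" "\<rho> (mat a) w = (a powi (l1 + l2)) *s w" using that by (simp_all add: W_def)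
    have "mat a ** g = g ** mat a" by (cases g rule: m2_cases) (simp add: mat_m2 mult.commute)
    then have "\<rho> (mat a) (\<rho> g w) = \<rho> g (\<rho> (mat a) w)"
      using rho_mult[OF inv that(1) w(1)] rho_mult[OF that(1) inv w(1)] by simp
    then show ?thesis using w that(1) by (simp add: W_def rho_V rho_smult)
  qed
  ultimately have "W = {0} \<or> W = V"
    using rep unfolding highest_weight_rep_def irreducible_rep_def by blast
  moreover have "v0 \<in> W" using v0(1) v0(3)[of a a] a by (simp add: W_def ma power_int_add)
  ultimately have "W = V" using v0(2) by blast
  then show ?thesis using v by (auto simp: W_def)
qed

text \<open>The block diagonal matrix formed by the inverse transpose of \<open>U\<close> and
  \<open>U\<close> lies in \<open>Gamma0 N\<close> for every \<open>N\<close> and acts by a linear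
  substitution, so modularity can be compared with the reindexed expansion.\<close>

lemma coeff_transform:
  assumes c: "expands F c" and U: "U ** U' = mat 1" "\<And>i j. U $ i $ j \<in> \<int>" "\<And>i j. U' $ i $ j \<in> \<int>"
  shows "c (U ** T ** transpose U) = \<rho> (cm U) (c T)"
proof -
  define A where "A = transpose U'"
  let ?g = "blk A 0 0 U"
  have AU: "A ** transpose U = mat 1" unfolding A_def matrix_transpose_mul[symmetric] U(1) by simp
  have g: "?g \<in> Gamma0 N"
  proof -
    have "A ** transpose U = mat 1" "U ** transpose A = mat 1" using AU U(1) by (simp_all add: A_def)
    then have "symplectic_similitude ?g 1"
      by (cases A rule: m2_cases; cases U rule: m2_cases) (simp add: symplectic_similitude_blk zero_m2 mat_m2)
    moreover have "A $ i $ j \<in> \<int>" for i j using U(3) by (simp add: A_def transpose_def)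
    ultimately show ?thesis unfolding Gamma0_def by (auto simp: all_sum_type U(2) intro!: bexI[of _ 0])
  qed
  have cmU: "cm U ** cm U' = mat 1" using U(1) by (simp add: cm_mult[symmetric] cm_mat)
  then have invU: "invertible (cm U)" "matrix_inv (cm U) = cm U'" using matrix_inv_unique by blast+
  have c0: "cm 0 = 0" by (simp add: zero_m2)
  have act: "F (cm A ** z ** cm (transpose A)) = R (cm U) *v F z" if "z \<in> siegel_H2" for z
  proof -
    have "automorphy_factor ?g z = cm U" by (simp add: automorphy_factor_def c0)
    moreover then have "siegel_act ?g z = cm A ** z ** cm (transpose A)"
      by (simp add: siegel_act_def invU c0 A_def)
    ultimately show ?thesis using modular[OF g that] by (simp add: R_V invU F_V that)
  qed
  have "expands (\<lambda>z. F (cm (mat 1 ** A) ** z ** cm (transpose A) + cm 0))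
     (\<lambda>T. ee (tr (mat (1/1) ** transpose (transpose U) ** T ** transpose U) (cm 0)) *s c (mat (1/1) ** transpose (transpose U) ** T ** transpose U))"
    by (rule expands_subst[OF c AU]) (simp_all add: zero_m2)
  then have "expands (\<lambda>z. F (cm A ** z ** cm (transpose A))) (\<lambda>T. c (U ** T ** transpose U))"
    by (simp add: c0 tr_def trace_def)
  then have "expands (\<lambda>z. R (cm U) *v F z) (\<lambda>T. c (U ** T ** transpose U))"
    by (rule expands_cong) (simp add: act)
  from expands_unique[OF this expands_matrix[OF c]]
  have "c (U ** T ** transpose U) = R (cm U) *v c T" by (rule fun_cong)
  then show ?thesis using R_V[OF invU(1) expands_F_V[OF c]] by simp
qed

text \<open>Serves the Koecher principle: \<open>\<rho>\<close> of the unipotent matrices grows at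
  most polynomially in \<open>k\<close>, which a Gaussian factor outweighs.\<close>

lemma polynomial_growth:
  assumes "polynomial_in_entries P" and "\<And>k i j. norm (G k $ i $ j) \<le> K * (1 + real k)"
  shows "\<exists>C m. C \<ge> 0 \<and> (\<forall>k. norm (P (G k)) \<le> C * (1 + real k) ^ m)"
  using assms(1)
proof induction
  case (const c)
  show ?case by (rule exI[of _ "norm c"], rule exI[of _ 0]) simp
next
  case (entry i j)
  have "K * (1 + real k) \<le> \<bar>K\<bar> * (1 + real k) ^ 1" for k by (simp add: mult_right_mono)
  from order_trans[OF assms(2) this] show ?case by (intro exI[of _ "\<bar>K\<bar>"] exI[of _ 1]) simp
next
  case (add P Q)
  then obtain C m C' m' where C: "C \<ge> 0" "\<And>k. norm (P (G k)) \<le> C * (1 + real k) ^ m"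
     "C' \<ge> 0" "\<And>k. norm (Q (G k)) \<le> C' * (1 + real k) ^ m'" by blast
  have "norm (P (G k) + Q (G k)) \<le> (C + C') * (1 + real k) ^ (m + m')" for k
  proof -
    have "C * (1 + real k) ^ m \<le> C * (1 + real k) ^ (m + m')" "C' * (1 + real k) ^ m' \<le> C' * (1 + real k) ^ (m + m')"
      using C by (auto intro!: mult_left_mono power_increasing)
    then show ?thesis using C(2)[of k] C(4)[of k] norm_triangle_ineq[of "P (G k)" "Q (G k)"]
      unfolding distrib_right by linarith
  qed
  then show ?case using C by (intro exI[of _ "C + C'"] exI[of _ "m + m'"]) simp
next
  case (mult P Q)
  then obtain C m C' m' where C: "C \<ge> 0" "\<And>k. norm (P (G k)) \<le> C * (1 + real k) ^ m"
     "C' \<ge> 0" "\<And>k. norm (Q (G k)) \<le> C' * (1 + real k) ^ m'" by blast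
  have "norm (P (G k) * Q (G k)) \<le> (C * C') * (1 + real k) ^ (m + m')" for k
  proof -
    have "norm (P (G k) * Q (G k)) \<le> (C * (1 + real k) ^ m) * (C' * (1 + real k) ^ m')"
      unfolding norm_mult using C by (intro mult_mono) auto
    then show ?thesis by (simp add: power_add mult_ac)
  qed
  then show ?case using C by (intro exI[of _ "C * C'"] exI[of _ "m + m'"]) simp
qed

lemma exp_quadratic_tendsto:
  fixes C \<beta> \<alpha> \<gamma> :: real
  assumes "\<gamma> > 0" shows "(\<lambda>k::nat. C * (1 + real k) ^ m * exp (\<alpha> + \<beta> * real k - \<gamma> * (real k)\<^sup>2)) \<longlonglongrightarrow> 0"
  using assms by real_asymp

text \<open>Each term of the absolutely convergent series at i times the identity is bounded by the
  total, uniformly in the index.\<close>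

lemma coeff_bounded:
  assumes c: "expands F c"
  shows "\<exists>B\<ge>0. \<forall>S i. norm (c S $ i) \<le> B * exp (2 * pi * of_rat (trace S))"
proof -
  have z0: "m2 \<i> 0 0 \<i> \<in> siegel_H2" by (auto simp: siegel_H2_iff H3_def pd_def)
  have "\<exists>B. \<forall>S. norm (ee (tr S (m2 \<i> 0 0 \<i>)) * c S $ i) \<le> B" for i
  proof -
    have "(\<lambda>S. norm (ee (tr S (m2 \<i> 0 0 \<i>)) * c S $ i)) summable_on UNIV"
    proof -
      have "((\<lambda>S. ee (tr S (m2 \<i> 0 0 \<i>)) * c S $ i) has_sum F (m2 \<i> 0 0 \<i>) $ i) UNIV"
        using c z0 by (simp add: expands_iff)
      from has_sum_imp_summable[OF this] show ?thesis
        by (rule summable_on_iff_abs_summable_on_complex[THEN iffD1])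
    qed
    from finite_sum_le_infsum[OF this, of "{S}" for S]
    have "norm (ee (tr S (m2 \<i> 0 0 \<i>)) * c S $ i) \<le> (\<Sum>\<^sub>\<infinity>S. norm (ee (tr S (m2 \<i> 0 0 \<i>)) * c S $ i))" for S by simp
    then show ?thesis by blast
  qed
  then obtain b where b: "\<And>i S. norm (ee (tr S (m2 \<i> 0 0 \<i>)) * c S $ i) \<le> b i" by metis
  have b0: "b i \<ge> 0" for i using b[of 0 i] norm_ge_zero order_trans by blast
  have "norm (c S $ i) \<le> (\<Sum>i\<in>UNIV. b i) * exp (2 * pi * of_rat (trace S))" for S i
  proof -
    obtain s1 s2 s3 s4 where S: "S = m2 s1 s2 s3 s4" by (rule m2_cases)
    have "norm (ee (tr S (m2 \<i> 0 0 \<i>))) = exp (- (2 * pi * of_rat (trace S)))"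
      by (simp add: S norm_ee of_real_of_rat[symmetric] of_rat_add)
    then have "norm (c S $ i) * exp (- (2 * pi * of_rat (trace S))) \<le> (\<Sum>i\<in>UNIV. b i)"
      using b[of S i] member_le_sum[of i UNIV b] b0 by (simp add: norm_mult mult.commute)
    then show ?thesis by (simp add: exp_minus field_simps)
  qed
  then show ?thesis using b0 by (intro exI[of _ "\<Sum>i\<in>UNIV. b i"]) (simp add: sum_nonneg)
qed

text \<open>
  Koecher principle: the unipotent matrices fixing a vector on which \<open>T\<close> is negative move \<open>T\<close>
  to matrices whose trace tends quadratically to minus infinity.
\<close>

lemma koecher:
  assumes c: "expands F c" and u: "u \<in> \<int>" "v \<in> \<int>" and neg: "t1 * u\<^sup>2 + 2 * t2 * u * v + t3 * v\<^sup>2 < 0"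
  shows "c (m2 t1 t2 t2 t3) = 0"
proof -
  let ?T = "m2 t1 t2 t2 t3"
  \<comment> \<open>\<open>U k\<close> is the identity plus \<open>k\<close> times the column (-v,
    u) times the row (u, v). These are orthogonal, so the increment squares to zero and
    \<open>U (- k)\<close> is the inverse; the quadratic term of the trace of U T U^T is the value
    of the form at (u, v) times u^2 + v^2.\<close>
  define U where "U k = m2 (1 - k * v * u) (- k * v * v) (k * u * u) (1 + k * u * v)" for k :: rat
  have UU: "U (- k) ** U k = mat 1" for k
    by (simp add: U_def mat_m2 algebra_simps)
  have UZ: "U k $ i $ j \<in> \<int>" if "k \<in> \<int>" for k i j
    using exhaust_2[of i] exhaust_2[of j] u that by (auto simp: U_def)
  define q w where "q = t1 * u\<^sup>2 + 2 * t2 * u * v + t3 * v\<^sup>2" and "w = u\<^sup>2 + v\<^sup>2"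
  define \<beta> where "\<beta> = 2 * (- v * (t1 * u + t2 * v) + u * (t2 * u + t3 * v))"
  have trace: "trace (U k ** ?T ** transpose (U k)) = t1 + t3 + \<beta> * k + q * w * k\<^sup>2" for k
    by (simp add: U_def q_def w_def \<beta>_def power2_eq_square algebra_simps)
  have "u \<noteq> 0 \<or> v \<noteq> 0" using neg by auto
  then have w: "w > 0" unfolding w_def by (simp add: sum_power2_gt_zero_iff)
  have q: "q < 0" using neg by (simp add: q_def)
  obtain B where B: "B \<ge> 0" "\<And>S i. norm (c S $ i) \<le> B * exp (2 * pi * of_rat (trace S))"
    using coeff_bounded[OF c] by blast
  \<comment> \<open>The inverse of \<open>U k\<close>. It expresses \<open>c ?T\<close> through the
    coefficient at the transformed matrix, whose exponential bound is Gaussian in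
    \<open>k\<close>.\<close>
  define G where "G k = cm (U (- of_nat k))" for k :: nat
  have invG: "invertible (G k)" for k
    unfolding G_def using matrix_inv_unique(2)[of "cm (U (- of_nat k))" "cm (U (of_nat k))"] UU
    by (simp add: cm_mult[symmetric] cm_mat)
  define K where "K = (1 + \<bar>of_rat v * of_rat u\<bar> + \<bar>of_rat v * of_rat v\<bar> + \<bar>of_rat u * of_rat u\<bar> :: real)"
  have K: "norm (G k $ i $ j) \<le> K * (1 + real k)" for k i j
  proof -
    define a1 a2 a3 where "a1 = (of_rat v * of_rat u :: real)" and "a2 = (of_rat v * of_rat v :: real)" and "a3 = (of_rat u * of_rat u :: real)"
    have G: "G k $ 1 $ 1 = of_real (1 + real k * a1)" "G k $ 1 $ 2 = of_real (real k * a2)"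
      "G k $ 2 $ 1 = of_real (- (real k * a3))" "G k $ 2 $ 2 = of_real (1 - real k * a1)"
      by (simp_all add: G_def U_def a1_def a2_def a3_def of_rat_add of_rat_diff of_rat_mult of_rat_minus of_real_of_rat mult_ac)
    have KK: "K = 1 + \<bar>a1\<bar> + \<bar>a2\<bar> + \<bar>a3\<bar>" by (simp add: K_def a1_def a2_def a3_def)
    have ge: "\<bar>a\<bar> * real k \<ge> 0" for a :: real by simp
    have "K * (1 + real k) = 1 + \<bar>a1\<bar> + \<bar>a2\<bar> + \<bar>a3\<bar> + real k + \<bar>a1\<bar> * real k + \<bar>a2\<bar> * real k + \<bar>a3\<bar> * real k"
      unfolding KK by (simp add: algebra_simps)
    moreover have "\<bar>1 + real k * a1\<bar> \<le> 1 + \<bar>a1\<bar> * real k" "\<bar>1 - real k * a1\<bar> \<le> 1 + \<bar>a1\<bar> * real k"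
       "\<bar>real k * a2\<bar> = \<bar>a2\<bar> * real k" "\<bar>- (real k * a3)\<bar> = \<bar>a3\<bar> * real k"
      using abs_triangle_ineq[of 1 "real k * a1"] abs_triangle_ineq4[of 1 "real k * a1"] by (simp_all add: abs_mult mult.commute)
    ultimately have "norm (G k $ 1 $ 1) \<le> K * (1 + real k)" "norm (G k $ 1 $ 2) \<le> K * (1 + real k)"
       "norm (G k $ 2 $ 1) \<le> K * (1 + real k)" "norm (G k $ 2 $ 2) \<le> K * (1 + real k)"
      unfolding G norm_of_real using ge[of a1] ge[of a2] ge[of a3] by linarith+
    then show ?thesis using exhaust_2[of i] exhaust_2[of j] by auto
  qed
  have "norm (c ?T $ i) \<le> e" if "e > 0" for e i
  proof -
    have "\<exists>C m. C \<ge> 0 \<and> (\<forall>k. norm (R (G k) $ i $ j) \<le> C * (1 + real k) ^ m)" for j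
    proof -
      obtain P where P: "polynomial_in_entries P" "\<And>g. invertible g \<Longrightarrow> \<rho> g (proj *v axis j 1) $ i = P g"
        using rho_poly[OF proj_V] by blast
      have "R (G k) $ i $ j = P (G k)" for k
      proof -
        have "R (G k) $ i $ j = (R (G k) *v axis j 1) $ i"
          by (simp add: matrix_vector_mult_def axis_def if_distrib cong: if_cong)
        then show ?thesis using P(2)[OF invG] by (simp add: R_works[OF invG])
      qed
      then show ?thesis using polynomial_growth[OF P(1) K] by simp
    qed
    then obtain C m where C: "\<And>j. C j \<ge> 0" "\<And>j k. norm (R (G k) $ i $ j) \<le> C j * (1 + real k) ^ m j" by metis
    let ?b = "\<lambda>k. \<Sum>j\<in>UNIV. (C j * B) * (1 + real k) ^ m j * exp (2 * pi * of_rat (t1 + t3) + 2 * pi * of_rat \<beta> * real k - (2 * pi * of_rat (- q * w)) * (real k)\<^sup>2)"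
    have "norm (c ?T $ i) \<le> ?b k" for k
    proof -
      let ?S = "U (of_nat k) ** ?T ** transpose (U (of_nat k))"
      have cS: "c ?S = \<rho> (cm (U (of_nat k))) (c ?T)"
        by (rule coeff_transform[OF c, of _ "U (- of_nat k)"]) (use UU[of "- of_nat k"] UZ in auto)
      have i2: "invertible (cm (U (of_nat k)))"
        using matrix_inv_unique(2)[of "cm (U (of_nat k))" "cm (U (- of_nat k))"] UU[of "- of_nat k"]
        by (simp add: cm_mult[symmetric] cm_mat)
      have "c ?T = \<rho> (G k ** cm (U (of_nat k))) (c ?T)"
        by (simp add: G_def cm_mult[symmetric] UU cm_mat rho_1 expands_F_V[OF c])
      also have "\<dots> = R (G k) *v c ?S"
        unfolding cS by (simp add: rho_mult[OF invG i2] R_V[OF invG] expands_F_V[OF c] rho_V[OF i2])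
      finally have "c ?T $ i = (\<Sum>j\<in>UNIV. R (G k) $ i $ j * c ?S $ j)" by (simp add: matrix_vector_mult_def)
      then have "norm (c ?T $ i) \<le> (\<Sum>j\<in>UNIV. norm (R (G k) $ i $ j) * norm (c ?S $ j))"
        by (simp add: sum_norm_le norm_mult)
      also have "\<dots> \<le> (\<Sum>j\<in>UNIV. (C j * (1 + real k) ^ m j) * (B * exp (2 * pi * of_rat (trace ?S))))"
        by (intro sum_mono mult_mono C B mult_nonneg_nonneg norm_ge_zero) (use C in auto)
      also have "\<dots> = ?b k"
        unfolding trace by (intro sum.cong refl) (simp add: of_rat_add of_rat_mult of_rat_power of_rat_minus algebra_simps)
      finally show ?thesis .
    qed
    moreover have "?b \<longlonglongrightarrow> (\<Sum>j\<in>(UNIV :: 'n set). 0)"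
    proof (rule tendsto_sum)
      have "2 * pi * real_of_rat (- q * w) > 0" using q w by (simp add: mult_neg_pos)
      then show "(\<lambda>k. (C j * B) * (1 + real k) ^ m j * exp (2 * pi * of_rat (t1 + t3) + 2 * pi * of_rat \<beta> * real k - (2 * pi * of_rat (- q * w)) * (real k)\<^sup>2)) \<longlonglongrightarrow> 0" for j
        by (rule exp_quadratic_tendsto)
    qed
    ultimately have "norm (c ?T $ i) \<le> 0" by (intro LIMSEQ_le_const) auto
    then show ?thesis using that by simp
  qed
  then have "norm (c ?T $ i) \<le> 0" for i using field_le_epsilon[of "norm (c ?T $ i)" 0] by simp
  then show ?thesis by (simp add: vec_eq_iff)
qed

theorem fourier_coeff_expands: "expands F (fourier_coeff F)"
  and fourier_coeff_support: "S \<notin> half_integral_psd \<Longrightarrow> fourier_coeff F S = 0"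
  and fourier_coeff_half_integral: "fourier_coeff F S \<noteq> 0 \<Longrightarrow> half_integral S"
proof -
  obtain c where c: "expands F c" "\<And>S. c S \<noteq> 0 \<Longrightarrow> half_integral S"
    using siegel_form_expands[OF form] by blast
  have supp: "S \<in> half_integral_psd" if cS: "c S \<noteq> 0" for S
  proof -
    obtain n r m :: int where S: "S = m2 (of_int n) (of_int r / 2) (of_int r / 2) (of_int m)"
      using c(2)[OF cS] by (auto simp: half_integral_def)
    have nn: "0 \<le> n * u\<^sup>2 + r * u * v + m * v\<^sup>2" for u v :: int
    proof (rule ccontr)
      assume "\<not> ?thesis"
      then have "(of_int (n * u\<^sup>2 + r * u * v + m * v\<^sup>2) :: rat) < 0" by (simp only: of_int_less_0_iff not_le)
      then have "c S = 0" unfolding S by (intro koecher[OF c(1), of "of_int u" "of_int v"]) simp_all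
      then show False using cS by simp
    qed
    have n: "n \<ge> 0" using nn[of 1 0] by simp
    have m: "m \<ge> 0" using nn[of 0 1] by simp
    \<comment> \<open>Koecher gives nonnegativity at integer vectors only. The vectors (-(m + 1), r)
      for \<open>n = 0\<close> and (- r, 2 n) otherwise extract the discriminant inequality, from
      which positivity at real vectors follows.\<close>
    have disc: "r\<^sup>2 \<le> 4 * n * m"
    proof (cases "n = 0")
      case True
      have "0 \<le> r * (- (m + 1)) * r + m * r\<^sup>2" using nn[of "- (m + 1)" r] True by simp
      also have "\<dots> = - (r\<^sup>2)" by (simp add: algebra_simps power2_eq_square)
      finally show ?thesis using True by simp
    next
      case False
      have "0 \<le> n * (4 * n * m - r\<^sup>2)" using nn[of "- r" "2 * n"] by (simp add: algebra_simps power2_eq_square)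
      then show ?thesis using n False by (simp add: zero_le_mult_iff)
    qed
    have "0 \<le> x \<bullet> ((\<chi> i j. of_rat (S $ i $ j)) *v x)" for x :: "real^2"
    proof -
      have e: "x \<bullet> ((\<chi> i j. of_rat (S $ i $ j)) *v x) = n * (x$1)\<^sup>2 + r * x$1 * x$2 + m * (x$2)\<^sup>2"
        by (simp add: S inner_vec_def sum_2 matrix_vector_mult_def of_rat_divide algebra_simps power2_eq_square)
      show ?thesis
      proof (cases "n = 0")
        case True
        then have "r = 0" using disc by simp
        then show ?thesis unfolding e using True m by simp
      next
        case False
        have "real_of_int (r\<^sup>2) \<le> real_of_int (4 * n * m)" using disc by (simp only: of_int_le_iff)
        then have "0 \<le> (2 * n * x$1 + r * x$2)\<^sup>2 + (4 * n * m - (real_of_int r)\<^sup>2) * (x$2)\<^sup>2" by simp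
        also have "\<dots> = 4 * n * (n * (x$1)\<^sup>2 + r * x$1 * x$2 + m * (x$2)\<^sup>2)"
          by (simp add: algebra_simps power2_eq_square)
        finally show ?thesis unfolding e using n False by (simp add: zero_le_mult_iff)
      qed
    qed
    moreover have "(of_int r / 2 :: rat) * 2 \<in> \<int>" "2 * (of_int r / 2 :: rat) \<in> \<int>" "2 * (of_int n :: rat) \<in> \<int>" "2 * (of_int m :: rat) \<in> \<int>" by auto
    ultimately show ?thesis unfolding half_integral_psd_def by (auto simp: S forall_2)
  qed
  \<comment> \<open>On families supported in the semidefinite index set both notions of expansion
    agree, so \<open>expands_unique\<close> resolves the definite description.\<close>
  have fe: "fourier_expansion F d \<longleftrightarrow> expands F d" if "\<forall>S. S \<notin> half_integral_psd \<longrightarrow> d S = 0" for d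
  proof -
    have "transpose S = S" if "S \<in> half_integral_psd" for S using that by (simp add: half_integral_psd_def)
    then have sym: "\<forall>S. transpose S \<noteq> S \<longrightarrow> d S = 0" using that by blast
    have "((\<lambda>S. ee (tr S z) *s d S) has_sum F z) half_integral_psd \<longleftrightarrow> ((\<lambda>S. ee (tr S z) *s d S) has_sum F z) UNIV" for z
      by (rule has_sum_cong_neutral) (use that in auto)
    then show ?thesis using sym unfolding fourier_expansion_def expands_def ee_def tr_def cm_def by simp
  qed
  have "fourier_coeff F = c"
    unfolding fourier_coeff_def
  proof (rule the_equality)
    show "fourier_expansion F c \<and> (\<forall>S. S \<notin> half_integral_psd \<longrightarrow> c S = 0)" using fe c supp by blast
    show "d = c" if "fourier_expansion F d \<and> (\<forall>S. S \<notin> half_integral_psd \<longrightarrow> d S = 0)" for d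
      using that fe expands_unique c(1) by blast
  qed
  then show "expands F (fourier_coeff F)" "S \<notin> half_integral_psd \<Longrightarrow> fourier_coeff F S = 0"
    "fourier_coeff F S \<noteq> 0 \<Longrightarrow> half_integral S"
    using c supp by blast+
qed

end

section \<open>Left cosets in the double cosets of T(p) and of diag(p^2,p,1,p)\<close>

locale p_local =
  fixes p :: nat
  assumes prime_p: "prime p"
begin

abbreviation Zp :: "rat set" where "Zp \<equiv> Z_localized p"
abbreviation pr :: rat where "pr \<equiv> of_nat p"

lemma p_nz [simp]: "p > 0" "p \<noteq> 0" "p > 1" "p > Suc 0" "p \<noteq> Suc 0"
  using prime_gt_1_nat[OF prime_p] by auto

lemma prime_int_p: "prime (int p)" using prime_p by simp

text \<open>The definition speaks of the reduced fraction; here any denominator prime to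
  \<open>p\<close> is allowed, which makes closure under the ring operations immediate.\<close>

lemma Zp_iff: "x \<in> Zp \<longleftrightarrow> (\<exists>a b. \<not> int p dvd b \<and> x = of_int a / of_int b)"
proof
  assume x: "x \<in> Zp"
  obtain a b where "quotient_of x = (a, b)" by (cases "quotient_of x")
  then show "\<exists>a b. \<not> int p dvd b \<and> x = of_int a / of_int b"
    using x quotient_of_div[of x a b] by (intro exI[of _ a] exI[of _ b]) (simp add: Z_localized_def)
next
  assume "\<exists>a b. \<not> int p dvd b \<and> x = of_int a / of_int b"
  then obtain a b where ab: "\<not> int p dvd b" "x = of_int a / of_int b" by blast
  obtain n d where q: "quotient_of x = (n, d)" by (cases "quotient_of x")
  have d: "d > 0" "coprime n d" "x = of_int n / of_int d"
    using q quotient_of_denom_pos quotient_of_coprime quotient_of_div by blast+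
  have "b \<noteq> 0" using ab(1) by auto
  then have "of_int (n * b) = (of_int (a * d) :: rat)" using ab(2) d by (simp add: field_simps)
  then have "n * b = a * d" using of_int_eq_iff by blast
  then have "d dvd n * b" by simp
  then have "d dvd b" using d(2) by (simp add: coprime_dvd_mult_right_iff coprime_commute)
  then have "\<not> int p dvd d" using ab(1) dvd_trans by blast
  then show "x \<in> Zp" by (simp add: Z_localized_def q)
qed

lemma Zp_of_int [simp]: "of_int n \<in> Zp"
  unfolding Zp_iff using p_nz by (intro exI[of _ n] exI[of _ 1]) auto

lemma Zp_of_nat [simp]: "of_nat n \<in> Zp" using Zp_of_int[of "int n"] by simp
lemma Zp_0 [simp]: "0 \<in> Zp" and Zp_1 [simp]: "1 \<in> Zp"
  using Zp_of_int[of 0] Zp_of_int[of 1] by simp_all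
lemma Zp_mult [intro]: assumes "x \<in> Zp" "y \<in> Zp" shows "x * y \<in> Zp"
proof -
  obtain a b c d where "\<not> int p dvd b" "x = of_int a / of_int b" "\<not> int p dvd d" "y = of_int c / of_int d"
    using assms unfolding Zp_iff by blast
  moreover then have "\<not> int p dvd b * d" using prime_dvd_mult_iff[OF prime_int_p] by blast
  ultimately show ?thesis unfolding Zp_iff by (intro exI[of _ "a * c"] exI[of _ "b * d"]) simp
qed

lemma Zp_add [intro]: assumes "x \<in> Zp" "y \<in> Zp" shows "x + y \<in> Zp"
proof -
  obtain a b c d where ab: "\<not> int p dvd b" "x = of_int a / of_int b" "\<not> int p dvd d" "y = of_int c / of_int d"
    using assms unfolding Zp_iff by blast
  moreover then have "\<not> int p dvd b * d" using prime_dvd_mult_iff[OF prime_int_p] by blast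
  moreover have "b \<noteq> 0" "d \<noteq> 0" using ab by auto
  ultimately show ?thesis unfolding Zp_iff by (intro exI[of _ "a * d + c * b"] exI[of _ "b * d"]) (simp add: field_simps)
qed

lemma Zp_minus [intro]: "x \<in> Zp \<Longrightarrow> - x \<in> Zp"
  using Zp_mult[of "- 1" x] Zp_of_int[of "- 1"] by simp
lemma Zp_diff [intro]: "x \<in> Zp \<Longrightarrow> y \<in> Zp \<Longrightarrow> x - y \<in> Zp"
  using Zp_add[of x "- y"] by auto
lemma Zp_power [intro]: "x \<in> Zp \<Longrightarrow> x ^ n \<in> Zp" by (induction n) auto
lemma Zp_minus_iff [simp]: "- x \<in> Zp \<longleftrightarrow> x \<in> Zp" using Zp_minus[of x] Zp_minus[of "- x"] by auto

lemma Zp_int_div_power: "of_int n / pr ^ k \<in> Zp \<longleftrightarrow> int p ^ k dvd n"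
proof
  assume "of_int n / pr ^ k \<in> Zp"
  then obtain a b where ab: "\<not> int p dvd b" "of_int n / pr ^ k = of_int a / of_int b" unfolding Zp_iff by blast
  have "b \<noteq> 0" using ab by auto
  then have "of_int (n * b) = (of_int (a * int p ^ k) :: rat)" using ab(2) by (simp add: field_simps)
  then have "n * b = a * int p ^ k" using of_int_eq_iff by blast
  then have "int p ^ k dvd n * b" by simp
  moreover have "coprime (int p ^ k) b" using ab(1) prime_imp_coprime[OF prime_int_p] by simp
  ultimately show "int p ^ k dvd n" by (simp add: coprime_dvd_mult_left_iff)
next
  assume "int p ^ k dvd n"
  then obtain m where "n = int p ^ k * m" by blast
  then have "of_int n / pr ^ k = of_int m" by simp
  then show "of_int n / pr ^ k \<in> Zp" by simp
qed

lemma Zp_valuation: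
  assumes "x \<noteq> 0"
  obtains k :: int and u where "x = pr powi k * u" "u \<in> Zp" "1 / u \<in> Zp" "u \<noteq> 0"
proof -
  obtain a b where q: "quotient_of x = (a, b)" by (cases "quotient_of x")
  then have x: "x = of_int a / of_int b" "b > 0" using quotient_of_div quotient_of_denom_pos by blast+
  have a: "a \<noteq> 0" using x assms by auto
  have nu: "\<not> is_unit (int p)" using prime_int_p by (simp add: not_prime_unit)
  obtain a' where a': "a = int p ^ multiplicity (int p) a * a'" "\<not> int p dvd a'"
    by (rule multiplicity_decompose'[OF a nu])
  have b0: "b \<noteq> 0" using x by simp
  obtain b' where b': "b = int p ^ multiplicity (int p) b * b'" "\<not> int p dvd b'"
    by (rule multiplicity_decompose'[OF b0 nu])
  define i j where "i = multiplicity (int p) a" and "j = multiplicity (int p) b"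
  have a'0: "a' \<noteq> 0" "b' \<noteq> 0" using a' b' by auto
  define u where "u = (of_int a' / of_int b' :: rat)"
  have u: "u \<in> Zp" "1 / u \<in> Zp" "u \<noteq> 0" using a' b' a'0 unfolding u_def Zp_iff by auto
  have "x = pr ^ i * of_int a' / (pr ^ j * of_int b')"
    unfolding x(1) by (subst a'(1), subst b'(1)) (simp add: i_def j_def)
  also have "\<dots> = pr powi (int i - int j) * u"
    by (simp add: u_def power_int_diff)
  finally show ?thesis using that u by blast
qed

text \<open>The valuation ring property: the entry of smaller valuation divides the other. It drives
  the row reduction.\<close>

lemma Zp_ratio: "x \<noteq> 0 \<or> y \<noteq> 0 \<Longrightarrow> x \<noteq> 0 \<and> y / x \<in> Zp \<or> y \<noteq> 0 \<and> x / y \<in> Zp"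
proof -
  have "x \<noteq> 0 \<and> y / x \<in> Zp \<or> y \<noteq> 0 \<and> x / y \<in> Zp" if xy: "x \<noteq> 0" "y \<noteq> 0"
  proof -
    obtain k u where x: "x = pr powi k * u" "u \<in> Zp" "1 / u \<in> Zp" "u \<noteq> 0" using Zp_valuation[OF xy(1)] by blast
    obtain l v where y: "y = pr powi l * v" "v \<in> Zp" "1 / v \<in> Zp" "v \<noteq> 0" using Zp_valuation[OF xy(2)] by blast
    show ?thesis
    proof (cases "k \<le> l")
      case True
      have "y / x = pr powi (l - k) * (v * (1 / u))" using x y by (simp add: power_int_diff)
      also have "\<dots> = pr ^ nat (l - k) * (v * (1 / u))" using True by (simp add: power_int_def)
      also have "\<dots> \<in> Zp" using x y by (intro Zp_mult Zp_power) simp_all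
      finally show ?thesis using xy by simp
    next
      case False
      have "x / y = pr powi (k - l) * (u * (1 / v))" using x y by (simp add: power_int_diff)
      also have "\<dots> = pr ^ nat (k - l) * (u * (1 / v))" using False by (simp add: power_int_def)
      also have "\<dots> \<in> Zp" using x y by (intro Zp_mult Zp_power) simp_all
      finally show ?thesis using xy by simp
    qed
  qed
  then show "x \<noteq> 0 \<or> y \<noteq> 0 \<Longrightarrow> ?thesis" by (cases "x = 0"; cases "y = 0") auto
qed

lemma Zp_unit_power:
  assumes x: "x \<in> Zp" "x \<noteq> 0"
  obtains k :: nat and u where "u * x = pr ^ k" "u \<in> Zp" "1 / u \<in> Zp" "u \<noteq> 0"
proof -
  obtain k u where k: "x = pr powi k * u" "u \<in> Zp" "1 / u \<in> Zp" "u \<noteq> 0" using Zp_valuation[OF x(2)] by blast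
  have "k \<ge> 0"
  proof (rule ccontr)
    assume "\<not> k \<ge> 0"
    then have "k = - int (Suc (nat (- k) - 1))" by simp
    then obtain n where n: "k = - int (Suc n)" by blast
    have "pr powi k = 1 / pr ^ Suc n" unfolding n by (simp only: power_int_minus power_int_of_nat inverse_eq_divide)
    then have "x * (1 / u) = of_int 1 / pr ^ Suc n" using k by simp
    then have "of_int 1 / pr ^ Suc n \<in> Zp" using Zp_mult[OF x(1) k(3)] by (simp only:)
    then have "int p ^ Suc n dvd 1" using Zp_int_div_power by blast
    then have "int p dvd 1" using dvd_mult_left[of "int p" "int p ^ n" 1] by simp
    then show False using prime_int_p not_prime_unit by blast
  qed
  then have "x = pr ^ nat k * u" using k(1) by (simp add: power_int_def)
  then show ?thesis using k by (intro that[of "1 / u" "nat k"]) auto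
qed

lemma Zp_residue:
  assumes "x \<in> Zp"
  obtains n :: nat where "n < p ^ k" "(x - of_nat n) / pr ^ k \<in> Zp"
proof -
  obtain a b where ab: "\<not> int p dvd b" "x = of_int a / of_int b" using assms unfolding Zp_iff by blast
  have b0: "b \<noteq> 0" using ab by auto
  have "coprime b (int p ^ k)" using ab(1) prime_imp_coprime[OF prime_int_p] by (simp add: coprime_commute)
  then obtain c where c: "[b * c = 1] (mod (int p ^ k))" using cong_solve_coprime_int by blast
  define n where "n = nat ((a * c) mod int p ^ k)"
  have pk: "int p ^ k > 0" using p_nz by simp
  have n: "int n = (a * c) mod int p ^ k" using pk by (simp add: n_def)
  have "int n < int (p ^ k)" using n pk by simp
  then have nlt: "n < p ^ k" by (simp only: of_nat_less_iff)
  have "int p ^ k dvd a - int n * b"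
  proof -
    have "[int n * b = a * c * b] (mod (int p ^ k))" unfolding n by (intro cong_scalar_right) (simp add: cong_def)
    moreover have "[a * (b * c) = a * 1] (mod (int p ^ k))" by (intro cong_scalar_left c)
    ultimately have "[int n * b = a] (mod (int p ^ k))" by (simp add: mult_ac cong_trans)
    then show ?thesis by (simp add: cong_iff_dvd_diff dvd_diff_commute)
  qed
  then have "of_int (a - int n * b) / pr ^ k \<in> Zp" by (simp only: Zp_int_div_power)
  moreover have "1 / of_int b \<in> Zp" unfolding Zp_iff using ab by (intro exI[of _ 1] exI[of _ b]) simp
  ultimately have "of_int (a - int n * b) / pr ^ k * (1 / of_int b) \<in> Zp" using Zp_mult by blast
  moreover have "of_int (a - int n * b) / pr ^ k * (1 / of_int b) = (x - of_nat n) / pr ^ k"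
    using b0 by (simp add: ab(2) field_simps)
  ultimately have "(x - of_nat n) / pr ^ k \<in> Zp" by (simp only:)
  then show ?thesis by (rule that[OF nlt])
qed

lemma Zp_nat_diff_eq:
  assumes "(of_nat m - of_nat n) / pr ^ k \<in> Zp" "m < p ^ k" "n < p ^ k" shows "m = n"
proof -
  have "of_int (int m - int n) / pr ^ k \<in> Zp" using assms(1) by simp
  then have "int p ^ k dvd int m - int n" by (simp only: Zp_int_div_power)
  then have "[int m = int n] (mod int (p ^ k))" by (simp add: cong_iff_dvd_diff)
  then have "[m = n] (mod p ^ k)" by (simp only: cong_int_iff)
  then show ?thesis using assms by (simp add: cong_def)
qed

text \<open>Integrality at \<open>p\<close> and away from \<open>p\<close> together give an integer.
  This turns local information on coset representatives into membership in
  \<open>Gamma0 N\<close>.\<close>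

lemma Zp_Z_inverted_int:
  assumes "x \<in> Zp" "x \<in> Z_inverted p" shows "x \<in> \<int>"
proof -
  obtain m where "pr ^ m * x \<in> \<int>" using assms(2) unfolding Z_inverted_def by blast
  then obtain n where n: "pr ^ m * x = of_int n" by (auto elim: Ints_cases)
  then have x: "x = of_int n / pr ^ m" by (simp add: field_simps)
  then have "int p ^ m dvd n" using assms(1) Zp_int_div_power by simp
  then obtain q where "n = int p ^ m * q" by blast
  then have "x = of_int q" using x by simp
  then show ?thesis by simp
qed

lemma Z_inverted_mult: assumes "x \<in> Z_inverted p" "y \<in> Z_inverted p" shows "x * y \<in> Z_inverted p"
proof -
  obtain m n where "pr ^ m * x \<in> \<int>" "pr ^ n * y \<in> \<int>" using assms unfolding Z_inverted_def by blast
  then have "(pr ^ m * x) * (pr ^ n * y) \<in> \<int>" by (rule Ints_mult)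
  then have "pr ^ (m + n) * (x * y) \<in> \<int>" by (simp add: power_add mult_ac)
  then show ?thesis unfolding Z_inverted_def by blast
qed

lemma Z_inverted_add: assumes "x \<in> Z_inverted p" "y \<in> Z_inverted p" shows "x + y \<in> Z_inverted p"
proof -
  obtain m n where mn: "pr ^ m * x \<in> \<int>" "pr ^ n * y \<in> \<int>" using assms unfolding Z_inverted_def by blast
  have "pr ^ n * (pr ^ m * x) + pr ^ m * (pr ^ n * y) \<in> \<int>"
    by (intro Ints_add Ints_mult[OF _ mn(1)] Ints_mult[OF _ mn(2)]) simp_all
  then have "pr ^ (m + n) * (x + y) \<in> \<int>" by (simp add: power_add algebra_simps)
  then show ?thesis unfolding Z_inverted_def by blast
qed

lemma Z_inverted_int: "of_int n \<in> Z_inverted p"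
  unfolding Z_inverted_def by (auto intro!: exI[of _ 0])

lemma Z_inverted_pinv: "1 / pr ^ k \<in> Z_inverted p"
  unfolding Z_inverted_def by (auto intro!: exI[of _ k])

lemma Z_inverted_frac: "of_int n / pr ^ k \<in> Z_inverted p"
  using Z_inverted_mult[OF Z_inverted_int Z_inverted_pinv, of n k] by simp

section \<open>Symplectic matrices integral at the prime, and triangular coset
  representatives\<close>

abbreviation K :: "mat4 set" where "K \<equiv> local_K p"

definition integral_mat :: "mat4 \<Rightarrow> bool" where "integral_mat g \<longleftrightarrow> (\<forall>i j. g $ i $ j \<in> Zp)"

lemma Zp_sum: "(\<And>i. i \<in> A \<Longrightarrow> f i \<in> Zp) \<Longrightarrow> (\<Sum>i\<in>A. f i) \<in> Zp"
  by (induction A rule: infinite_finite_induct) auto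

lemma integral_mat_mult: "integral_mat g \<Longrightarrow> integral_mat h \<Longrightarrow> integral_mat (g ** h)"
  by (auto simp: integral_mat_def matrix_matrix_mult_def intro!: Zp_sum)

lemma integral_mat_blk: "integral_mat (blk (m2 a1 a2 a3 a4) (m2 b1 b2 b3 b4) (m2 c1 c2 c3 c4) (m2 d1 d2 d3 d4)) \<longleftrightarrow>
   {a1,a2,a3,a4,b1,b2,b3,b4,c1,c2,c3,c4,d1,d2,d3,d4} \<subseteq> Zp"
  by (auto simp: integral_mat_def all_sum_type forall_2)

lemma K_iff: "k \<in> K \<longleftrightarrow> symplectic_similitude k 1 \<and> integral_mat k"
  by (simp add: local_K_def integral_mat_def)

lemma K_integral: "k \<in> K \<Longrightarrow> integral_mat k" by (simp add: K_iff)

lemma K_mult: "g \<in> K \<Longrightarrow> h \<in> K \<Longrightarrow> g ** h \<in> K"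
  using symplectic_similitude_mult[of g 1 h 1] by (auto simp: K_iff integral_mat_mult)

lemma K_1: "mat 1 \<in> K"
  unfolding K_iff blk_mat mat_m2 zero_m2 symplectic_similitude_blk integral_mat_blk by simp

text \<open>The second factor is the adjoint with respect to the symplectic form, which inverts a
  similitude up to its multiplier.\<close>

lemma similitude_inverse:
  assumes "symplectic_similitude (blk A B C D) \<eta>"
  shows "blk A B C D ** blk (transpose D) (- transpose B) (- transpose C) (transpose A) = mat \<eta>"
  using assms
  by (cases A rule: m2_cases; cases B rule: m2_cases; cases C rule: m2_cases; cases D rule: m2_cases)
     (simp add: symplectic_similitude_blk blk_mat mat_m2 zero_m2 algebra_simps)

lemma K_inverse:
  assumes "k \<in> K" obtains k' where "k' \<in> K" "k ** k' = mat 1" "k' ** k = mat 1"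
proof -
  obtain A B C D where k: "k = blk A B C D" by (rule blk_cases)
  let ?k = "blk (transpose D) (- transpose B) (- transpose C) (transpose A)"
  have 1: "k ** ?k = mat 1" using assms similitude_inverse[of A B C D 1] by (simp add: k K_iff)
  then have 2: "?k ** k = mat 1" using matrix_left_right_inverse by blast
  have "?k ** J ** transpose ?k = ?k ** (k ** J ** transpose k) ** transpose ?k"
    using assms by (simp add: K_iff symplectic_similitude_def)
  also have "\<dots> = (?k ** k) ** J ** transpose (?k ** k)"
    by (simp only: matrix_transpose_mul matrix_mul_assoc)
  also have "\<dots> = J" unfolding 2 by simp
  finally have "symplectic_similitude ?k 1" by (simp add: symplectic_similitude_def)
  moreover have "integral_mat ?k"
    using assms unfolding k K_iff
    by (cases A rule: m2_cases; cases B rule: m2_cases; cases C rule: m2_cases; cases D rule: m2_cases)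
       (simp add: integral_mat_blk)
  ultimately show ?thesis using that[of ?k] 1 2 by (simp add: K_iff)
qed

lemma left_coset_K:
  assumes "k \<in> K" shows "left_coset p (k ** g) = left_coset p g"
proof -
  obtain k' where k': "k' \<in> K" "k ** k' = mat 1" "k' ** k = mat 1" using K_inverse[OF assms] by blast
  have "h ** g = (h ** k') ** (k ** g)" for h
  proof -
    have "(h ** k') ** (k ** g) = h ** (k' ** k) ** g" by (simp only: matrix_mul_assoc)
    then show ?thesis by (simp add: k'(3))
  qed
  then show ?thesis unfolding left_coset_def
  proof (intro Set.set_eqI iffI; elim CollectE exE conjE)
    fix x h assume "x = h ** (k ** g)" "h \<in> K"
    then show "x \<in> {h ** g |h. h \<in> K}" using K_mult[OF _ assms] by (auto simp: matrix_mul_assoc)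
  next
    fix x h assume x: "x = h ** g" "h \<in> K"
    then have "x = (h ** k') ** (k ** g)" using \<open>\<And>h. h ** g = (h ** k') ** (k ** g)\<close> by simp
    then show "x \<in> {h ** (k ** g) |h. h \<in> K}" using K_mult[OF x(2) k'(1)] by blast
  qed
qed

lemma left_coset_eqD:
  assumes "left_coset p g = left_coset p h" obtains k where "k \<in> K" "g = k ** h"
proof -
  have "g \<in> left_coset p g" unfolding left_coset_def using K_1 by (auto intro!: exI[of _ "mat 1"])
  then show ?thesis using assms that unfolding left_coset_def by auto
qed

lemma double_coset_refl: "g \<in> double_coset p g"
  unfolding double_coset_def using K_1 by (auto intro!: exI[of _ "mat 1"])

lemma double_coset_mult: "h \<in> double_coset p g \<Longrightarrow> k \<in> K \<Longrightarrow> k' \<in> K \<Longrightarrow> k ** h ** k' \<in> double_coset p g"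
proof -
  assume "h \<in> double_coset p g" and k: "k \<in> K" "k' \<in> K"
  then obtain j j' where j: "h = j ** g ** j'" "j \<in> K" "j' \<in> K" unfolding double_coset_def by blast
  have "k ** h ** k' = (k ** j) ** g ** (j' ** k')" unfolding j(1) by (simp only: matrix_mul_assoc)
  then show ?thesis unfolding double_coset_def using K_mult[OF k(1) j(2)] K_mult[OF j(3) k(2)] by blast
qed

text \<open>\<open>e13\<close> and \<open>e24\<close> embed SL(2) in the rows and columns 1, 3 and
  2, 4. \<open>lv\<close> is the Levi element of a unimodular A, \<open>lo\<close> the Levi element
  with lower triangular D, and \<open>ux\<close> the unipotent element with symmetric B.\<close>

definition e13 :: "rat \<Rightarrow> rat \<Rightarrow> rat \<Rightarrow> rat \<Rightarrow> mat4" where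
  "e13 a b c d = blk (m2 a 0 0 1) (m2 b 0 0 0) (m2 c 0 0 0) (m2 d 0 0 1)"
definition e24 :: "rat \<Rightarrow> rat \<Rightarrow> rat \<Rightarrow> rat \<Rightarrow> mat4" where
  "e24 a b c d = blk (m2 1 0 0 a) (m2 0 0 0 b) (m2 0 0 0 c) (m2 1 0 0 d)"
definition lv :: "rat \<Rightarrow> rat \<Rightarrow> rat \<Rightarrow> rat \<Rightarrow> mat4" where
  "lv a b c d = blk (m2 a b c d) (m2 0 0 0 0) (m2 0 0 0 0) (m2 d (- c) (- b) a)"
definition lo :: "rat \<Rightarrow> rat \<Rightarrow> rat \<Rightarrow> mat4" where
  "lo u s v = blk (m2 (1 / u) (- s / (u * v)) 0 (1 / v)) (m2 0 0 0 0) (m2 0 0 0 0) (m2 u 0 s v)"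
definition ux :: "rat \<Rightarrow> rat \<Rightarrow> rat \<Rightarrow> mat4" where
  "ux a b c = blk (m2 1 0 0 1) (m2 a b b c) (m2 0 0 0 0) (m2 1 0 0 1)"

lemma e_K:
  "a \<in> Zp \<Longrightarrow> b \<in> Zp \<Longrightarrow> c \<in> Zp \<Longrightarrow> d \<in> Zp \<Longrightarrow> a * d - b * c = 1 \<Longrightarrow> e13 a b c d \<in> K"
  "a \<in> Zp \<Longrightarrow> b \<in> Zp \<Longrightarrow> c \<in> Zp \<Longrightarrow> d \<in> Zp \<Longrightarrow> a * d - b * c = 1 \<Longrightarrow> e24 a b c d \<in> K"
  "a \<in> Zp \<Longrightarrow> b \<in> Zp \<Longrightarrow> c \<in> Zp \<Longrightarrow> d \<in> Zp \<Longrightarrow> a * d - b * c = 1 \<Longrightarrow> lv a b c d \<in> K"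
  "a \<in> Zp \<Longrightarrow> b \<in> Zp \<Longrightarrow> c \<in> Zp \<Longrightarrow> ux a b c \<in> K"
  unfolding K_iff e13_def e24_def lv_def ux_def integral_mat_blk symplectic_similitude_blk
  by (auto simp: algebra_simps)

lemma lo_K:
  assumes "u \<in> Zp" "1 / u \<in> Zp" "v \<in> Zp" "1 / v \<in> Zp" "s \<in> Zp" "u \<noteq> 0" "v \<noteq> 0"
  shows "lo u s v \<in> K"
proof -
  have "- s * (1 / u) * (1 / v) \<in> Zp" using assms by (intro Zp_mult Zp_minus)
  moreover have "- s * (1 / u) * (1 / v) = - s / (u * v)" by simp
  ultimately show ?thesis using assms
    unfolding K_iff lo_def integral_mat_blk symplectic_similitude_blk by simp
qed

lemma Zp_eliminate:
  obtains a b c d where "a \<in> Zp" "b \<in> Zp" "c \<in> Zp" "d \<in> Zp" "a * d - b * c = 1" "c * x + d * y = 0"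
proof (cases "x = 0 \<and> y = 0")
  case True then show ?thesis using that[of 1 0 0 1] by simp
next
  case False
  then consider "x \<noteq> 0" "y / x \<in> Zp" | "y \<noteq> 0" "x / y \<in> Zp" using Zp_ratio[of x y] by blast
  then show ?thesis
  proof cases
    case 1 then show ?thesis using that[of 1 0 "- (y / x)" 1] by simp
  next
    case 2 then show ?thesis using that[of 0 "- 1" 1 "- (x / y)"] by simp
  qed
qed

text \<open>Row reduction of the first two columns; the last vanishing entry in the first column is
  forced upon the second column by the symplectic relations.\<close>

lemma iwasawa:
  assumes "symplectic_similitude g \<eta>" "\<eta> \<noteq> 0"
  shows "\<exists>k\<in>K. \<exists>a b d B D. k ** g = blk (m2 a b 0 d) B 0 D"
proof -
  obtain A B C D where g: "g = blk A B C D" by (rule blk_cases)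
  obtain a1 a2 a3 a4 where A: "A = m2 a1 a2 a3 a4" by (rule m2_cases)
  obtain c1 c2 c3 c4 where C: "C = m2 c1 c2 c3 c4" by (rule m2_cases)
  obtain s1 s2 s3 s4 where s: "s1 \<in> Zp" "s2 \<in> Zp" "s3 \<in> Zp" "s4 \<in> Zp" "s1 * s4 - s2 * s3 = 1" "s3 * a1 + s4 * c1 = 0"
    by (rule Zp_eliminate[of a1 c1])
  obtain t1 t2 t3 t4 where t: "t1 \<in> Zp" "t2 \<in> Zp" "t3 \<in> Zp" "t4 \<in> Zp" "t1 * t4 - t2 * t3 = 1" "t3 * a3 + t4 * c3 = 0"
    by (rule Zp_eliminate[of a3 c3])
  let ?x = "s1 * a1 + s2 * c1" and ?y = "t1 * a3 + t2 * c3"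
  obtain r1 r2 r3 r4 where r: "r1 \<in> Zp" "r2 \<in> Zp" "r3 \<in> Zp" "r4 \<in> Zp" "r1 * r4 - r2 * r3 = 1" "r3 * ?x + r4 * ?y = 0"
    by (rule Zp_eliminate[of ?x ?y])
  define k1 where "k1 = lv r1 r2 r3 r4 ** (e24 t1 t2 t3 t4 ** e13 s1 s2 s3 s4)"
  have k1: "k1 \<in> K" unfolding k1_def by (intro K_mult e_K r t s)
  have "\<exists>x a b c d B' D'. k1 ** g = blk (m2 x a 0 b) B' (m2 0 c 0 d) D'"
  proof -
    have 1: "e13 s1 s2 s3 s4 ** g = blk (m2 ?x (s1 * a2 + s2 * c2) a3 a4) (m2 s1 0 0 1 ** B + m2 s2 0 0 0 ** D)
        (m2 0 (s3 * a2 + s4 * c2) c3 c4) (m2 s3 0 0 0 ** B + m2 s4 0 0 1 ** D)"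
      using s(6) by (simp add: e13_def g A C)
    obtain B1 D1 where 2: "e24 t1 t2 t3 t4 ** (e13 s1 s2 s3 s4 ** g) = blk (m2 ?x (s1 * a2 + s2 * c2) ?y (t1 * a4 + t2 * c4)) B1
        (m2 0 (s3 * a2 + s4 * c2) 0 (t3 * a4 + t4 * c4)) D1"
      unfolding 1 using t(6) by (simp add: e24_def)
    have "k1 ** g = lv r1 r2 r3 r4 ** (e24 t1 t2 t3 t4 ** (e13 s1 s2 s3 s4 ** g))"
      unfolding k1_def by (simp only: matrix_mul_assoc)
    then show ?thesis unfolding 2 using r(6) by (simp add: lv_def)
  qed
  then obtain x a b c d B' D' where kg: "k1 ** g = blk (m2 x a 0 b) B' (m2 0 c 0 d) D'" by blast
  have sim: "symplectic_similitude (blk (m2 x a 0 b) B' (m2 0 c 0 d) D') \<eta>"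
    using symplectic_similitude_mult[OF _ assms(1), of k1 1] k1 kg by (simp add: K_iff)
  let ?h = "blk (m2 x a 0 b) B' (m2 0 c 0 d) D'"
  let ?h' = "blk (transpose D') (- transpose B') (- transpose (m2 0 c 0 d)) (transpose (m2 x a 0 b))"
  have "?h ** ?h' = mat \<eta>" by (rule similitude_inverse[OF sim])
  \<comment> \<open>The defining relation constrains rows only. Reversing the product with the
    adjoint yields the column relations, among them \<open>x * c = 0\<close> with \<open>x\<close>
    nonzero.\<close>
  then have "?h ** (?h' ** mat (1 / \<eta>)) = mat \<eta> ** mat (1 / \<eta>)" by (simp only: matrix_mul_assoc)
  also have "\<dots> = mat 1" using assms(2) by (simp add: blk_mat mat_m2 zero_m2)
  finally have "?h' ** mat (1 / \<eta>) ** ?h = mat 1" using matrix_left_right_inverse by blast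
  then have eq: "blk (m2 1 0 0 1) (m2 0 0 0 0) (m2 0 0 0 0) (m2 1 0 0 1) = ?h' ** mat (1 / \<eta>) ** ?h"
    by (simp add: blk_mat mat_m2 zero_m2)
  obtain u1 u2 u3 u4 where D': "D' = m2 u1 u2 u3 u4" by (rule m2_cases)
  obtain v1 v2 v3 v4 where B': "B' = m2 v1 v2 v3 v4" by (rule m2_cases)
  have "u1 * x = \<eta>" "x * c = 0"
    using eq by (auto simp: D' B' blk_mat mat_m2 zero_m2)
  then have c: "c = 0" using assms(2) by auto
  obtain w1 w2 w3 w4 where w: "w1 \<in> Zp" "w2 \<in> Zp" "w3 \<in> Zp" "w4 \<in> Zp" "w1 * w4 - w2 * w3 = 1" "w3 * b + w4 * d = 0"
    by (rule Zp_eliminate[of b d])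
  have "e24 w1 w2 w3 w4 ** k1 ** g = e24 w1 w2 w3 w4 ** (k1 ** g)" by (simp only: matrix_mul_assoc)
  also have "\<dots> = blk (m2 x a 0 (w1 * b + w2 * d)) (m2 1 0 0 w1 ** B' + m2 0 0 0 w2 ** D') 0 (m2 0 0 0 w3 ** B' + m2 1 0 0 w4 ** D')"
    unfolding kg using w(6) by (simp add: e24_def c zero_m2)
  finally show ?thesis using K_mult[OF e_K(2)[OF w(1-5)] k1] by blast
qed

text \<open>The similitude with D lower triangular, A equal to \<open>\<eta>\<close> times the
  inverse transpose of D, and B = X D for the symmetric X with entries \<open>x1\<close>,
  \<open>x2\<close>, \<open>x3\<close>. It acts on the half space by z -> \<eta> D^-T z D^-1 +
  X.\<close>

definition rp :: "rat \<Rightarrow> rat \<Rightarrow> rat \<Rightarrow> rat \<Rightarrow> rat \<Rightarrow> rat \<Rightarrow> rat \<Rightarrow> mat4" where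
  "rp \<eta> d1 d3 d4 x1 x2 x3 = blk (m2 (\<eta> / d1) (- (\<eta> * d3) / (d1 * d4)) 0 (\<eta> / d4))
     (m2 (x1 * d1 + x2 * d3) (x2 * d4) (x2 * d1 + x3 * d3) (x3 * d4)) (m2 0 0 0 0) (m2 d1 0 d3 d4)"

lemma rp_similitude: "d1 \<noteq> 0 \<Longrightarrow> d4 \<noteq> 0 \<Longrightarrow> symplectic_similitude (rp \<eta> d1 d3 d4 x1 x2 x3) \<eta>"
  unfolding rp_def symplectic_similitude_blk by (simp add: field_simps)

text \<open>With C = 0 the relations make A equal to \<open>\<eta>\<close> times the inverse
  transpose of D, and symmetry of A B^T becomes symmetry of X = B D^-1.\<close>

lemma upper_form_rp:
  assumes s: "symplectic_similitude (blk (m2 a b 0 d) B 0 (m2 d1 d2 d3 d4)) \<eta>" and "\<eta> \<noteq> 0"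
  shows "d2 = 0" "d1 \<noteq> 0" "d4 \<noteq> 0" "\<exists>x1 x2 x3. blk (m2 a b 0 d) B 0 (m2 d1 d2 d3 d4) = rp \<eta> d1 d3 d4 x1 x2 x3"
proof -
  obtain b1 b2 b3 b4 where B: "B = m2 b1 b2 b3 b4" by (rule m2_cases)
  have r: "a * b3 + b * b4 = b2 * d" "a * d1 + b * d2 = \<eta>" "a * d3 + b * d4 = 0" "d * d2 = 0" "d * d4 = \<eta>"
    using s unfolding B zero_m2 symplectic_similitude_blk by simp_all
  have d: "d \<noteq> 0" "d4 \<noteq> 0" using r(5) assms(2) by auto
  then show d2: "d2 = 0" using r(4) by simp
  then have ad: "a * d1 = \<eta>" using r(2) by simp
  then show d1: "d1 \<noteq> 0" using assms(2) by auto
  show "d4 \<noteq> 0" by (rule d)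
  have a: "a = \<eta> / d1" "d = \<eta> / d4" using ad r(5) d d1 by (simp_all add: field_simps)
  have "b = - (a * d3) / d4" using r(3) d by (simp add: field_simps)
  then have b: "b = - (\<eta> * d3) / (d1 * d4)" by (simp add: a)
  have "b2 * (\<eta> / d4) = \<eta> / d1 * b3 - \<eta> * d3 / (d1 * d4) * b4" using r(1) by (simp add: a b)
  then have "\<eta> * (b2 * d1) = \<eta> * (b3 * d4 - d3 * b4)" using d1 d by (simp add: field_simps)
  then have b3: "b2 * d1 = b3 * d4 - d3 * b4" using assms(2) by simp
  have "blk (m2 a b 0 d) B 0 (m2 d1 d2 d3 d4) = rp \<eta> d1 d3 d4 ((b1 - b2 / d4 * d3) / d1) (b2 / d4) (b4 / d4)"
    unfolding rp_def B d2 zero_m2 blk_inject m2_inject using d d1 b3 a b by (simp add: field_simps)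
  then show "\<exists>x1 x2 x3. blk (m2 a b 0 d) B 0 (m2 d1 d2 d3 d4) = rp \<eta> d1 d3 d4 x1 x2 x3" by blast
qed

text \<open>After the reduction to block triangular form, units of the local ring turn the diagonal
  of D into powers of \<open>p\<close>, and an integral row operation reduces the lower left entry
  modulo the first of them.\<close>

lemma rp_exists:
  assumes g: "symplectic_similitude g \<eta>" "integral_mat g" and \<eta>: "\<eta> \<noteq> 0"
  obtains k a b y x1 x2 x3 where "k \<in> K" "k ** g = rp \<eta> (pr ^ a) (of_nat y) (pr ^ b) x1 x2 x3" "y < p ^ a"
proof -
  obtain k a b d B D where k: "k \<in> K" "k ** g = blk (m2 a b 0 d) B 0 D" using iwasawa[OF g(1) \<eta>] by blast
  obtain d1 d2 d3 d4 where D: "D = m2 d1 d2 d3 d4" by (rule m2_cases)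
  have sim: "symplectic_similitude (blk (m2 a b 0 d) B 0 (m2 d1 d2 d3 d4)) \<eta>"
    using symplectic_similitude_mult[OF _ g(1), of k 1] k by (simp add: K_iff D)
  note u = upper_form_rp(1-3)[OF sim \<eta>]
  have "integral_mat (k ** g)" by (intro integral_mat_mult K_integral k(1) g(2))
  then have dZ: "d1 \<in> Zp" "d3 \<in> Zp" "d4 \<in> Zp"
    unfolding k(2) D by (cases B rule: m2_cases, simp add: zero_m2 integral_mat_blk)+
  obtain i u where u1: "u * d1 = pr ^ i" "u \<in> Zp" "1 / u \<in> Zp" "u \<noteq> 0" by (rule Zp_unit_power[OF dZ(1) u(2)])
  obtain j v where v1: "v * d4 = pr ^ j" "v \<in> Zp" "1 / v \<in> Zp" "v \<noteq> 0" by (rule Zp_unit_power[OF dZ(3) u(3)])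
  obtain y where y: "y < p ^ i" "(v * d3 - of_nat y) / pr ^ i \<in> Zp" by (rule Zp_residue[OF Zp_mult[OF v1(2) dZ(2)]])
  \<comment> \<open>Chosen so that the row operation replaces \<open>v * d3\<close> by its residue
    \<open>y\<close>.\<close>
  define s where "s = - ((v * d3 - of_nat y) / pr ^ i) * u"
  have sZ: "s \<in> Zp" unfolding s_def using y(2) u1(2) by (intro Zp_mult Zp_minus)
  have s: "s * d1 + v * d3 = of_nat y"
  proof -
    have "s * d1 = - ((v * d3 - of_nat y) / pr ^ i) * (u * d1)" by (simp add: s_def)
    also have "\<dots> = - (v * d3 - of_nat y)" unfolding u1(1) by simp
    finally show ?thesis by simp
  qed
  have l: "lo u s v \<in> K" by (rule lo_K) (use u1 v1 sZ in auto)
  obtain a' b' d' B' where e: "lo u s v ** (k ** g) = blk (m2 a' b' 0 d') B' 0 (m2 (pr ^ i) 0 (of_nat y) (pr ^ j))"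
  proof -
    have "lo u s v ** (k ** g) = blk (m2 (1 / u) (- s / (u * v)) 0 (1 / v) ** m2 a b 0 d) (m2 (1 / u) (- s / (u * v)) 0 (1 / v) ** B)
       0 (m2 u 0 s v ** m2 d1 0 d3 d4)"
      unfolding k(2) D u(1) by (cases B rule: m2_cases) (simp add: lo_def zero_m2)
    also have "m2 u 0 s v ** m2 d1 0 d3 d4 = m2 (pr ^ i) 0 (of_nat y) (pr ^ j)" using u1 v1 s by simp
    finally show ?thesis using that by simp
  qed
  have "symplectic_similitude (lo u s v ** (k ** g)) \<eta>"
    using symplectic_similitude_mult[OF _ symplectic_similitude_mult[OF _ g(1)], of "lo u s v" 1 k 1] k l by (simp add: K_iff)
  from upper_form_rp(4)[OF this[unfolded e] \<eta>] obtain x1 x2 x3 where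
    "lo u s v ** (k ** g) = rp \<eta> (pr ^ i) (of_nat y) (pr ^ j) x1 x2 x3" unfolding e by blast
  then have "(lo u s v ** k) ** g = rp \<eta> (pr ^ i) (of_nat y) (pr ^ j) x1 x2 x3" by (simp only: matrix_mul_assoc)
  then show ?thesis using that K_mult[OF l k(1)] y(1) by blast
qed

lemma rp_shift: "ux z1 z2 z3 ** rp \<eta> d1 d3 d4 x1 x2 x3 = rp \<eta> d1 d3 d4 (x1 + z1) (x2 + z2) (x3 + z3)"
  by (simp add: ux_def rp_def algebra_simps)

lemma Zp_power_ratio: "pr ^ m / pr ^ n \<in> Zp \<Longrightarrow> n \<le> m"
proof -
  assume "pr ^ m / pr ^ n \<in> Zp"
  then have "of_int (int p ^ m) / pr ^ n \<in> Zp" by simp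
  then have "int p ^ n dvd int p ^ m" by (simp only: Zp_int_div_power)
  then have "p ^ n dvd p ^ m" by (metis of_nat_dvd_iff of_nat_power)
  then show "n \<le> m" using power_dvd_imp_le p_nz by blast
qed

text \<open>The connecting element of \<open>K\<close> is itself block triangular, and its diagonal
  entries are ratios of powers of \<open>p\<close> that are integral together with their inverses,
  hence 1. This leaves only a change of \<open>d3\<close> modulo \<open>d1\<close> and, for equal
  \<open>d3\<close>, of X modulo integral matrices.\<close>

lemma rp_coset_eq:
  assumes eq: "left_coset p (rp \<eta> d1 d3 d4 x1 x2 x3) = left_coset p (rp \<eta> d1' d3' d4' x1' x2' x3')" and \<eta>: "\<eta> \<noteq> 0"
    and d: "d1 = pr ^ a" "d4 = pr ^ b" "d1' = pr ^ a'" "d4' = pr ^ b'"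
  shows "d1 = d1'" "d4 = d4'" "(d3 - d3') / d1 \<in> Zp"
    "d3 = d3' \<Longrightarrow> x1 - x1' \<in> Zp \<and> x2 - x2' \<in> Zp \<and> x3 - x3' \<in> Zp"
proof -
  obtain k where k: "k \<in> K" "rp \<eta> d1 d3 d4 x1 x2 x3 = k ** rp \<eta> d1' d3' d4' x1' x2' x3'"
    using left_coset_eqD[OF eq] by blast
  obtain P Q R S where kb: "k = blk P Q R S" by (rule blk_cases)
  obtain p1 p2 p3 p4 where P: "P = m2 p1 p2 p3 p4" by (rule m2_cases)
  obtain q1 q2 q3 q4 where Q: "Q = m2 q1 q2 q3 q4" by (rule m2_cases)
  obtain r1 r2 r3 r4 where R: "R = m2 r1 r2 r3 r4" by (rule m2_cases)
  obtain s1 s2 s3 s4 where S: "S = m2 s1 s2 s3 s4" by (rule m2_cases)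
  note all = kb P Q R S
  have nz: "d1 \<noteq> 0" "d4 \<noteq> 0" "d1' \<noteq> 0" "d4' \<noteq> 0" by (simp_all add: d)
  have int: "{p1,p2,p3,p4,q1,q2,q3,q4,s1,s2,s3,s4} \<subseteq> Zp" using k(1) unfolding all K_iff integral_mat_blk by simp
  have "r1 * (\<eta> / d1') = 0" "r3 * (\<eta> / d1') = 0" "p3 * (\<eta> / d1') = 0"
    using k(2) unfolding all rp_def by simp_all
  then have r13: "r1 = 0" "r3 = 0" "p3 = 0" using \<eta> nz by auto
  have "r2 * (\<eta> / d4') = 0" "r4 * (\<eta> / d4') = 0"
    using k(2) r13 unfolding all rp_def by simp_all
  then have r24: "r2 = 0" "r4 = 0" using \<eta> nz by auto
  have D: "d1 = s1 * d1' + s2 * d3'" "s2 * d4' = 0" "d3 = s3 * d1' + s4 * d3'" "d4 = s3 * 0 + s4 * d4'"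
    using k(2) r13 r24 unfolding all rp_def by simp_all
  have s2: "s2 = 0" using D(2) nz by simp
  have sy: "p1 * s1 = 1" "p4 * s4 = 1"
    using k(1) r13 r24 s2 unfolding all K_iff symplectic_similitude_blk by simp_all
  have s1: "s1 = d1 / d1'" "s4 = d4 / d4'" using D nz s2 by simp_all
  have "s1 \<noteq> 0" "s4 \<noteq> 0" using s1 nz by simp_all
  then have "p1 = 1 / s1" "p4 = 1 / s4" using sy by (simp_all add: eq_divide_eq del: mult_cancel_left)
  then have p1: "p1 = d1' / d1" "p4 = d4' / d4" using s1 by simp_all
  have "pr ^ a / pr ^ a' \<in> Zp" "pr ^ a' / pr ^ a \<in> Zp" "pr ^ b / pr ^ b' \<in> Zp" "pr ^ b' / pr ^ b \<in> Zp"
    using int s1 p1 by (simp_all add: d)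
  then have "a = a'" "b = b'" using Zp_power_ratio by (meson le_antisym)+
  then show dd: "d1 = d1'" "d4 = d4'" by (simp_all add: d)
  then have s1': "s1 = 1" "s4 = 1" "p1 = 1" "p4 = 1" using s1 p1 nz by simp_all
  have "(d3 - d3') / d1 = s3" using D(3) s1' dd nz by simp
  then show "(d3 - d3') / d1 \<in> Zp" using int by simp
  assume "d3 = d3'"
  then have s3: "s3 = 0" using D(3) s1' nz by simp
  have p2: "p2 = 0" using k(1) r13 r24 s1' s2 s3 unfolding all K_iff symplectic_similitude_blk by simp
  have "x1 * d1 + x2 * d3 = (x1' * d1 + x2' * d3) + (q1 * d1 + q2 * d3)" "x2 * d4 = x2' * d4 + q2 * d4"
    "x3 * d4 = x3' * d4 + q4 * d4"
    using k(2) r13 r24 s1' s2 s3 p2 dd \<open>d3 = d3'\<close> unfolding all rp_def by simp_all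
  then have "(x2 - x2' - q2) * d4 = 0" "(x3 - x3' - q4) * d4 = 0"
    "(x1 - x1' - q1) * d1 + (x2 - x2' - q2) * d3 = 0"
    by (simp_all add: algebra_simps)
  then have "x2 - x2' = q2" "x3 - x3' = q4" "x1 - x1' = q1" using nz by auto
  then show "x1 - x1' \<in> Zp \<and> x2 - x2' \<in> Zp \<and> x3 - x3' \<in> Zp" using int by simp
qed

type_synonym idx = "rat \<times> rat \<times> rat \<times> rat \<times> rat \<times> rat"

definition rpt :: "rat \<Rightarrow> idx \<Rightarrow> mat4" where
  "rpt \<eta> s = (case s of (d1, d3, d4, x1, x2, x3) \<Rightarrow> rp \<eta> d1 d3 d4 x1 x2 x3)"

lemma Zp_frac:
  assumes "x * pr ^ k \<in> Zp" obtains n where "n < p ^ k" "of_nat n / pr ^ k - x \<in> Zp"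
proof -
  obtain n where n: "n < p ^ k" "(x * pr ^ k - of_nat n) / pr ^ k \<in> Zp" by (rule Zp_residue[OF assms])
  have "- ((x * pr ^ k - of_nat n) / pr ^ k) = of_nat n / pr ^ k - x" by (simp add: field_simps)
  then show ?thesis using that[OF n(1)] Zp_minus[OF n(2)] by simp
qed

lemma Zp_frac_eq:
  assumes "of_nat m / pr ^ k - of_nat n / pr ^ k \<in> Zp" "m < p ^ k" "n < p ^ k" shows "m = n"
  by (rule Zp_nat_diff_eq[OF _ assms(2,3)]) (use assms(1) in \<open>simp add: diff_divide_distrib\<close>)

lemma Zp_nat_div_0: "of_nat n / pr \<in> Zp \<Longrightarrow> n < p \<Longrightarrow> n = 0"
  using Zp_nat_diff_eq[of n 0 1] by simp

lemma not_Zp_inverse: "1 / pr \<notin> Zp"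
  using Zp_power_ratio[of 0 1] by auto

lemma Zp_unit_cases: assumes "x \<in> Zp" obtains "x / pr \<in> Zp" | "x \<noteq> 0" "1 / x \<in> Zp" "x / pr \<notin> Zp"
proof (cases "x = 0")
  case False
  obtain k u where u: "u * x = pr ^ k" "u \<in> Zp" "1 / u \<in> Zp" "u \<noteq> 0" by (rule Zp_unit_power[OF assms False])
  have x: "x = pr ^ k * (1 / u)" using u by (simp add: field_simps)
  show ?thesis
  proof (cases k)
    case 0
    then have xu: "1 / x = u" using x by simp
    have "x / pr \<notin> Zp"
    proof
      assume "x / pr \<in> Zp"
      then have "x / pr * (1 / x) \<in> Zp" unfolding xu using u(2) by (rule Zp_mult)
      then show False using not_Zp_inverse False by simp
    qed
    then show ?thesis using that(2) False xu u(2) by simp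
  next
    case (Suc n)
    then have "x / pr = pr ^ n * (1 / u)" using x by simp
    also have "\<dots> \<in> Zp" using u by (intro Zp_mult Zp_power) simp_all
    finally show ?thesis by (rule that(1))
  qed
qed (use that(1) in simp)

lemma Zp_square_div: assumes "x \<in> Zp" "x\<^sup>2 / pr \<in> Zp" shows "x / pr \<in> Zp"
proof (rule Zp_unit_cases[OF assms(1)])
  assume x: "x \<noteq> 0" "1 / x \<in> Zp"
  have "x\<^sup>2 / pr * (1 / x * (1 / x)) \<in> Zp" using assms x by (intro Zp_mult)
  moreover have "x\<^sup>2 / pr * (1 / x * (1 / x)) = 1 / pr" using x by (simp add: power2_eq_square)
  ultimately show ?thesis using not_Zp_inverse by simp
qed

lemma rp_move:
  assumes "z1 - x1 \<in> Zp" "z2 - x2 \<in> Zp" "z3 - x3 \<in> Zp" "k \<in> K" "k ** g = rp \<eta> d1 d3 d4 x1 x2 x3"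
  shows "\<exists>k\<in>K. k ** g = rp \<eta> d1 d3 d4 z1 z2 z3"
proof -
  have "ux (z1 - x1) (z2 - x2) (z3 - x3) ** k ** g = rp \<eta> d1 d3 d4 z1 z2 z3"
    using assms(5) by (simp add: matrix_mul_assoc[symmetric] rp_shift)
  then show ?thesis using K_mult[OF e_K(4)[OF assms(1-3)] assms(4)] by blast
qed

subsection \<open>The double coset of diag(1,1,p,p)\<close>

text \<open>Index set of the (1 + p)(1 + p^2) left cosets, sorted by D: the identity, the p + 1
  lattices of index \<open>p\<close> in the two middle families, and \<open>p\<close> times the
  identity.\<close>

definition I1 :: "idx set" where
  "I1 = {(1, 0, 1, 0, 0, 0)} \<union> (\<lambda>n. (1, 0, pr, 0, 0, of_nat n / pr)) ` {..<p}
     \<union> (\<lambda>(y, n). (pr, of_nat y, 1, of_nat n / pr, 0, 0)) ` ({..<p} \<times> {..<p})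
     \<union> (\<lambda>(n1, n2, n3). (pr, 0, pr, of_nat n1 / pr, of_nat n2 / pr, of_nat n3 / pr)) ` ({..<p} \<times> {..<p} \<times> {..<p})"

lemma finite_I1: "finite I1" by (simp add: I1_def)

lemma I1_complete:
  assumes "symplectic_similitude g pr" "integral_mat g"
  shows "\<exists>s\<in>I1. \<exists>k\<in>K. k ** g = rpt pr s"
proof -
  obtain k a b y x1 x2 x3 where k: "k \<in> K" "k ** g = rp pr (pr ^ a) (of_nat y) (pr ^ b) x1 x2 x3" "y < p ^ a"
    by (rule rp_exists[OF assms]) simp
  have "integral_mat (k ** g)" by (intro integral_mat_mult K_integral k(1) assms)
  then have Z: "pr / pr ^ a \<in> Zp" "pr / pr ^ b \<in> Zp" "- (pr * of_nat y) / (pr ^ a * pr ^ b) \<in> Zp"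
    "x1 * pr ^ a + x2 * of_nat y \<in> Zp" "x2 * pr ^ b \<in> Zp" "x2 * pr ^ a + x3 * of_nat y \<in> Zp" "x3 * pr ^ b \<in> Zp"
    unfolding k(2) rp_def integral_mat_blk by simp_all
  \<comment> \<open>Integrality of the block A bounds the exponents in D by that of the
    multiplier.\<close>
  have "a \<le> 1" "b \<le> 1" using Zp_power_ratio[of 1 a] Zp_power_ratio[of 1 b] Z by simp_all
  then consider "a = 0" "b = 0" | "a = 0" "b = 1" | "a = 1" "b = 0" | "a = 1" "b = 1" by linarith
  then show ?thesis
  proof cases
    case 1
    then have "y = 0" using k(3) by simp
    then have "\<exists>k\<in>K. k ** g = rp pr 1 0 1 0 0 0"
      using Z 1 k by (intro rp_move[OF _ _ _ k(1), of 0 x1 0 x2 0 x3]) simp_all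
    then show ?thesis by (intro bexI[of _ "(1, 0, 1, 0, 0, 0)"]) (simp_all add: rpt_def I1_def)
  next
    case 2
    then have y: "y = 0" using k(3) by simp
    obtain n where n: "n < p ^ 1" "of_nat n / pr ^ 1 - x3 \<in> Zp" by (rule Zp_frac[of x3 1]) (use Z 2 in simp)
    then have "\<exists>k\<in>K. k ** g = rp pr 1 0 pr 0 0 (of_nat n / pr)"
      using Z 2 k y by (intro rp_move[OF _ _ _ k(1), of 0 x1 0 x2 _ x3]) simp_all
    then show ?thesis using n by (intro bexI[of _ "(1, 0, pr, 0, 0, of_nat n / pr)"]) (auto simp: rpt_def I1_def)
  next
    case 3
    have "x1 * pr ^ 1 + x2 * of_nat y - x2 * of_nat y \<in> Zp" using Z 3 by (intro Zp_diff Zp_mult) simp_all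
    then have "x1 * pr ^ 1 \<in> Zp" by simp
    then obtain n where n: "n < p ^ 1" "of_nat n / pr ^ 1 - x1 \<in> Zp" by (rule Zp_frac)
    then have "\<exists>k\<in>K. k ** g = rp pr pr (of_nat y) 1 (of_nat n / pr) 0 0"
      using Z 3 k by (intro rp_move[OF _ _ _ k(1), of _ x1 0 x2 0 x3]) simp_all
    then show ?thesis using n k(3) 3 by (intro bexI[of _ "(pr, of_nat y, 1, of_nat n / pr, 0, 0)"]) (auto simp: rpt_def I1_def image_iff)
  next
    case 4
    have "of_nat y / pr \<in> Zp" using Z(3) 4 by (simp add: field_simps)
    then have y: "y = 0" using Zp_nat_div_0 k(3) 4 by simp
    have Z': "x1 * pr ^ 1 \<in> Zp" "x2 * pr ^ 1 \<in> Zp" "x3 * pr ^ 1 \<in> Zp" using Z 4 y by simp_all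
    obtain n1 where n1: "n1 < p ^ 1" "of_nat n1 / pr ^ 1 - x1 \<in> Zp" by (rule Zp_frac[OF Z'(1)])
    obtain n2 where n2: "n2 < p ^ 1" "of_nat n2 / pr ^ 1 - x2 \<in> Zp" by (rule Zp_frac[OF Z'(2)])
    obtain n3 where n3: "n3 < p ^ 1" "of_nat n3 / pr ^ 1 - x3 \<in> Zp" by (rule Zp_frac[OF Z'(3)])
    have "\<exists>k\<in>K. k ** g = rp pr pr 0 pr (of_nat n1 / pr) (of_nat n2 / pr) (of_nat n3 / pr)"
      using n1 n2 n3 4 k y by (intro rp_move[OF _ _ _ k(1), of _ x1 _ x2 _ x3]) simp_all
    then show ?thesis using n1 n2 n3
      by (intro bexI[of _ "(pr, 0, pr, of_nat n1 / pr, of_nat n2 / pr, of_nat n3 / pr)"]) (auto simp: rpt_def I1_def image_iff)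
  qed
qed

lemma I_coset_eq:
  assumes eq: "left_coset p (rpt \<eta> (d1, d3, d4, x1, x2, x3)) = left_coset p (rpt \<eta> (d1', d3', d4', x1', x2', x3'))" and "\<eta> \<noteq> 0"
    and d: "d1 \<in> range (\<lambda>n. pr ^ n)" "d4 \<in> range (\<lambda>n. pr ^ n)" "d1' \<in> range (\<lambda>n. pr ^ n)" "d4' \<in> range (\<lambda>n. pr ^ n)"
  shows "d1 = d1' \<and> d4 = d4' \<and> (d3 - d3') / d1 \<in> Zp \<and> (d3 = d3' \<longrightarrow> x1 - x1' \<in> Zp \<and> x2 - x2' \<in> Zp \<and> x3 - x3' \<in> Zp)"
proof -
  obtain a b a' b' where "d1 = pr ^ a" "d4 = pr ^ b" "d1' = pr ^ a'" "d4' = pr ^ b'" using d by blast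
  from rp_coset_eq[OF eq[unfolded rpt_def prod.case] assms(2) this] show ?thesis by blast
qed

lemma pr_powers: "1 \<in> range (\<lambda>n. pr ^ n)" "pr \<in> range (\<lambda>n. pr ^ n)" "pr\<^sup>2 \<in> range (\<lambda>n. pr ^ n)"
  using rangeI[of "\<lambda>n. pr ^ n" 0] rangeI[of "\<lambda>n. pr ^ n" 1] rangeI[of "\<lambda>n. pr ^ n" 2] by simp_all

lemma pr_distinct [simp]: "pr \<noteq> 1" "1 \<noteq> pr" "pr \<noteq> pr\<^sup>2" "pr\<^sup>2 \<noteq> pr" "pr\<^sup>2 \<noteq> 1" "1 \<noteq> pr\<^sup>2"
proof -
  have a: "1 < pr" using p_nz(3) by simp
  have "1 * pr < pr * pr" by (rule mult_strict_right_mono[OF a]) simp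
  then have b: "pr < pr\<^sup>2" by (simp add: power2_eq_square)
  note c = less_trans[OF a b]
  show "1 \<noteq> pr" "pr \<noteq> pr\<^sup>2" "1 \<noteq> pr\<^sup>2" by (rule less_imp_neq, rule a b c)+
  show "pr \<noteq> 1" "pr\<^sup>2 \<noteq> pr" "pr\<^sup>2 \<noteq> 1" by (rule not_sym, rule less_imp_neq, rule a b c)+
qed

lemma Zp_frac_eq1: "of_nat m / pr - of_nat n / pr \<in> Zp \<Longrightarrow> m < p \<Longrightarrow> n < p \<Longrightarrow> m = n"
  using Zp_frac_eq[of m 1 n] by simp

lemma Zp_frac_eq1': "(of_nat m - of_nat n) / pr \<in> Zp \<Longrightarrow> m < p \<Longrightarrow> n < p \<Longrightarrow> m = n"
  using Zp_nat_diff_eq[of m n 1] by simp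

lemma I1_inj: "inj_on (\<lambda>s. left_coset p (rpt pr s)) I1"
proof (rule inj_onI)
  fix s t assume st: "s \<in> I1" "t \<in> I1" "left_coset p (rpt pr s) = left_coset p (rpt pr t)"
  obtain d1 d3 d4 x1 x2 x3 where s: "s = (d1, d3, d4, x1, x2, x3)" by (rule prod_cases6)
  obtain d1' d3' d4' x1' x2' x3' where t: "t = (d1', d3', d4', x1', x2', x3')" by (rule prod_cases6)
  have pw: "d1 \<in> range (\<lambda>n. pr ^ n)" "d4 \<in> range (\<lambda>n. pr ^ n)" if "(d1, d3, d4, x1, x2, x3) \<in> I1" for d1 d3 d4 x1 x2 x3
    using that pr_powers by (auto simp: I1_def)
  have c: "d1 = d1' \<and> d4 = d4' \<and> (d3 - d3') / d1 \<in> Zp \<and> (d3 = d3' \<longrightarrow> x1 - x1' \<in> Zp \<and> x2 - x2' \<in> Zp \<and> x3 - x3' \<in> Zp)"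
    by (rule I_coset_eq[OF st(3)[unfolded s t]]) (use st pw in \<open>auto simp: s t\<close>)
  show "s = t"
    using st(1,2) c unfolding s t I1_def
    by (elim UnE) (auto dest!: Zp_frac_eq1 Zp_frac_eq1')
qed

definition \<gamma>1 :: mat4 where "\<gamma>1 = rp pr pr 0 pr 0 0 0"

lemma \<gamma>1_blk: "\<gamma>1 = blk (m2 1 0 0 1) (m2 0 0 0 0) (m2 0 0 0 0) (m2 pr 0 0 pr)"
  by (simp add: \<gamma>1_def rp_def)

text \<open>Weyl elements inside \<open>e13\<close> and \<open>e24\<close> exchange diagonal entries
  and produce the diagonal representatives; right multiplication by integral \<open>ux\<close> and
  \<open>lv\<close> then creates X and the lower left entry of D.\<close>

lemma I1_double_coset: "s \<in> I1 \<Longrightarrow> rpt pr s \<in> double_coset p \<gamma>1"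
proof -
  let ?D = "double_coset p \<gamma>1"
  have g1: "e13 0 (-1) 1 0 ** \<gamma>1 ** e13 0 1 (-1) 0 \<in> ?D" (is "?g1 \<in> _")
    by (intro double_coset_mult double_coset_refl e_K) simp_all
  have g1': "?g1 = blk (m2 pr 0 0 1) (m2 0 0 0 0) (m2 0 0 0 0) (m2 1 0 0 pr)"
    by (simp add: e13_def \<gamma>1_blk)
  have g2: "e24 0 (-1) 1 0 ** \<gamma>1 ** e24 0 1 (-1) 0 \<in> ?D" (is "?g2 \<in> _")
    by (intro double_coset_mult double_coset_refl e_K) simp_all
  have g2': "?g2 = blk (m2 1 0 0 pr) (m2 0 0 0 0) (m2 0 0 0 0) (m2 pr 0 0 1)"
    by (simp add: e24_def \<gamma>1_blk)
  have g3: "e24 0 (-1) 1 0 ** ?g1 ** e24 0 1 (-1) 0 \<in> ?D" (is "?g3 \<in> _")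
    by (intro double_coset_mult g1 e_K) simp_all
  have g3': "?g3 = blk (m2 pr 0 0 pr) (m2 0 0 0 0) (m2 0 0 0 0) (m2 1 0 0 1)"
    unfolding g1' by (simp add: e24_def)
  have 1: "rp pr 1 0 1 0 0 0 \<in> ?D" using g3 unfolding g3' by (simp add: rp_def)
  have 2: "rp pr 1 0 pr 0 0 (of_nat n / pr) \<in> ?D" for n
  proof -
    have "mat 1 ** ?g1 ** ux 0 0 (of_nat n) \<in> ?D" by (intro double_coset_mult g1 K_1 e_K) simp_all
    moreover have "?g1 ** ux 0 0 (of_nat n) = rp pr 1 0 pr 0 0 (of_nat n / pr)"
      unfolding g1' by (simp add: rp_def ux_def)
    ultimately show ?thesis by simp
  qed
  have 3: "rp pr pr (of_nat y) 1 (of_nat n / pr) 0 0 \<in> ?D" for y n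
  proof -
    have "mat 1 ** ?g2 ** (ux (of_nat n) 0 0 ** lv 1 (- of_nat y) 0 1) \<in> ?D"
      by (intro double_coset_mult g2 K_1 K_mult e_K) simp_all
    moreover have "?g2 ** (ux (of_nat n) 0 0 ** lv 1 (- of_nat y) 0 1) = rp pr pr (of_nat y) 1 (of_nat n / pr) 0 0"
      unfolding g2' by (simp add: rp_def ux_def lv_def)
    ultimately show ?thesis by simp
  qed
  have 4: "rp pr pr 0 pr (of_nat n1 / pr) (of_nat n2 / pr) (of_nat n3 / pr) \<in> ?D" for n1 n2 n3
  proof -
    have "mat 1 ** \<gamma>1 ** ux (of_nat n1) (of_nat n2) (of_nat n3) \<in> ?D"
      by (intro double_coset_mult double_coset_refl K_1 e_K) simp_all
    moreover have "\<gamma>1 ** ux (of_nat n1) (of_nat n2) (of_nat n3) = rp pr pr 0 pr (of_nat n1 / pr) (of_nat n2 / pr) (of_nat n3 / pr)"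
      unfolding \<gamma>1_blk by (simp add: rp_def ux_def)
    ultimately show ?thesis by simp
  qed
  assume "s \<in> I1"
  then show ?thesis using 1 2 3 4 by (auto simp: I1_def rpt_def)
qed

lemma double_coset_similitude_integral:
  assumes "symplectic_similitude g \<eta>" "integral_mat g" "h \<in> double_coset p g"
  shows "symplectic_similitude h \<eta>" "integral_mat h"
proof -
  obtain k k' where h: "h = k ** g ** k'" "k \<in> K" "k' \<in> K" using assms(3) unfolding double_coset_def by blast
  show "integral_mat h" unfolding h by (intro integral_mat_mult K_integral h assms)
  show "symplectic_similitude h \<eta>"
    using symplectic_similitude_mult[OF symplectic_similitude_mult[OF _ assms(1)], of k 1 k' 1] h by (simp add: K_iff)
qed

lemma left_cosets_eq:
  assumes sub: "\<And>s. s \<in> I \<Longrightarrow> rpt \<eta> s \<in> double_coset p g"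
    and complete: "\<And>h. h \<in> double_coset p g \<Longrightarrow> \<exists>s\<in>I. \<exists>k\<in>K. k ** h = rpt \<eta> s"
  shows "left_coset p ` double_coset p g = (\<lambda>s. left_coset p (rpt \<eta> s)) ` I"
proof (intro Set.set_eqI iffI)
  fix c assume "c \<in> left_coset p ` double_coset p g"
  then obtain h where h: "c = left_coset p h" "h \<in> double_coset p g" by blast
  obtain s k where s: "s \<in> I" "k \<in> K" "k ** h = rpt \<eta> s" using complete[OF h(2)] by blast
  have "c = left_coset p (rpt \<eta> s)" unfolding h(1) s(3)[symmetric] by (rule left_coset_K[OF s(2), symmetric])
  then show "c \<in> (\<lambda>s. left_coset p (rpt \<eta> s)) ` I" using s(1) by blast
next
  fix c assume "c \<in> (\<lambda>s. left_coset p (rpt \<eta> s)) ` I"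
  then show "c \<in> left_coset p ` double_coset p g" using sub by blast
qed

lemma \<gamma>1_cosets: "left_coset p ` double_coset p \<gamma>1 = (\<lambda>s. left_coset p (rpt pr s)) ` I1"
proof (rule left_cosets_eq)
  have "symplectic_similitude \<gamma>1 pr" unfolding \<gamma>1_def by (rule rp_similitude) simp_all
  moreover have "integral_mat \<gamma>1" unfolding \<gamma>1_blk integral_mat_blk by simp
  ultimately show "\<exists>s\<in>I1. \<exists>k\<in>K. k ** h = rpt pr s" if "h \<in> double_coset p \<gamma>1" for h
    using double_coset_similitude_integral[OF _ _ that] I1_complete by blast
qed (rule I1_double_coset)

subsection \<open>The double coset of diag(p^2,p,1,p)\<close>

text \<open>There are p + p^2 + p^3 + p^4 cosets. In the last two families D is \<open>p\<close>
  times the identity, and p X runs modulo \<open>p\<close> through the nonzero symmetric matrices of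
  rank one, which are multiples of v^T v for v = (1, y) or v = (0, 1).\<close>

definition I2 :: "idx set" where
  "I2 = {(1, 0, pr, 0, 0, 0)} \<union> (\<lambda>y. (pr, of_nat y, 1, 0, 0, 0)) ` {..<p}
     \<union> (\<lambda>(n2, n3). (pr, 0, pr\<^sup>2, 0, of_nat n2 / pr, of_nat n3 / pr\<^sup>2)) ` ({..<p} \<times> {..<p\<^sup>2})
     \<union> (\<lambda>(y, n1, n2). (pr\<^sup>2, pr * of_nat y, pr, of_nat n1 / pr\<^sup>2, of_nat n2 / pr, 0)) ` ({..<p} \<times> {..<p\<^sup>2} \<times> {..<p})
     \<union> (\<lambda>(e, y). (pr, 0, pr, of_nat e / pr, of_nat e * of_nat y / pr, of_nat e * (of_nat y)\<^sup>2 / pr)) ` ({1..<p} \<times> {..<p})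
     \<union> (\<lambda>e. (pr, 0, pr, 0, 0, of_nat e / pr)) ` {1..<p}"

lemma finite_I2: "finite I2" by (simp add: I2_def)

text \<open>Reduction modulo \<open>p\<close> has rank one; this separates the double coset from \<open>p\<close> times a unimodular matrix
  and from the other double cosets of multiplier \<open>p\<^sup>2\<close>.\<close>

definition rank1 :: "mat4 \<Rightarrow> bool" where
  "rank1 g \<longleftrightarrow> (\<exists>u v h. (\<forall>i. u i \<in> Zp) \<and> (\<forall>i. v i \<in> Zp) \<and> integral_mat h \<and>
     (\<forall>i j. g $ i $ j = u i * v j + pr * h $ i $ j)) \<and> (\<exists>i j. g $ i $ j / pr \<notin> Zp)"

text \<open>All two by two minors of a rank one matrix vanish modulo \<open>p\<close>. On the
  triangular form this excludes the exponent pairs (0, 0), (0, 2), (2, 0) and (2, 2).\<close>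

lemma rank1_minor:
  assumes "rank1 g" shows "(g $ i $ j * g $ k $ l - g $ i $ l * g $ k $ j) / pr \<in> Zp"
proof -
  obtain u v h where u: "\<And>i. u i \<in> Zp" "\<And>i. v i \<in> Zp" "integral_mat h" "\<And>i j. g $ i $ j = u i * v j + pr * h $ i $ j"
    using assms unfolding rank1_def by blast
  have "(g $ i $ j * g $ k $ l - g $ i $ l * g $ k $ j) / pr =
     u i * v j * h$k$l + h$i$j * (u k * v l) + pr * h$i$j * h$k$l - (u i * v l * h$k$j + h$i$l * (u k * v j) + pr * h$i$l * h$k$j)"
    unfolding u(4) by (simp add: field_simps)
  also have "\<dots> \<in> Zp" using u by (intro Zp_add Zp_diff Zp_mult) (simp_all add: integral_mat_def)
  finally show ?thesis .
qed

lemma rank1_mult: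
  assumes g: "rank1 g" and k: "k \<in> K" "k' \<in> K" shows "rank1 (k ** g ** k')"
proof -
  obtain u v h where u: "\<And>i. u i \<in> Zp" "\<And>i. v i \<in> Zp" "integral_mat h" "\<And>i j. g $ i $ j = u i * v j + pr * h $ i $ j"
    using g unfolding rank1_def by blast
  have kZ: "k $ i $ j \<in> Zp" "k' $ i $ j \<in> Zp" for i j using k K_integral by (auto simp: integral_mat_def)
  let ?u = "\<lambda>i. \<Sum>j\<in>UNIV. k $ i $ j * u j" and ?v = "\<lambda>j. \<Sum>i\<in>UNIV. v i * k' $ i $ j"
  have A: "(k ** g ** k') $ i $ j = ?u i * ?v j + pr * (k ** h ** k') $ i $ j" for i j
    unfolding matrix_matrix_mult_def
    by (simp add: u(4) sum_distrib_left sum_distrib_right sum.distrib algebra_simps)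
  have B: "?u i \<in> Zp" "?v i \<in> Zp" for i using u kZ by (auto intro!: Zp_sum)
  have C: "integral_mat (k ** h ** k')" by (intro integral_mat_mult K_integral k u)
  \<comment> \<open>If the product were zero modulo \<open>p\<close>, multiplying back by inverses
    in \<open>K\<close> would make \<open>g\<close> zero modulo \<open>p\<close>.\<close>
  have D: "\<exists>i j. (k ** g ** k') $ i $ j / pr \<notin> Zp"
  proof (rule ccontr)
    assume "\<not> ?thesis"
    then have Z: "(k ** g ** k') $ i $ j / pr \<in> Zp" for i j by blast
    define m where "m = (\<chi> i j. (k ** g ** k') $ i $ j / pr)"
    have m: "integral_mat m" using Z by (simp add: integral_mat_def m_def)
    obtain l where l: "l \<in> K" "k ** l = mat 1" "l ** k = mat 1" by (rule K_inverse[OF k(1)])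
    obtain l' where l': "l' \<in> K" "k' ** l' = mat 1" "l' ** k' = mat 1" by (rule K_inverse[OF k(2)])
    have "l ** (k ** g ** k') ** l' = (l ** k) ** g ** (k' ** l')" by (simp only: matrix_mul_assoc)
    then have "g = l ** (k ** g ** k') ** l'" by (simp add: l l')
    moreover have "(l ** (k ** g ** k') ** l') $ i $ j / pr = (l ** m ** l') $ i $ j" for i j
      unfolding matrix_matrix_mult_def[of _ l'] matrix_matrix_mult_def[of l]
      by (simp add: m_def sum_divide_distrib[symmetric])
    moreover have "integral_mat (l ** m ** l')" by (intro integral_mat_mult K_integral l l' m)
    ultimately have "g $ i $ j / pr \<in> Zp" for i j by (simp add: integral_mat_def)
    then show False using g unfolding rank1_def by blast
  qed
  show ?thesis unfolding rank1_def
    by (rule conjI[OF _ D], rule exI[of _ ?u], rule exI[of _ ?v], rule exI[of _ "k ** h ** k'"]) (intro conjI allI A B C)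
qed

lemma I2_complete:
  assumes "symplectic_similitude g (pr\<^sup>2)" "integral_mat g" "rank1 g"
  shows "\<exists>s\<in>I2. \<exists>k\<in>K. k ** g = rpt (pr\<^sup>2) s"
proof -
  obtain k a b y x1 x2 x3 where k: "k \<in> K" "k ** g = rp (pr\<^sup>2) (pr ^ a) (of_nat y) (pr ^ b) x1 x2 x3" "y < p ^ a"
    by (rule rp_exists[OF assms(1,2)]) simp
  have "integral_mat (k ** g)" by (intro integral_mat_mult K_integral k(1) assms)
  then have Z: "pr\<^sup>2 / pr ^ a \<in> Zp" "pr\<^sup>2 / pr ^ b \<in> Zp" "- (pr\<^sup>2 * of_nat y) / (pr ^ a * pr ^ b) \<in> Zp"
    "x1 * pr ^ a + x2 * of_nat y \<in> Zp" "x2 * pr ^ b \<in> Zp" "x2 * pr ^ a + x3 * of_nat y \<in> Zp" "x3 * pr ^ b \<in> Zp"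
    unfolding k(2) rp_def integral_mat_blk by simp_all
  have r1: "rank1 (k ** g)" using rank1_mult[OF assms(3) k(1) K_1] by simp
  note M = rank1_minor[OF r1, unfolded k(2) rp_def]
  have ab2: "a \<le> 2" "b \<le> 2" using Zp_power_ratio[of 2 a] Zp_power_ratio[of 2 b] Z by simp_all
  have M1: "pr\<^sup>2 / pr ^ a * (pr\<^sup>2 / pr ^ b) / pr \<in> Zp" using M[of "Inl 1" "Inl 1" "Inl 2" "Inl 2"] by simp
  have M2: "pr ^ a * pr ^ b / pr \<in> Zp" using M[of "Inr 1" "Inr 1" "Inr 2" "Inr 2"] by simp
  have M3: "pr\<^sup>2 / pr ^ a * pr ^ b / pr \<in> Zp" using M[of "Inl 1" "Inl 1" "Inr 2" "Inr 2"] by simp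
  have M4: "pr\<^sup>2 / pr ^ b * pr ^ a / pr \<in> Zp" using M[of "Inl 2" "Inl 2" "Inr 1" "Inr 1"] by simp
  have ab3: "a = 0 \<or> a = 1 \<or> a = 2" "b = 0 \<or> b = 1 \<or> b = 2" using ab2 by linarith+
  consider "a = 0" "b = 0" | "a = 0" "b = 1" | "a = 0" "b = 2" | "a = 1" "b = 0" | "a = 1" "b = 1" | "a = 1" "b = 2"
    | "a = 2" "b = 0" | "a = 2" "b = 1" | "a = 2" "b = 2" using ab3 by blast
  then show ?thesis
  proof cases
    case 1 then show ?thesis using M2 not_Zp_inverse by simp
  next
    case 3 then show ?thesis using M4 not_Zp_inverse by simp
  next
    case 7 then show ?thesis using M3 not_Zp_inverse by simp
  next
    case 9 then show ?thesis using M1 not_Zp_inverse by simp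
  next
    case 2
    then have y: "y = 0" using k(3) by simp
    have "x3 \<in> Zp" using M[of "Inl 2" "Inr 1" "Inr 1" "Inr 2"] 2 y by simp
    then have "\<exists>k\<in>K. k ** g = rp (pr\<^sup>2) 1 0 pr 0 0 0"
      using Z 2 k y by (intro rp_move[OF _ _ _ k(1), of 0 x1 0 x2 0 x3]) simp_all
    then show ?thesis by (intro bexI[of _ "(1, 0, pr, 0, 0, 0)"]) (simp_all add: rpt_def I2_def)
  next
    case 4
    have "x1 \<in> Zp" using M[of "Inl 1" "Inr 1" "Inr 2" "Inr 2"] 4 by simp
    then have "\<exists>k\<in>K. k ** g = rp (pr\<^sup>2) pr (of_nat y) 1 0 0 0"
      using Z 4 k by (intro rp_move[OF _ _ _ k(1), of 0 x1 0 x2 0 x3]) simp_all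
    then show ?thesis using k(3) 4 by (intro bexI[of _ "(pr, of_nat y, 1, 0, 0, 0)"]) (auto simp: rpt_def I2_def)
  next
    case 6
    have "of_nat y / pr \<in> Zp" using Z(3) 6 by (simp add: power2_eq_square)
    then have y: "y = 0" using Zp_nat_div_0 k(3) 6 by simp
    have x1: "x1 \<in> Zp" using M[of "Inl 1" "Inr 1" "Inl 2" "Inl 2"] 6 y by simp
    obtain n2 where n2: "n2 < p ^ 1" "of_nat n2 / pr ^ 1 - x2 \<in> Zp" by (rule Zp_frac[of x2 1]) (use Z 6 y in simp)
    obtain n3 where n3: "n3 < p ^ 2" "of_nat n3 / pr ^ 2 - x3 \<in> Zp" by (rule Zp_frac[of x3 2]) (use Z 6 in simp)
    have "\<exists>k\<in>K. k ** g = rp (pr\<^sup>2) pr 0 (pr\<^sup>2) 0 (of_nat n2 / pr) (of_nat n3 / pr\<^sup>2)"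
      using x1 n2 n3 6 k y by (intro rp_move[OF _ _ _ k(1), of 0 x1 _ x2 _ x3]) simp_all
    then show ?thesis using n2 n3
      by (intro bexI[of _ "(pr, 0, pr\<^sup>2, 0, of_nat n2 / pr, of_nat n3 / pr\<^sup>2)"]) (auto simp: rpt_def I2_def image_iff)
  next
    case 8
    have "of_nat y / pr \<in> Zp" using Z(3) 8 by (simp add: power2_eq_square)
    then have "of_int (int y) / pr ^ 1 \<in> Zp" by simp
    then have "int p dvd int y" unfolding Zp_int_div_power by simp
    then obtain y' where y: "y = p * y'" by auto
    have y': "y' < p" using k(3) 8 y by (simp add: power2_eq_square)
    have x3: "x3 \<in> Zp" using M[of "Inl 1" "Inl 1" "Inl 2" "Inr 2"] 8 by simp
    have x2: "x2 * pr ^ 1 \<in> Zp" using Z 8 by simp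
    have "x1 * pr ^ 2 + x2 * of_nat y \<in> Zp" using Z(4) 8 by simp
    from Zp_diff[OF this Zp_mult[OF x2 Zp_of_nat[of y']]]
    have "x1 * pr ^ 2 + x2 * of_nat y - (x2 * pr ^ 1) * of_nat y' \<in> Zp" .
    then have "x1 * pr ^ 2 \<in> Zp" by (simp add: y)
    then obtain n1 where n1: "n1 < p ^ 2" "of_nat n1 / pr ^ 2 - x1 \<in> Zp" by (rule Zp_frac)
    obtain n2 where n2: "n2 < p ^ 1" "of_nat n2 / pr ^ 1 - x2 \<in> Zp" by (rule Zp_frac[OF x2])
    have "\<exists>k\<in>K. k ** g = rp (pr\<^sup>2) (pr\<^sup>2) (pr * of_nat y') pr (of_nat n1 / pr\<^sup>2) (of_nat n2 / pr) 0"
      using x3 n1 n2 8 k y by (intro rp_move[OF _ _ _ k(1), of _ x1 _ x2 0 x3]) simp_all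
    then show ?thesis using n1 n2 y'
      by (intro bexI[of _ "(pr\<^sup>2, pr * of_nat y', pr, of_nat n1 / pr\<^sup>2, of_nat n2 / pr, 0)"]) (auto simp: rpt_def I2_def image_iff)
  next
    case 5
    \<comment> \<open>This minor multiplies the off-diagonal entries of A and D, which are
      \<open>- y\<close> and \<open>y\<close> here.\<close>
    have "of_nat y * of_nat y / pr \<in> Zp" using M[of "Inl 1" "Inl 2" "Inr 2" "Inr 1"] 5 by (simp add: power2_eq_square)
    then have "(of_nat y)\<^sup>2 / pr \<in> Zp" by (simp only: power2_eq_square)
    then have "of_nat y / pr \<in> Zp" by (rule Zp_square_div[OF Zp_of_nat])
    then have y: "y = 0" using Zp_nat_div_0 k(3) 5 by simp
    \<comment> \<open>p X is an integral symmetric matrix with determinant 0 modulo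
      \<open>p\<close>. It is nonzero modulo \<open>p\<close>, because A and D vanish modulo
      \<open>p\<close> in this case.\<close>
    define b1 b2 b3 where "b1 = x1 * pr" and "b2 = x2 * pr" and "b3 = x3 * pr"
    have b: "b1 \<in> Zp" "b2 \<in> Zp" "b3 \<in> Zp" using Z 5 y by (simp_all add: b1_def b2_def b3_def)
    have x: "x1 = b1 / pr" "x2 = b2 / pr" "x3 = b3 / pr" by (simp_all add: b1_def b2_def b3_def)
    have det: "(b1 * b3 - b2 * b2) / pr \<in> Zp" using M[of "Inl 1" "Inr 1" "Inl 2" "Inr 2"] 5 y by (simp add: b1_def b2_def b3_def)
    have kg: "k ** g = rp (pr\<^sup>2) pr 0 pr x1 x2 x3" using k(2) 5 y by simp
    have nd: "b1 / pr \<notin> Zp \<or> b2 / pr \<notin> Zp \<or> b3 / pr \<notin> Zp"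
    proof (rule ccontr)
      assume "\<not> ?thesis"
      then have "(k ** g) $ i $ j / pr \<in> Zp" for i j
        unfolding kg rp_def
        by (cases i; cases j) (use exhaust_2[of "case i of Inl a \<Rightarrow> a | Inr a \<Rightarrow> a"] exhaust_2[of "case j of Inl a \<Rightarrow> a | Inr a \<Rightarrow> a"]
             in \<open>auto simp: power2_eq_square x\<close>)
      then show False using r1 unfolding rank1_def by blast
    qed
    show ?thesis
    proof (rule Zp_unit_cases[OF b(1)])
      assume b1: "b1 / pr \<in> Zp"
      have "b1 / pr * b3 - (b1 * b3 - b2 * b2) / pr \<in> Zp" using b1 b det by (intro Zp_diff Zp_mult)
      then have "b2\<^sup>2 / pr \<in> Zp" by (simp add: diff_divide_distrib power2_eq_square)
      then have b2: "b2 / pr \<in> Zp" using Zp_square_div b by blast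
      obtain n where n: "n < p ^ 1" "of_nat n / pr ^ 1 - x3 \<in> Zp" by (rule Zp_frac[of x3 1]) (use b in \<open>simp add: x\<close>)
      have "n \<noteq> 0"
      proof
        assume "n = 0" then have "x3 \<in> Zp" using n by simp
        then show False using nd b1 b2 by (simp add: x)
      qed
      moreover have "\<exists>k\<in>K. k ** g = rp (pr\<^sup>2) pr 0 pr 0 0 (of_nat n / pr)"
        using n b1 b2 kg by (intro rp_move[OF _ _ _ k(1), of _ x1 _ x2 _ x3]) (simp_all add: x)
      ultimately show ?thesis using n by (intro bexI[of _ "(pr, 0, pr, 0, 0, of_nat n / pr)"]) (auto simp: rpt_def I2_def image_iff)
    next
      assume b1: "b1 \<noteq> 0" "1 / b1 \<in> Zp" "b1 / pr \<notin> Zp"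
      obtain e where e: "e < p ^ 1" "(b1 - of_nat e) / pr ^ 1 \<in> Zp" by (rule Zp_residue[OF b(1)])
      have "e \<noteq> 0" using e b1(3) by (intro notI) simp
      \<comment> \<open>With \<open>b1\<close> a unit, p X is modulo \<open>p\<close> equal to
        \<open>b1\<close> times v^T v for v = (1, b2 / b1); \<open>e\<close> and \<open>t\<close>
        are the residues of \<open>b1\<close> and \<open>b2 / b1\<close>.\<close>
      obtain t where t: "t < p ^ 1" "(b2 * (1 / b1) - of_nat t) / pr ^ 1 \<in> Zp" by (rule Zp_residue[OF Zp_mult[OF b(2) b1(2)]])
      have e': "(b1 - of_nat e) / pr \<in> Zp" and t': "(b2 * (1 / b1) - of_nat t) / pr \<in> Zp" using e t by simp_all
      have 1: "of_nat e / pr - x1 \<in> Zp" using Zp_minus[OF e'] by (simp add: x diff_divide_distrib)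
      have "of_nat e * of_nat t / pr - x2 = - (of_nat t * ((b1 - of_nat e) / pr)) - b1 * ((b2 * (1 / b1) - of_nat t) / pr)"
        using b1 by (simp add: x field_simps)
      also have "\<dots> \<in> Zp" using b e' t' by (intro Zp_diff Zp_minus Zp_mult) simp_all
      finally have 2: "of_nat e * of_nat t / pr - x2 \<in> Zp" .
      have "of_nat e * (of_nat t)\<^sup>2 / pr - x3 = - ((of_nat t)\<^sup>2 * ((b1 - of_nat e) / pr))
          - (1 / b1) * ((b1 * b3 - b2 * b2) / pr) - (b2 + b1 * of_nat t) * ((b2 * (1 / b1) - of_nat t) / pr)"
        using b1 by (simp add: x field_simps power2_eq_square)
      also have "\<dots> \<in> Zp" using b e' t' det b1(2) by (intro Zp_diff Zp_minus Zp_mult Zp_add Zp_power) simp_all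
      finally have 3: "of_nat e * (of_nat t)\<^sup>2 / pr - x3 \<in> Zp" .
      have "\<exists>k\<in>K. k ** g = rp (pr\<^sup>2) pr 0 pr (of_nat e / pr) (of_nat e * of_nat t / pr) (of_nat e * (of_nat t)\<^sup>2 / pr)"
        by (rule rp_move[OF 1 2 3 k(1) kg])
      then show ?thesis using e t \<open>e \<noteq> 0\<close>
        by (intro bexI[of _ "(pr, 0, pr, of_nat e / pr, of_nat e * of_nat t / pr, of_nat e * (of_nat t)\<^sup>2 / pr)"])
           (auto simp: rpt_def I2_def image_iff)
    qed
  qed
qed

lemma I2_E:
  assumes "(d1, d3, d4, x1, x2, x3) \<in> I2"
  obtains (A) "d1 = 1" "d3 = 0" "d4 = pr" "x1 = 0" "x2 = 0" "x3 = 0"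
  | (B) y where "y < p" "d1 = pr" "d3 = of_nat y" "d4 = 1" "x1 = 0" "x2 = 0" "x3 = 0"
  | (C) m n where "m < p" "n < p\<^sup>2" "d1 = pr" "d3 = 0" "d4 = pr\<^sup>2" "x1 = 0" "x2 = of_nat m / pr" "x3 = of_nat n / pr\<^sup>2"
  | (D) z m n where "z < p" "m < p\<^sup>2" "n < p" "d1 = pr\<^sup>2" "d3 = pr * of_nat z" "d4 = pr"
      "x1 = of_nat m / pr\<^sup>2" "x2 = of_nat n / pr" "x3 = 0"
  | (E) e y where "1 \<le> e" "e < p" "y < p" "d1 = pr" "d3 = 0" "d4 = pr" "x1 = of_nat e / pr"
      "x2 = of_nat e * of_nat y / pr" "x3 = of_nat e * (of_nat y)\<^sup>2 / pr"
  | (F) e where "1 \<le> e" "e < p" "d1 = pr" "d3 = 0" "d4 = pr" "x1 = 0" "x2 = 0" "x3 = of_nat e / pr"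
  using assms[unfolded I2_def]
proof (elim UnE imageE)
  assume "(d1, d3, d4, x1, x2, x3) \<in> {(1, 0, pr, 0, 0, 0)}"
  then show thesis by (intro A) simp_all
next
  fix y assume "(d1, d3, d4, x1, x2, x3) = (pr, of_nat y, 1, 0, 0, 0)" "y \<in> {..<p}"
  then show thesis by (intro B[of y]) simp_all
next
  fix q assume "(d1, d3, d4, x1, x2, x3) = (case q of (n2, n3) \<Rightarrow> (pr, 0, pr\<^sup>2, 0, of_nat n2 / pr, of_nat n3 / pr\<^sup>2))"
    "q \<in> {..<p} \<times> {..<p\<^sup>2}"
  then show thesis by (intro C[of "fst q" "snd q"]) (simp_all add: case_prod_beta mem_Times_iff)
next
  fix q assume "(d1, d3, d4, x1, x2, x3) = (case q of (y, n1, n2) \<Rightarrow> (pr\<^sup>2, pr * of_nat y, pr, of_nat n1 / pr\<^sup>2, of_nat n2 / pr, 0))"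
    "q \<in> {..<p} \<times> {..<p\<^sup>2} \<times> {..<p}"
  then show thesis by (intro D[of "fst q" "fst (snd q)" "snd (snd q)"]) (simp_all add: case_prod_beta mem_Times_iff)
next
  fix q assume "(d1, d3, d4, x1, x2, x3) = (case q of (e, y) \<Rightarrow> (pr, 0, pr, of_nat e / pr, of_nat e * of_nat y / pr, of_nat e * (of_nat y)\<^sup>2 / pr))"
    "q \<in> {1..<p} \<times> {..<p}"
  then show thesis by (intro E[of "fst q" "snd q"]) (simp_all add: case_prod_beta mem_Times_iff)
next
  fix e assume "(d1, d3, d4, x1, x2, x3) = (pr, 0, pr, 0, 0, of_nat e / pr)" "e \<in> {1..<p}"
  then show thesis by (intro F[of e]) simp_all
qed

lemma I2_cases:
  assumes "(d1, d3, d4, x1, x2, x3) \<in> I2"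
  shows "d1 = 1 \<and> d4 = pr \<or> d1 = pr \<and> d4 = 1 \<or> d1 = pr \<and> d4 = pr\<^sup>2 \<or> d1 = pr\<^sup>2 \<and> d4 = pr \<or> d1 = pr \<and> d4 = pr"
    "d1 = 1 \<Longrightarrow> d3 = 0 \<and> x1 = 0 \<and> x2 = 0 \<and> x3 = 0"
    "d1 = pr \<Longrightarrow> d4 = 1 \<Longrightarrow> \<exists>y. y < p \<and> d3 = of_nat y \<and> x1 = 0 \<and> x2 = 0 \<and> x3 = 0"
    "d1 = pr \<Longrightarrow> d4 = pr\<^sup>2 \<Longrightarrow> \<exists>m n. m < p \<and> n < p\<^sup>2 \<and> d3 = 0 \<and> x1 = 0 \<and> x2 = of_nat m / pr \<and> x3 = of_nat n / pr\<^sup>2"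
    "d1 = pr\<^sup>2 \<Longrightarrow> d4 = pr \<Longrightarrow> \<exists>z m n. z < p \<and> m < p\<^sup>2 \<and> n < p \<and> d3 = pr * of_nat z \<and> x1 = of_nat m / pr\<^sup>2 \<and> x2 = of_nat n / pr \<and> x3 = 0"
    "d1 = pr \<Longrightarrow> d4 = pr \<Longrightarrow> d3 = 0 \<and> ((\<exists>e y. 1 \<le> e \<and> e < p \<and> y < p \<and> x1 = of_nat e / pr \<and> x2 = of_nat e * of_nat y / pr \<and> x3 = of_nat e * (of_nat y)\<^sup>2 / pr)
       \<or> (\<exists>e. 1 \<le> e \<and> e < p \<and> x1 = 0 \<and> x2 = 0 \<and> x3 = of_nat e / pr))"
proof -
  note d = pr_distinct
  show "d1 = 1 \<and> d4 = pr \<or> d1 = pr \<and> d4 = 1 \<or> d1 = pr \<and> d4 = pr\<^sup>2 \<or> d1 = pr\<^sup>2 \<and> d4 = pr \<or> d1 = pr \<and> d4 = pr"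
    by (rule I2_E[OF assms]) blast+
  show "d3 = 0 \<and> x1 = 0 \<and> x2 = 0 \<and> x3 = 0" if "d1 = 1"
    by (rule I2_E[OF assms]) (use that d in metis)+
  show "\<exists>y. y < p \<and> d3 = of_nat y \<and> x1 = 0 \<and> x2 = 0 \<and> x3 = 0" if "d1 = pr" "d4 = 1"
    by (rule I2_E[OF assms]) (use that d in metis)+
  show "\<exists>m n. m < p \<and> n < p\<^sup>2 \<and> d3 = 0 \<and> x1 = 0 \<and> x2 = of_nat m / pr \<and> x3 = of_nat n / pr\<^sup>2" if "d1 = pr" "d4 = pr\<^sup>2"
    by (rule I2_E[OF assms]) (use that d in metis)+
  show "\<exists>z m n. z < p \<and> m < p\<^sup>2 \<and> n < p \<and> d3 = pr * of_nat z \<and> x1 = of_nat m / pr\<^sup>2 \<and> x2 = of_nat n / pr \<and> x3 = 0" if "d1 = pr\<^sup>2" "d4 = pr"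
    by (rule I2_E[OF assms]) (use that d in metis)+
  show "d3 = 0 \<and> ((\<exists>e y. 1 \<le> e \<and> e < p \<and> y < p \<and> x1 = of_nat e / pr \<and> x2 = of_nat e * of_nat y / pr \<and> x3 = of_nat e * (of_nat y)\<^sup>2 / pr)
       \<or> (\<exists>e. 1 \<le> e \<and> e < p \<and> x1 = 0 \<and> x2 = 0 \<and> x3 = of_nat e / pr))" if "d1 = pr" "d4 = pr"
    by (rule I2_E[OF assms]) (use that d in metis)+
qed

lemma I2_inj: "inj_on (\<lambda>s. left_coset p (rpt (pr\<^sup>2) s)) I2"
proof (rule inj_onI)
  fix s t assume st: "s \<in> I2" "t \<in> I2" "left_coset p (rpt (pr\<^sup>2) s) = left_coset p (rpt (pr\<^sup>2) t)"
  obtain d1 d3 d4 x1 x2 x3 where s: "s = (d1, d3, d4, x1, x2, x3)" by (rule prod_cases6)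
  obtain d1' d3' d4' x1' x2' x3' where t: "t = (d1', d3', d4', x1', x2', x3')" by (rule prod_cases6)
  have pw: "d1 \<in> range (\<lambda>n. pr ^ n)" "d4 \<in> range (\<lambda>n. pr ^ n)" if "(d1, d3, d4, x1, x2, x3) \<in> I2" for d1 d3 d4 x1 x2 x3
    using that pr_powers by (auto simp: I2_def)
  have c: "d1 = d1' \<and> d4 = d4' \<and> (d3 - d3') / d1 \<in> Zp \<and> (d3 = d3' \<longrightarrow> x1 - x1' \<in> Zp \<and> x2 - x2' \<in> Zp \<and> x3 - x3' \<in> Zp)"
    by (rule I_coset_eq[OF st(3)[unfolded s t]]) (use st pw in \<open>auto simp: s t\<close>)
  have f2: "m = n" if "of_nat m / pr\<^sup>2 - of_nat n / pr\<^sup>2 \<in> Zp" "m < p\<^sup>2" "n < p\<^sup>2" for m n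
    by (rule Zp_frac_eq[OF that])
  have py: "m = n" if "(pr * of_nat m - pr * of_nat n) / pr\<^sup>2 \<in> Zp" "m < p" "n < p" for m n
  proof (rule Zp_frac_eq1'[OF _ that(2,3)])
    have "(pr * of_nat m - pr * of_nat n) / pr\<^sup>2 = (of_nat m - of_nat n) / pr"
      by (simp add: power2_eq_square field_simps)
    then show "(of_nat m - of_nat n) / pr \<in> Zp" using that(1) by simp
  qed
  have nu: "of_nat e / pr \<notin> Zp" if "1 \<le> e" "e < p" for e using Zp_nat_div_0[of e] that by auto
  \<comment> \<open>\<open>e\<close> is a unit of the local ring and can be cancelled.\<close>
  have ey: "m = n" if "of_nat e * of_nat m / pr - of_nat e * of_nat n / pr \<in> Zp" "1 \<le> e" "e < p" "m < p" "n < p" for e m n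
  proof (rule Zp_unit_cases[of "of_nat e"])
    assume e: "(of_nat e :: rat) \<noteq> 0" "1 / of_nat e \<in> Zp"
    have "(1 / of_nat e) * (of_nat e * of_nat m / pr - of_nat e * of_nat n / pr) \<in> Zp" using e(2) that(1) by (rule Zp_mult)
    moreover have "(1 / of_nat e) * (of_nat e * of_nat m / pr - of_nat e * of_nat n / pr) = (of_nat m - of_nat n) / pr"
      using e(1) by (simp add: field_simps)
    ultimately show ?thesis using Zp_frac_eq1'[of m n] that by simp
  qed (use nu that in auto)
  have s': "(d1, d3, d4, x1, x2, x3) \<in> I2" and t': "(d1, d3', d4, x1', x2', x3') \<in> I2"
    using st(1,2) c by (simp_all add: s t)
  have "d3 = d3' \<and> x1 = x1' \<and> x2 = x2' \<and> x3 = x3'"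
    using I2_cases(1)[OF s']
  proof (elim disjE conjE)
    assume "d1 = 1" "d4 = pr"
    then show ?thesis using I2_cases(2)[OF s'] I2_cases(2)[OF t'] by simp
  next
    assume d: "d1 = pr" "d4 = 1"
    obtain y where y: "y < p" "d3 = of_nat y" "x1 = 0" "x2 = 0" "x3 = 0" using I2_cases(3)[OF s' d] by blast
    obtain y' where y': "y' < p" "d3' = of_nat y'" "x1' = 0" "x2' = 0" "x3' = 0" using I2_cases(3)[OF t' d] by blast
    have "(d3 - d3') / d1 \<in> Zp" using c by blast
    then have "y = y'" unfolding y(2) y'(2) d(1) by (rule Zp_frac_eq1'[OF _ y(1) y'(1)])
    then show ?thesis using y y' by simp
  next
    assume d: "d1 = pr" "d4 = pr\<^sup>2"
    obtain m n where y: "m < p" "n < p\<^sup>2" "d3 = 0" "x1 = 0" "x2 = of_nat m / pr" "x3 = of_nat n / pr\<^sup>2" using I2_cases(4)[OF s' d] by blast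
    obtain m' n' where y': "m' < p" "n' < p\<^sup>2" "d3' = 0" "x1' = 0" "x2' = of_nat m' / pr" "x3' = of_nat n' / pr\<^sup>2" using I2_cases(4)[OF t' d] by blast
    have "m = m'" "n = n'" using Zp_frac_eq1[of m m'] f2[of n n'] c y y' by simp_all
    then show ?thesis using y y' by simp
  next
    assume d: "d1 = pr\<^sup>2" "d4 = pr"
    obtain z m n where y: "z < p" "m < p\<^sup>2" "n < p" "d3 = pr * of_nat z" "x1 = of_nat m / pr\<^sup>2" "x2 = of_nat n / pr" "x3 = 0"
      using I2_cases(5)[OF s' d] by blast
    obtain z' m' n' where y': "z' < p" "m' < p\<^sup>2" "n' < p" "d3' = pr * of_nat z'" "x1' = of_nat m' / pr\<^sup>2" "x2' = of_nat n' / pr" "x3' = 0"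
      using I2_cases(5)[OF t' d] by blast
    have "(d3 - d3') / d1 \<in> Zp" using c by blast
    then have z: "z = z'" unfolding y(4) y'(4) d(1) by (rule py[OF _ y(1) y'(1)])
    have "m = m'" "n = n'" using Zp_frac_eq1[of n n'] f2[of m m'] c y y' z by simp_all
    then show ?thesis using y y' z by simp
  next
    assume d: "d1 = pr" "d4 = pr"
    have d3: "d3 = 0" "d3' = 0" and s'': "(\<exists>e y. 1 \<le> e \<and> e < p \<and> y < p \<and> x1 = of_nat e / pr \<and> x2 = of_nat e * of_nat y / pr \<and> x3 = of_nat e * (of_nat y)\<^sup>2 / pr)
       \<or> (\<exists>e. 1 \<le> e \<and> e < p \<and> x1 = 0 \<and> x2 = 0 \<and> x3 = of_nat e / pr)"
      and t'': "(\<exists>e y. 1 \<le> e \<and> e < p \<and> y < p \<and> x1' = of_nat e / pr \<and> x2' = of_nat e * of_nat y / pr \<and> x3' = of_nat e * (of_nat y)\<^sup>2 / pr)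
       \<or> (\<exists>e. 1 \<le> e \<and> e < p \<and> x1' = 0 \<and> x2' = 0 \<and> x3' = of_nat e / pr)"
      using I2_cases(6)[OF s' d] I2_cases(6)[OF t' d] by simp_all
    have c': "x1 - x1' \<in> Zp" "x2 - x2' \<in> Zp" "x3 - x3' \<in> Zp" using c d3 by simp_all
    show ?thesis using s''
    proof (elim disjE exE conjE)
      fix e y assume y: "1 \<le> e" "e < p" "y < p" "x1 = of_nat e / pr" "x2 = of_nat e * of_nat y / pr" "x3 = of_nat e * (of_nat y)\<^sup>2 / pr"
      show ?thesis using t''
      proof (elim disjE exE conjE)
        fix e' y' assume y': "1 \<le> e'" "e' < p" "y' < p" "x1' = of_nat e' / pr" "x2' = of_nat e' * of_nat y' / pr" "x3' = of_nat e' * (of_nat y')\<^sup>2 / pr"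
        have e: "e = e'" using Zp_frac_eq1[of e e'] c'(1) y y' by simp
        have "of_nat e * of_nat y / pr - of_nat e * of_nat y' / pr \<in> Zp" using c'(2) y(5) y'(5) e by simp
        from ey[OF this y(1-3) y'(3)] show ?thesis using y y' e d3 by simp
      next
        fix e' assume "1 \<le> e'" "e' < p" "x1' = 0"
        then show ?thesis using nu[of e] c'(1) y by simp
      qed
    next
      fix e assume y: "1 \<le> e" "e < p" "x1 = 0" "x2 = 0" "x3 = of_nat e / pr"
      show ?thesis using t''
      proof (elim disjE exE conjE)
        fix e' y' assume "1 \<le> e'" "e' < p" "x1' = of_nat e' / pr"
        then show ?thesis using nu[of e'] c'(1) y by simp
      next
        fix e' assume y': "1 \<le> e'" "e' < p" "x1' = 0" "x2' = 0" "x3' = of_nat e' / pr"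
        have "e = e'" using Zp_frac_eq1[of e e'] c'(3) y y' by simp
        then show ?thesis using y y' d3 by simp
      qed
    qed
  qed
  then show "s = t" using c by (simp add: s t)
qed

text \<open>This is diag(p^2, p, 1, p), which a Weyl element carries to diag(1, p, p^2, p) in the
  same double coset.\<close>

definition \<gamma>2 :: mat4 where "\<gamma>2 = rp (pr\<^sup>2) 1 0 pr 0 0 0"

lemma \<gamma>2_blk: "\<gamma>2 = blk (m2 (pr\<^sup>2) 0 0 pr) (m2 0 0 0 0) (m2 0 0 0 0) (m2 1 0 0 pr)"
  by (simp add: \<gamma>2_def rp_def power2_eq_square)

lemma \<gamma>2_rank1: "rank1 \<gamma>2"
proof -
  let ?u = "\<lambda>i :: 2 + 2. if i = Inr 1 then 1 else 0 :: rat"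
  let ?h = "blk (m2 pr 0 0 1) (m2 0 0 0 0) (m2 0 0 0 0) (m2 0 0 0 1)"
  have A: "\<forall>i j. \<gamma>2 $ i $ j = ?u i * ?u j + pr * ?h $ i $ j"
    by (simp add: all_sum_type forall_2 \<gamma>2_blk power2_eq_square)
  have B: "integral_mat ?h" by (simp add: integral_mat_blk)
  have C: "\<gamma>2 $ Inr 1 $ Inr 1 / pr \<notin> Zp" using not_Zp_inverse by (simp add: \<gamma>2_blk)
  have D: "\<forall>i. ?u i \<in> Zp" by simp
  show ?thesis unfolding rank1_def
  proof
    show "\<exists>u v h. (\<forall>i. u i \<in> Zp) \<and> (\<forall>i. v i \<in> Zp) \<and> integral_mat h \<and> (\<forall>i j. \<gamma>2 $ i $ j = u i * v j + pr * h $ i $ j)"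
      by (rule exI[of _ ?u], rule exI[of _ ?u], rule exI[of _ ?h]) (intro conjI A B D)
    show "\<exists>i j. \<gamma>2 $ i $ j / pr \<notin> Zp" by (rule exI, rule exI, rule C)
  qed
qed

lemma I2_double_coset: "s \<in> I2 \<Longrightarrow> rpt (pr\<^sup>2) s \<in> double_coset p \<gamma>2"
proof -
  let ?D = "double_coset p \<gamma>2"
  have pp: "pr\<^sup>2 = pr * pr" by (rule power2_eq_square)
  have g1: "lv 0 1 (-1) 0 ** \<gamma>2 ** lv 0 (-1) 1 0 \<in> ?D" (is "?g1 \<in> _")
    by (intro double_coset_mult double_coset_refl e_K) simp_all
  have g1': "?g1 = blk (m2 pr 0 0 (pr\<^sup>2)) (m2 0 0 0 0) (m2 0 0 0 0) (m2 pr 0 0 1)"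
    by (simp add: lv_def \<gamma>2_blk)
  have g2: "e24 0 (-1) 1 0 ** ?g1 ** e24 0 1 (-1) 0 \<in> ?D" (is "?g2 \<in> _")
    by (intro double_coset_mult g1 e_K) simp_all
  have g2': "?g2 = blk (m2 pr 0 0 1) (m2 0 0 0 0) (m2 0 0 0 0) (m2 pr 0 0 (pr\<^sup>2))"
    unfolding g1' by (simp add: e24_def)
  have g3: "e13 0 (-1) 1 0 ** \<gamma>2 ** e13 0 1 (-1) 0 \<in> ?D" (is "?g3 \<in> _")
    by (intro double_coset_mult double_coset_refl e_K) simp_all
  have g3': "?g3 = blk (m2 1 0 0 pr) (m2 0 0 0 0) (m2 0 0 0 0) (m2 (pr\<^sup>2) 0 0 pr)"
    by (simp add: e13_def \<gamma>2_blk)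
  have 1: "rp (pr\<^sup>2) 1 0 pr 0 0 0 \<in> ?D" using double_coset_refl unfolding \<gamma>2_def .
  have 2: "rp (pr\<^sup>2) pr (of_nat y) 1 0 0 0 \<in> ?D" for y
  proof -
    have "mat 1 ** ?g1 ** lv 1 (- of_nat y) 0 1 \<in> ?D" by (intro double_coset_mult g1 K_1 e_K) simp_all
    moreover have "?g1 ** lv 1 (- of_nat y) 0 1 = rp (pr\<^sup>2) pr (of_nat y) 1 0 0 0"
      unfolding g1' by (simp add: rp_def lv_def pp)
    ultimately show ?thesis by simp
  qed
  have 3: "rp (pr\<^sup>2) pr 0 (pr\<^sup>2) 0 (of_nat n2 / pr) (of_nat n3 / pr\<^sup>2) \<in> ?D" for n2 n3
  proof -
    have "mat 1 ** ?g2 ** ux 0 (of_nat n2) (of_nat n3) \<in> ?D" by (intro double_coset_mult g2 K_1 e_K) simp_all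
    moreover have "?g2 ** ux 0 (of_nat n2) (of_nat n3) = rp (pr\<^sup>2) pr 0 (pr\<^sup>2) 0 (of_nat n2 / pr) (of_nat n3 / pr\<^sup>2)"
      unfolding g2' by (simp add: rp_def ux_def pp)
    ultimately show ?thesis by simp
  qed
  have 4: "rp (pr\<^sup>2) (pr\<^sup>2) (pr * of_nat y) pr (of_nat n1 / pr\<^sup>2) (of_nat n2 / pr) 0 \<in> ?D" for y n1 n2
  proof -
    have "mat 1 ** ?g3 ** (ux (of_nat n1) (of_nat n2) 0 ** lv 1 (- of_nat y) 0 1) \<in> ?D"
      by (intro double_coset_mult g3 K_1 K_mult e_K) simp_all
    moreover have "?g3 ** (ux (of_nat n1) (of_nat n2) 0 ** lv 1 (- of_nat y) 0 1) =
        rp (pr\<^sup>2) (pr\<^sup>2) (pr * of_nat y) pr (of_nat n1 / pr\<^sup>2) (of_nat n2 / pr) 0"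
      unfolding g3' by (simp add: rp_def ux_def lv_def pp field_simps)
    ultimately show ?thesis by simp
  qed
  have unit: "1 / of_nat e \<in> Zp" "(of_nat e :: rat) \<noteq> 0" "pr / of_nat e \<in> Zp" if "1 \<le> e" "e < p" for e
  proof -
    have "1 / of_nat e \<in> Zp \<and> (of_nat e :: rat) \<noteq> 0"
      by (rule Zp_unit_cases[of "of_nat e"]) (use that Zp_nat_div_0[of e] in auto)
    then show "1 / of_nat e \<in> Zp" "(of_nat e :: rat) \<noteq> 0" by auto
    then have "pr * (1 / of_nat e) \<in> Zp" by (intro Zp_mult) simp_all
    then show "pr / of_nat e \<in> Zp" by simp
  qed
  \<comment> \<open>For a unit \<open>e\<close> the matrix with rows (p, e), (0, p) has elementary
    divisors 1 and p^2, which the factors \<open>e13\<close> realise explicitly; conjugation by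
    \<open>lv\<close> then turns the single entry into \<open>e\<close> times v^T v for v = (1,
    y).\<close>
  have 5: "rp (pr\<^sup>2) pr 0 pr (of_nat e / pr) (of_nat e * of_nat y / pr) (of_nat e * (of_nat y)\<^sup>2 / pr) \<in> ?D"
    if e: "1 \<le> e" "e < p" for e y
  proof -
    note u = unit[OF e]
    have "lv 1 0 (of_nat y) 1 ** (e13 1 0 (pr / of_nat e) 1 ** ?g3 ** (e13 0 (of_nat e) (- (1 / of_nat e)) 0 ** e13 1 0 (pr / of_nat e) 1))
       ** lv 1 0 (- of_nat y) 1 \<in> ?D"
      by (intro double_coset_mult g3 K_mult e_K) (use u in simp_all)
    moreover have "lv 1 0 (of_nat y) 1 ** (e13 1 0 (pr / of_nat e) 1 ** ?g3 ** (e13 0 (of_nat e) (- (1 / of_nat e)) 0 ** e13 1 0 (pr / of_nat e) 1))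
       ** lv 1 0 (- of_nat y) 1 = rp (pr\<^sup>2) pr 0 pr (of_nat e / pr) (of_nat e * of_nat y / pr) (of_nat e * (of_nat y)\<^sup>2 / pr)"
      unfolding g3' using u(2) by (simp add: rp_def e13_def lv_def power2_eq_square field_simps)
    ultimately show ?thesis by simp
  qed
  have 6: "rp (pr\<^sup>2) pr 0 pr 0 0 (of_nat e / pr) \<in> ?D"
    if e: "1 \<le> e" "e < p" for e
  proof -
    note u = unit[OF e]
    have "e24 1 0 (pr / of_nat e) 1 ** ?g2 ** (e24 0 (of_nat e) (- (1 / of_nat e)) 0 ** e24 1 0 (pr / of_nat e) 1) \<in> ?D"
      by (intro double_coset_mult g2 K_mult e_K) (use u in simp_all)
    moreover have "e24 1 0 (pr / of_nat e) 1 ** ?g2 ** (e24 0 (of_nat e) (- (1 / of_nat e)) 0 ** e24 1 0 (pr / of_nat e) 1)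
       = rp (pr\<^sup>2) pr 0 pr 0 0 (of_nat e / pr)"
      unfolding g2' using u(2) by (simp add: rp_def e24_def pp field_simps)
    ultimately show ?thesis by simp
  qed
  assume "s \<in> I2"
  then show ?thesis using 1 2 3 4 5 6 by (auto simp: I2_def rpt_def)
qed

lemma \<gamma>2_cosets: "left_coset p ` double_coset p \<gamma>2 = (\<lambda>s. left_coset p (rpt (pr\<^sup>2) s)) ` I2"
proof (rule left_cosets_eq)
  have "symplectic_similitude \<gamma>2 (pr\<^sup>2)" unfolding \<gamma>2_def by (rule rp_similitude) simp_all
  moreover have "integral_mat \<gamma>2" unfolding \<gamma>2_blk integral_mat_blk by auto
  moreover have "rank1 h" if "h \<in> double_coset p \<gamma>2" for h
    using that rank1_mult[OF \<gamma>2_rank1] unfolding double_coset_def by auto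
  ultimately show "\<exists>s\<in>I2. \<exists>k\<in>K. k ** h = rpt (pr\<^sup>2) s" if "h \<in> double_coset p \<gamma>2" for h
    using double_coset_similitude_integral[OF _ _ that] I2_complete that by blast
qed (rule I2_double_coset)

end

section \<open>The action of a Hecke operator on Fourier coefficients\<close>

lemma automorphy_invertible:
  assumes g: "symplectic_similitude g 1" and z: "z \<in> siegel_H2"
  shows "invertible (automorphy_factor g z)"
proof (rule ccontr)
  assume ni: "\<not> invertible (automorphy_factor g z)"
  obtain A B C D where gb: "g = blk A B C D" by (rule blk_cases)
  obtain a1 a2 a3 a4 where A: "A = m2 a1 a2 a3 a4" by (rule m2_cases)
  obtain b1 b2 b3 b4 where B: "B = m2 b1 b2 b3 b4" by (rule m2_cases)
  obtain c1 c2 c3 c4 where C: "C = m2 c1 c2 c3 c4" by (rule m2_cases)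
  obtain d1 d2 d3 d4 where D: "D = m2 d1 d2 d3 d4" by (rule m2_cases)
  obtain a b c where z': "z = m2 a b b c" "pd (Im a) (Im b) (Im c)" using z by (auto simp: siegel_H2_iff H3_def)
  let ?r = "of_rat :: rat \<Rightarrow> complex"
  define q1 q2 q3 q4 where q: "q1 = ?r c1 * a + ?r c2 * b + ?r d1" "q2 = ?r c1 * b + ?r c2 * c + ?r d2"
    "q3 = ?r c3 * a + ?r c4 * b + ?r d3" "q4 = ?r c3 * b + ?r c4 * c + ?r d4"
  have "automorphy_factor g z = m2 q1 q2 q3 q4" by (simp add: automorphy_factor_def gb C D z' q)
  then have det: "q1 * q4 - q2 * q3 = 0" using ni by (simp add: m2_invertible_iff)
  \<comment> \<open>A nonzero row w with w (C z + D) = 0 gives u = w C and v = w D with v = - u z.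
    Symmetry of C D^T makes the Hermitian form of Im z vanish at u, so u = v = 0, and A D^T - B C^T
    = 1 then yields w = 0.\<close>
  obtain w1 w2 where w: "w1 \<noteq> 0 \<or> w2 \<noteq> 0" "w1 * q1 + w2 * q3 = 0" "w1 * q2 + w2 * q4 = 0"
  proof -
    consider "q1 \<noteq> 0 \<or> q3 \<noteq> 0" | "q2 \<noteq> 0 \<or> q4 \<noteq> 0" | "q1 = 0" "q2 = 0" "q3 = 0" "q4 = 0" by blast
    then show thesis
    proof cases
      case 1 then show ?thesis using det that[of q3 "- q1"] by (auto simp: algebra_simps)
    next
      case 2 then show ?thesis using det that[of q4 "- q2"] by (auto simp: algebra_simps)
    next
      case 3 then show ?thesis using that[of 1 0] by simp
    qed
  qed
  define u1 u2 v1 v2 where u: "u1 = w1 * ?r c1 + w2 * ?r c3" "u2 = w1 * ?r c2 + w2 * ?r c4"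
    "v1 = w1 * ?r d1 + w2 * ?r d3" "v2 = w1 * ?r d2 + w2 * ?r d4"
  have v: "v1 = - (u1 * a + u2 * b)" "v2 = - (u1 * b + u2 * c)"
  proof -
    have "v1 + (u1 * a + u2 * b) = w1 * q1 + w2 * q3" "v2 + (u1 * b + u2 * c) = w1 * q2 + w2 * q4"
      unfolding q u by (simp_all add: algebra_simps)
    then show "v1 = - (u1 * a + u2 * b)" "v2 = - (u1 * b + u2 * c)"
      unfolding w by (simp_all only: eq_neg_iff_add_eq_0)
  qed
  have sy: "c1 * d3 + c2 * d4 = d1 * c3 + d2 * c4" "a1*d1 + a2*d2 - (b1*c1 + b2*c2) = 1" "a1*d3 + a2*d4 - (b1*c3 + b2*c4) = 0"
     "a3*d1 + a4*d2 - (b3*c1 + b4*c2) = 0" "a3*d3 + a4*d4 - (b3*c3 + b4*c4) = 1"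
    using g unfolding gb A B C D symplectic_similitude_blk by blast+
  have cnjr: "cnj (?r x) = ?r x" for x by (simp add: of_real_of_rat[symmetric])
  have syc: "?r c1 * ?r d3 + ?r c2 * ?r d4 - (?r d1 * ?r c3 + ?r d2 * ?r c4) = 0"
    using arg_cong[OF sy(1), of ?r] by (simp add: of_rat_add of_rat_mult)
  have "u1 * cnj v1 + u2 * cnj v2 - (v1 * cnj u1 + v2 * cnj u2) =
     (w1 * cnj w2 - w2 * cnj w1) * (?r c1 * ?r d3 + ?r c2 * ?r d4 - (?r d1 * ?r c3 + ?r d2 * ?r c4))"
    unfolding u by (simp add: cnjr algebra_simps)
  then have "u1 * cnj v1 + u2 * cnj v2 - (v1 * cnj u1 + v2 * cnj u2) = 0" by (simp only: syc mult_zero_right)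
  then have "Im (u1 * cnj v1 + u2 * cnj v2 - (v1 * cnj u1 + v2 * cnj u2)) = 0" by simp
  then have h: "Im a * ((Re u1)\<^sup>2 + (Im u1)\<^sup>2) + 2 * Im b * (Re u1 * Re u2 + Im u1 * Im u2) + Im c * ((Re u2)\<^sup>2 + (Im u2)\<^sup>2) = 0"
    unfolding v by (simp add: algebra_simps power2_eq_square)
  have P: "Im a > 0" "Im a * Im c - (Im b)\<^sup>2 > 0" using z'(2) by (simp_all add: pd_iff)
  have "(Im a * Re u1 + Im b * Re u2)\<^sup>2 + (Im a * Im u1 + Im b * Im u2)\<^sup>2 + (Im a * Im c - (Im b)\<^sup>2) * ((Re u2)\<^sup>2 + (Im u2)\<^sup>2)
     = Im a * (Im a * ((Re u1)\<^sup>2 + (Im u1)\<^sup>2) + 2 * Im b * (Re u1 * Re u2 + Im u1 * Im u2) + Im c * ((Re u2)\<^sup>2 + (Im u2)\<^sup>2))"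
    by (simp add: algebra_simps power2_eq_square)
  also have "\<dots> = 0" unfolding h by simp
  finally have e: "(Im a * Re u1 + Im b * Re u2)\<^sup>2 + (Im a * Im u1 + Im b * Im u2)\<^sup>2 + (Im a * Im c - (Im b)\<^sup>2) * ((Re u2)\<^sup>2 + (Im u2)\<^sup>2) = 0" .
  have n3: "(Im a * Im c - (Im b)\<^sup>2) * ((Re u2)\<^sup>2 + (Im u2)\<^sup>2) \<ge> 0" using P by simp
  have "(Im a * Im c - (Im b)\<^sup>2) * ((Re u2)\<^sup>2 + (Im u2)\<^sup>2) = 0"
    using e n3 zero_le_power2[of "Im a * Re u1 + Im b * Re u2"] zero_le_power2[of "Im a * Im u1 + Im b * Im u2"] by linarith
  then have "(Re u2)\<^sup>2 + (Im u2)\<^sup>2 = 0" using P by simp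
  then have u20: "Re u2 = 0" "Im u2 = 0" by (simp_all add: sum_power2_eq_zero_iff)
  then have "Im a * ((Re u1)\<^sup>2 + (Im u1)\<^sup>2) = 0" using h by simp
  then have "(Re u1)\<^sup>2 + (Im u1)\<^sup>2 = 0" using P by simp
  then have u0: "u1 = 0" "u2 = 0" using u20 by (simp_all add: sum_power2_eq_zero_iff complex_eq_iff)
  then have v0: "v1 = 0" "v2 = 0" using v by simp_all
  have s2: "?r a1 * ?r d1 + ?r a2 * ?r d2 - (?r b1 * ?r c1 + ?r b2 * ?r c2) = 1" "?r a1 * ?r d3 + ?r a2 * ?r d4 - (?r b1 * ?r c3 + ?r b2 * ?r c4) = 0"
    "?r a3 * ?r d1 + ?r a4 * ?r d2 - (?r b3 * ?r c1 + ?r b4 * ?r c2) = 0" "?r a3 * ?r d3 + ?r a4 * ?r d4 - (?r b3 * ?r c3 + ?r b4 * ?r c4) = 1"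
    using arg_cong[OF sy(2), of ?r] arg_cong[OF sy(3), of ?r] arg_cong[OF sy(4), of ?r] arg_cong[OF sy(5), of ?r]
    by (simp_all add: of_rat_add of_rat_mult of_rat_diff)
  have "?r a1 * v1 + ?r a2 * v2 - (?r b1 * u1 + ?r b2 * u2) =
     w1 * (?r a1 * ?r d1 + ?r a2 * ?r d2 - (?r b1 * ?r c1 + ?r b2 * ?r c2)) + w2 * (?r a1 * ?r d3 + ?r a2 * ?r d4 - (?r b1 * ?r c3 + ?r b2 * ?r c4))"
    unfolding u by (simp add: algebra_simps)
  then have "w1 = 0" unfolding s2 using u0 v0 by simp
  have "?r a3 * v1 + ?r a4 * v2 - (?r b3 * u1 + ?r b4 * u2) =
     w1 * (?r a3 * ?r d1 + ?r a4 * ?r d2 - (?r b3 * ?r c1 + ?r b4 * ?r c2)) + w2 * (?r a3 * ?r d3 + ?r a4 * ?r d4 - (?r b3 * ?r c3 + ?r b4 * ?r c4))"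
    unfolding u by (simp add: algebra_simps)
  then have "w2 = 0" unfolding s2 using u0 v0 by simp
  with \<open>w1 = 0\<close> w(1) show False by simp
qed

lemma matrix_add_rdistrib:
  fixes A B :: "'a::semiring_1^'n^'m"
  shows "(A + B) ** C = A ** C + B ** C"
  by (simp add: matrix_matrix_mult_def vec_eq_iff sum.distrib distrib_right)

locale hecke_form = siegel_form N V \<rho> l1 l2 F + p_local p
  for N :: nat and V :: "(complex^'n) set" and \<rho> l1 l2 F p +
  assumes pN: "\<not> p dvd N" and eigen: "hecke_eigenform N \<rho> l1 l2 F" and p34: "p mod 4 = 3"
begin

text \<open>The connecting element \<open>k\<close> is \<open>\<delta>\<close> times the inverse of
  \<open>r\<close>, so its entries are integral away from \<open>p\<close>; lying in
  \<open>K\<close>, it is integral at \<open>p\<close> too. Divisibility of the lower left block by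
  \<open>N\<close> survives because \<open>N\<close> is a unit at \<open>p\<close>.\<close>

lemma left_coset_Gamma0:
  assumes r: "symplectic_similitude r (pr ^ e)" "r = blk A B 0 D" "\<And>i j. r $ i $ j \<in> Z_inverted p"
    and d: "\<delta> \<in> level_matrices p N" "\<delta> \<in> left_coset p r"
  obtains k where "k \<in> Gamma0 N" "\<delta> = k ** r"
proof -
  obtain k where k: "k \<in> K" "\<delta> = k ** r" using d(2) unfolding left_coset_def by blast
  let ?r = "blk (transpose D) (- transpose B) (- transpose 0) (transpose A)"
  have rr: "r ** ?r = mat (pr ^ e)" unfolding r(2) by (rule similitude_inverse) (use r in simp)
  have cm: "M ** mat u = mat u ** M" for M :: mat4 and u
    by (cases M rule: blk_cases) (simp add: blk_mat mat2_eq_iff mat_m2 zero_m2 mult_2x2)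
  have mm: "(mat u ** M) $ i $ j = u * M $ i $ j" for M :: mat4 and u i j
    by (simp add: matrix_matrix_mult_def mat_def if_distrib[of "\<lambda>x. x * _"] cong: if_cong)
  have "\<delta> ** ?r = k ** (r ** ?r)" unfolding k(2) by (simp only: matrix_mul_assoc)
  then have dk: "\<delta> ** ?r = mat (pr ^ e) ** k" unfolding rr cm .
  have ent: "k $ i $ j = (\<delta> ** ?r) $ i $ j * (1 / pr ^ e)" for i j unfolding dk mm by simp
  have dZ: "\<delta> $ i $ j \<in> Z_inverted p" for i j using d(1) by (simp add: level_matrices_def)
  have Zi_minus: "x \<in> Z_inverted p \<Longrightarrow> - x \<in> Z_inverted p" for x using Z_inverted_mult[OF Z_inverted_int[of "- 1"], of x] by simp
  have Zi0: "0 \<in> Z_inverted p" using Z_inverted_int[of 0] by simp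
  have rZ: "?r $ i $ j \<in> Z_inverted p" for i j
    using r(3)[of "Inl _" "Inl _"] r(3)[of "Inl _" "Inr _"] r(3)[of "Inr _" "Inr _"] Zi0
    unfolding r(2) by (cases i; cases j) (auto simp: transpose_def intro!: Zi_minus)
  have Zi_sum: "(\<And>x. x \<in> X \<Longrightarrow> f x \<in> Z_inverted p) \<Longrightarrow> sum f X \<in> Z_inverted p" for X :: "'a set" and f
    by (induction X rule: infinite_finite_induct) (auto simp: Zi0 intro: Z_inverted_add)
  have kint: "k $ i $ j \<in> \<int>" for i j
  proof (rule Zp_Z_inverted_int)
    show "k $ i $ j \<in> Zp" using K_integral[OF k(1)] by (simp add: integral_mat_def)
    have "(\<delta> ** ?r) $ i $ j \<in> Z_inverted p" unfolding matrix_matrix_mult_def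
      by (simp add: sum_sum_type) (intro Z_inverted_add Zi_sum Z_inverted_mult dZ rZ[of "Inl _" j, simplified] rZ[of "Inr _" j, simplified])
    then show "k $ i $ j \<in> Z_inverted p" unfolding ent by (intro Z_inverted_mult Z_inverted_pinv)
  qed
  have N0: "N \<noteq> 0" using pN by (intro notI) simp
  have kC: "\<exists>x\<in>\<int>. k $ Inr i $ Inl j = of_nat N * x" for i j
  proof -
    have "\<forall>a. \<exists>x\<in>Z_inverted p. \<delta> $ Inr i $ Inl a = of_nat N * x" using d(1) by (simp add: level_matrices_def)
    then obtain x where x: "\<And>a. x a \<in> Z_inverted p" "\<And>a. \<delta> $ Inr i $ Inl a = of_nat N * x a" by metis
    define y where "y = (\<Sum>a\<in>UNIV. x a * ?r $ Inl a $ Inl j) * (1 / pr ^ e)"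
    have yZ: "y \<in> Z_inverted p" unfolding y_def by (intro Z_inverted_mult Z_inverted_pinv Zi_sum x rZ)
    have "(\<delta> ** ?r) $ Inr i $ Inl j = (\<Sum>a\<in>UNIV. of_nat N * x a * ?r $ Inl a $ Inl j)"
      unfolding matrix_matrix_mult_def by (simp add: sum_sum_type x(2) transpose_def)
    then have ky: "k $ Inr i $ Inl j = of_nat N * y" unfolding ent y_def by (simp add: sum_distrib_left mult_ac)
    have "1 / of_nat N \<in> Zp" unfolding Zp_iff using pN by (intro exI[of _ 1] exI[of _ "int N"]) simp
    then have "k $ Inr i $ Inl j * (1 / of_nat N) \<in> Zp" using K_integral[OF k(1)] by (intro Zp_mult) (simp_all add: integral_mat_def)
    then have "y \<in> Zp" using N0 by (simp add: ky)
    then have "y \<in> \<int>" using yZ by (rule Zp_Z_inverted_int)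
    then show ?thesis using ky by blast
  qed
  have "k \<in> Gamma0 N" using k(1) kint kC unfolding Gamma0_def K_iff by simp
  then show ?thesis using that k(2) by blast
qed

text \<open>Modularity cancels the factor in \<open>Gamma0 N\<close>, so the value does not depend
  on the representative chosen in \<open>hecke_operator\<close>, and the triangular one makes the
  substitution affine in \<open>z\<close>.\<close>

lemma slash_left_coset:
  assumes r: "symplectic_similitude r (pr ^ e)" "r = blk A B 0 D" "\<And>i j. r $ i $ j \<in> Z_inverted p"
    and d: "\<delta> \<in> level_matrices p N" "\<delta> \<in> left_coset p r"
    and inv: "invertible (cm D)" and w: "w = (cm A ** z + cm B) ** matrix_inv (cm D)" "w \<in> siegel_H2"
  shows "slash \<rho> l1 l2 F \<delta> z = (of_nat p ^ e) powi (l1 + l2 - 3) *s (R (matrix_inv (cm D)) *v F w)"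
proof -
  obtain k where k: "k \<in> Gamma0 N" "\<delta> = k ** r" by (rule left_coset_Gamma0[OF r d])
  have ks: "symplectic_similitude k 1" using k(1) by (simp add: Gamma0_def)
  have "symplectic_similitude \<delta> (pr ^ e)" using symplectic_similitude_mult[OF ks r(1)] k(2) by simp
  then have mult: "multiplier \<delta> = pr ^ e" by (rule multiplier_eq)
  obtain A' B' C' D' where kb: "k = blk A' B' C' D'" by (rule blk_cases)
  let ?j = "automorphy_factor k w"
  have ji: "invertible ?j" by (rule automorphy_invertible[OF ks w(2)])
  have wD: "w ** cm D = cm A ** z + cm B"
    unfolding w(1) matrix_mul_assoc[symmetric] matrix_inv_both(2)[OF inv] by simp
  have j: "automorphy_factor \<delta> z = ?j ** cm D"
  proof -
    have "automorphy_factor \<delta> z = cm C' ** (cm A ** z + cm B) + cm D' ** cm D"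
      unfolding k(2) kb r(2) automorphy_factor_def
      by (simp add: cm_mult cm_add matrix_add_ldistrib matrix_mul_assoc add.assoc)
    also have "\<dots> = ?j ** cm D" unfolding wD[symmetric] automorphy_factor_def kb
      by (simp add: matrix_add_rdistrib matrix_mul_assoc)
    finally show ?thesis .
  qed
  have act: "siegel_act \<delta> z = siegel_act k w"
  proof -
    have "block_A \<delta> ** z + block_B \<delta> = cm A' ** (cm A ** z + cm B) + cm B' ** cm D"
      unfolding k(2) kb r(2)
      by (simp add: cm_mult cm_add matrix_add_ldistrib matrix_mul_assoc add.assoc)
    also have "\<dots> = (cm A' ** w + cm B') ** cm D" unfolding wD[symmetric]
      by (simp add: matrix_add_rdistrib matrix_mul_assoc)
    finally have "siegel_act \<delta> z = (cm A' ** w + cm B') ** (cm D ** matrix_inv (cm D)) ** matrix_inv ?j"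
      unfolding siegel_act_def j matrix_inv_mult[OF ji inv] by (simp only: matrix_mul_assoc)
    then show ?thesis unfolding matrix_inv_both(1)[OF inv] by (simp add: siegel_act_def kb)
  qed
  have inv': "invertible (matrix_inv (cm D))" "invertible (matrix_inv ?j)"
    using matrix_inv_unique(2)[OF matrix_inv_both(2)] inv ji by blast+
  have "\<rho> (matrix_inv (automorphy_factor \<delta> z)) (F (siegel_act \<delta> z)) =
     \<rho> (matrix_inv (cm D) ** matrix_inv ?j) (\<rho> ?j (F w))"
    unfolding act j matrix_inv_mult[OF ji inv] by (simp add: modular[OF k(1) w(2)])
  also have "\<dots> = \<rho> (matrix_inv (cm D)) (\<rho> (matrix_inv ?j) (\<rho> ?j (F w)))"
    by (rule rho_mult[OF inv' rho_V[OF ji F_V[OF w(2)]]])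
  also have "\<rho> (matrix_inv ?j) (\<rho> ?j (F w)) = F w"
    using rho_mult[OF inv'(2) ji F_V[OF w(2)]] by (simp add: matrix_inv_both(2)[OF ji] rho_1 F_V w(2))
  also have "\<rho> (matrix_inv (cm D)) (F w) = R (matrix_inv (cm D)) *v F w" using R_V[OF inv'(1) F_V[OF w(2)]] by simp
  finally show ?thesis unfolding slash_def mult by (simp add: of_rat_power)
qed

text \<open>For a coset index, these are D, its inverse, the symmetric X, and the frequency D T D^T
  / \<eta> of the coefficient of \<open>F\<close> that contributes to the coefficient at
  \<open>T\<close> of the slashed form.\<close>

definition idx_D :: "idx \<Rightarrow> rat^2^2" where "idx_D s = (case s of (d1, d3, d4, x1, x2, x3) \<Rightarrow> m2 d1 0 d3 d4)"
definition idx_D' :: "idx \<Rightarrow> rat^2^2" where "idx_D' s = (case s of (d1, d3, d4, x1, x2, x3) \<Rightarrow> m2 (1 / d1) 0 (- d3 / (d1 * d4)) (1 / d4))"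
definition idx_X :: "idx \<Rightarrow> rat^2^2" where "idx_X s = (case s of (d1, d3, d4, x1, x2, x3) \<Rightarrow> m2 x1 x2 x2 x3)"
definition idx_S :: "rat \<Rightarrow> idx \<Rightarrow> rat^2^2 \<Rightarrow> rat^2^2" where
  "idx_S \<eta> s T = mat (1 / \<eta>) ** idx_D s ** T ** transpose (idx_D s)"

abbreviation c :: "rat^2^2 \<Rightarrow> complex^'n" where "c \<equiv> fourier_coeff F"

text \<open>The contribution of one coset to the coefficient at \<open>T\<close>, without the power
  of the multiplier.\<close>

definition hterm :: "rat \<Rightarrow> idx \<Rightarrow> rat^2^2 \<Rightarrow> complex^'n" where
  "hterm \<eta> s T = R (cm (idx_D' s)) *v (ee (tr (idx_S \<eta> s T) (cm (idx_X s))) *s c (idx_S \<eta> s T))"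

definition idx_ok :: "idx \<Rightarrow> bool" where
  "idx_ok s = (case s of (d1, d3, d4, x1, x2, x3) \<Rightarrow> d1 \<in> range (\<lambda>n. pr ^ n) \<and> d4 \<in> range (\<lambda>n. pr ^ n) \<and> {d3, x1, x2, x3} \<subseteq> Z_inverted p)"

text \<open>The Hecke sum and the multiple of \<open>F\<close> by the eigenvalue both have explicit
  expansions, and uniqueness equates the coefficients. Frequencies outside the half-integral
  matrices occur in the single summands.\<close>

theorem hecke_coefficients:
  assumes cos: "left_coset p ` double_coset p \<gamma> = (\<lambda>s. left_coset p (rpt (pr ^ e) s)) ` I"
    and inj: "inj_on (\<lambda>s. left_coset p (rpt (pr ^ e) s)) I" and fin: "finite I" and ok: "\<And>s. s \<in> I \<Longrightarrow> idx_ok s"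
    and g: "symplectic_similitude \<gamma> (pr ^ e)"
  shows "\<exists>lam. \<forall>T. lam *s c T = (of_nat p ^ e) powi (l1 + l2 - 3) *s (\<Sum>s\<in>I. hterm (pr ^ e) s T)"
proof -
  let ?\<eta> = "pr ^ e" and ?q = "(of_nat p ^ e) powi (l1 + l2 - 3) :: complex"
  let ?w = "\<lambda>s z. cm (mat ?\<eta> ** transpose (idx_D' s)) ** z ** cm (transpose (transpose (idx_D' s))) + cm (idx_X s)"
  have exp: "expands F c" by (rule fourier_coeff_expands)
  have \<eta>: "?\<eta> > 0" by simp
  have DD: "idx_D s ** idx_D' s = mat 1" "idx_D' s ** idx_D s = mat 1" if "idx_ok s" for s
    using that by (auto simp: idx_ok_def idx_D_def idx_D'_def mat_m2)
  have tDD: "transpose (idx_D' s) ** transpose (idx_D s) = mat 1" if "idx_ok s" for s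
    using DD[OF that] by (simp add: matrix_transpose_mul[symmetric])
  have symX: "transpose (idx_X s) = idx_X s" for s by (auto simp: idx_X_def split: prod.splits)
  have wH: "?w s z \<in> siegel_H2" if "idx_ok s" "z \<in> siegel_H2" for s z
  proof (rule siegel_H2_affine[OF that(2) _ \<eta> symX])
    have "det (transpose (idx_D' s)) * det (transpose (idx_D s)) = 1" using arg_cong[OF tDD[OF that(1)], of det] by (simp add: det_mul)
    then show "det (transpose (idx_D' s)) \<noteq> 0" by auto
  qed
  have cmD: "cm (idx_D s) ** cm (idx_D' s) = mat 1" if "idx_ok s" for s
    using DD[OF that] by (simp add: cm_mult[symmetric] cm_mat)
  have sl: "slash \<rho> l1 l2 F (SOME \<delta>. \<delta> \<in> left_coset p (rpt ?\<eta> s) \<and> \<delta> \<in> level_matrices p N) z = ?q *s (R (cm (idx_D' s)) *v F (?w s z))"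
    if s: "s \<in> I" and z: "z \<in> siegel_H2" for s z
  proof -
    note oks = ok[OF s]
    obtain d1 d3 d4 x1 x2 x3 where st: "s = (d1, d3, d4, x1, x2, x3)" by (rule prod_cases6)
    obtain a b where ab: "d1 = pr ^ a" "d4 = pr ^ b" and xZ: "{d3, x1, x2, x3} \<subseteq> Z_inverted p" using oks by (auto simp: idx_ok_def st)
    let ?r = "rpt ?\<eta> s"
    have nz: "d1 \<noteq> 0" "d4 \<noteq> 0" by (simp_all add: ab)
    have sim: "symplectic_similitude ?r ?\<eta>" unfolding st rpt_def prod.case by (rule rp_similitude[OF nz])
    define A B where "A = mat ?\<eta> ** transpose (idx_D' s)" and "B = idx_X s ** idx_D s"
    have rb: "?r = blk A B 0 (idx_D s)"
      by (simp add: st rpt_def rp_def A_def B_def idx_D_def idx_D'_def idx_X_def mat_m2 zero_m2)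
    have pZ: "pr ^ n \<in> Z_inverted p" "1 / pr ^ n \<in> Z_inverted p" "0 \<in> Z_inverted p" for n
      using Z_inverted_int[of "int p ^ n"] Z_inverted_pinv[of n] Z_inverted_int[of 0] by simp_all
    have rZ: "?r $ i $ j \<in> Z_inverted p" for i j
    proof -
      have m: "- 1 \<in> Z_inverted p" using Z_inverted_int[of "- 1"] by simp
      have "pr ^ e * (1 / pr ^ a) \<in> Z_inverted p" "pr ^ e * (1 / pr ^ b) \<in> Z_inverted p" "- 1 * (pr ^ e * d3) * (1 / pr ^ (a + b)) \<in> Z_inverted p"
         "x1 * pr ^ a + x2 * d3 \<in> Z_inverted p" "x2 * pr ^ b \<in> Z_inverted p" "x2 * pr ^ a + x3 * d3 \<in> Z_inverted p" "x3 * pr ^ b \<in> Z_inverted p"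
        using xZ by (intro Z_inverted_add Z_inverted_mult pZ m; simp)+
      then have "\<forall>i j. ?r $ i $ j \<in> Z_inverted p"
        using xZ pZ unfolding st rpt_def prod.case rp_def ab by (simp add: all_sum_type forall_2 power_add)
      then show ?thesis by blast
    qed
    have "?r \<in> level_matrices p N"
      unfolding level_matrices_def
    proof (intro CollectI conjI allI)
      show "\<exists>k::int. symplectic_similitude ?r (pr powi k)" using sim by (intro exI[of _ "int e"]) simp
      show "?r $ i $ j \<in> Z_inverted p" for i j by (rule rZ)
      show "\<exists>x\<in>Z_inverted p. ?r $ Inr i $ Inl j = of_nat N * x" for i j
        unfolding rb using pZ(3) by (intro bexI[of _ 0]) simp_all
    qed
    moreover have "?r \<in> left_coset p ?r" unfolding left_coset_def using K_1 by (auto intro!: exI[of _ "mat 1"])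
    \<comment> \<open>The triangular matrix itself satisfies the level condition, so the choice in
      \<open>hecke_operator\<close> is never vacuous.\<close>
    ultimately have "\<exists>\<delta>. \<delta> \<in> left_coset p ?r \<and> \<delta> \<in> level_matrices p N" by blast
    from someI_ex[OF this] have \<delta>: "(SOME \<delta>. \<delta> \<in> left_coset p ?r \<and> \<delta> \<in> level_matrices p N) \<in> level_matrices p N"
       "(SOME \<delta>. \<delta> \<in> left_coset p ?r \<and> \<delta> \<in> level_matrices p N) \<in> left_coset p ?r" by blast+
    have iD: "invertible (cm (idx_D s))" "matrix_inv (cm (idx_D s)) = cm (idx_D' s)"
      using matrix_inv_unique[OF cmD[OF oks]] by blast+
    have w: "?w s z = (cm A ** z + cm B) ** matrix_inv (cm (idx_D s))"
    proof -
      have "cm B ** cm (idx_D' s) = cm (idx_X s)"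
        unfolding B_def cm_mult matrix_mul_assoc[symmetric] cmD[OF oks] by simp
      then show ?thesis unfolding iD(2) A_def by (simp add: matrix_add_rdistrib)
    qed
    show ?thesis
      using slash_left_coset[OF sim rb rZ \<delta> iD(1) w wH[OF oks z]] by (simp only: iD(2))
  qed
  have op: "hecke_operator p N \<rho> l1 l2 \<gamma> F z = (\<Sum>s\<in>I. ?q *s (R (cm (idx_D' s)) *v F (?w s z)))" if z: "z \<in> siegel_H2" for z
    unfolding hecke_operator_def cos sum.reindex[OF inj] o_def by (rule sum.cong[OF refl]) (rule sl[OF _ z])
  have "expands (\<lambda>z. \<Sum>s\<in>I. ?q *s (R (cm (idx_D' s)) *v F (?w s z))) (\<lambda>T. \<Sum>s\<in>I. ?q *s hterm ?\<eta> s T)"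
  proof (rule expands_sum[OF fin])
    fix s assume "s \<in> I"
    have "expands (\<lambda>z. F (?w s z)) (\<lambda>T. ee (tr (mat (1/?\<eta>) ** transpose (transpose (idx_D s)) ** T ** transpose (idx_D s)) (cm (idx_X s))) *s
        c (mat (1/?\<eta>) ** transpose (transpose (idx_D s)) ** T ** transpose (idx_D s)))"
      by (rule expands_subst[OF exp tDD[OF ok[OF \<open>s \<in> I\<close>]] \<eta> symX])
    from expands_smult[OF expands_matrix[OF this]]
    show "expands (\<lambda>z. ?q *s (R (cm (idx_D' s)) *v F (?w s z))) (\<lambda>T. ?q *s hterm ?\<eta> s T)"
      unfolding hterm_def idx_S_def transpose_transpose .
  qed
  then have e1: "expands (\<lambda>z. hecke_operator p N \<rho> l1 l2 \<gamma> F z) (\<lambda>T. \<Sum>s\<in>I. ?q *s hterm ?\<eta> s T)"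
    by (rule expands_cong) (simp add: op)
  have "\<exists>k::int. symplectic_similitude \<gamma> (pr powi k)" using g by (intro exI[of _ "int e"]) simp
  then obtain a where lam: "\<And>z. z \<in> siegel_H2 \<Longrightarrow> hecke_operator p N \<rho> l1 l2 \<gamma> F z = a *s F z"
    using eigen prime_p pN unfolding hecke_eigenform_def by blast
  have "expands (\<lambda>z. hecke_operator p N \<rho> l1 l2 \<gamma> F z) (\<lambda>T. a *s c T)"
    by (rule expands_cong[OF expands_smult[OF exp]]) (simp add: lam)
  from expands_unique[OF this e1] have "a *s c T = (\<Sum>s\<in>I. ?q *s hterm ?\<eta> s T)" for T by (rule fun_cong)
  then show ?thesis by (intro exI[of _ a]) (simp add: vec.scale_sum_right)
qed

section \<open>Relations between the coefficients at scalar matrices\<close>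

lemma not_dvd_sum_squares: "\<not> p dvd y\<^sup>2 + 1"
proof
  assume d: "p dvd y\<^sup>2 + 1"
  have ny: "\<not> p dvd y"
  proof
    assume "p dvd y"
    then have "p dvd y\<^sup>2" by (simp add: power2_eq_square)
    then have "p dvd 1" using d by (simp only: dvd_add_right_iff)
    then show False using p_nz by simp
  qed
  \<comment> \<open>By Fermat's theorem, -1 being a square modulo \<open>p\<close> would give 1 =
    (-1)^m, but \<open>m\<close> is odd for \<open>p\<close> congruent to 3 modulo 4.\<close>
  define m where "m = (p - 1) div 2"
  have "p = 4 * (p div 4) + 3" using p34 div_mult_mod_eq[of p 4] by simp
  then have m: "p - 1 = 2 * m" "odd m" unfolding m_def by presburger+
  have "[int y ^ (p - 1) = 1] (mod int p)"
    using fermat_theorem[OF prime_p ny] by (metis cong_int_iff of_nat_1 of_nat_power)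
  moreover have "[(int y)\<^sup>2 = - 1] (mod int p)"
  proof -
    have "int p dvd int (y\<^sup>2 + 1)" using d by (simp only: of_nat_dvd_iff)
    then show ?thesis by (simp add: cong_iff_dvd_diff add.commute)
  qed
  then have "[((int y)\<^sup>2) ^ m = (- 1) ^ m] (mod int p)" by (rule cong_pow)
  then have "[int y ^ (p - 1) = - 1] (mod int p)" using m by (simp add: power_mult)
  ultimately have "[1 = - 1] (mod int p)" using cong_sym cong_trans by blast
  then have "int p dvd 2" by (simp add: cong_iff_dvd_diff)
  then have "p \<le> 2" using zdvd_imp_le[of "int p" 2] by simp
  then show False using p34 p_nz(3) by simp
qed

lemma ee_rat_int: "x \<in> \<int> \<Longrightarrow> ee (of_rat x) = 1"
  by (auto elim!: Ints_cases)

lemma c_V: "c S \<in> V" by (rule expands_F_V[OF fourier_coeff_expands])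

lemma hterm_mat:
  "hterm \<eta> (d1, d3, d4, x1, x2, x3) (mat t) =
    ee (of_rat (t / \<eta> * (d1\<^sup>2 * x1 + 2 * (d1 * d3) * x2 + (d3\<^sup>2 + d4\<^sup>2) * x3))) *s
     (R (cm (m2 (1 / d1) 0 (- d3 / (d1 * d4)) (1 / d4))) *v
      c (m2 (t / \<eta> * d1\<^sup>2) (t / \<eta> * (d1 * d3)) (t / \<eta> * (d1 * d3)) (t / \<eta> * (d3\<^sup>2 + d4\<^sup>2))))"
proof -
  have S: "idx_S \<eta> (d1, d3, d4, x1, x2, x3) (mat t) = m2 (t / \<eta> * d1\<^sup>2) (t / \<eta> * (d1 * d3)) (t / \<eta> * (d1 * d3)) (t / \<eta> * (d3\<^sup>2 + d4\<^sup>2))"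
    by (simp add: idx_S_def idx_D_def mat_m2 power2_eq_square distrib_left mult_ac)
  have "tr (m2 (t / \<eta> * d1\<^sup>2) (t / \<eta> * (d1 * d3)) (t / \<eta> * (d1 * d3)) (t / \<eta> * (d3\<^sup>2 + d4\<^sup>2))) (cm (m2 x1 x2 x2 x3)) =
    of_rat (t / \<eta> * (d1\<^sup>2 * x1 + 2 * (d1 * d3) * x2 + (d3\<^sup>2 + d4\<^sup>2) * x3))"
    by (simp add: of_rat_mult[symmetric] of_rat_add[symmetric] algebra_simps)
  then show ?thesis unfolding hterm_def S by (simp add: idx_X_def idx_D'_def vector_scalar_commute)
qed

text \<open>The scalar by which \<open>\<rho>\<close> acts at 1 / p, by
  \<open>scalar_action\<close>.\<close>

abbreviation pl :: complex where "pl \<equiv> (1 / of_nat p) powi (l1 + l2)"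

lemma R_scale:
  assumes "invertible (cm M)" shows "R (cm (mat (1 / pr) ** M)) *v c S = pl *s (R (cm M) *v c S)"
proof -
  have p0: "1 / of_nat p \<noteq> (0::complex)" by simp
  have m: "cm (mat (1 / pr)) = mat (1 / of_nat p)" by (simp add: cm_mat of_rat_divide)
  have i1: "invertible (mat (1 / of_nat p) :: complex^2^2)" by (simp add: mat_m2 m2_invertible_iff)
  have i2: "invertible (mat (1 / of_nat p) ** cm M)" using i1 assms by (rule invertible_mult)
  have "R (cm (mat (1 / pr) ** M)) *v c S = \<rho> (mat (1 / of_nat p) ** cm M) (c S)"
    unfolding cm_mult m by (rule R_V[OF i2 c_V])
  also have "\<dots> = pl *s \<rho> (cm M) (c S)"
    unfolding rho_mult[OF i1 assms c_V] by (rule scalar_action[OF p0 rho_V[OF assms c_V]])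
  finally show ?thesis by (simp only: R_V[OF assms c_V])
qed

lemma R_1: "R (cm (m2 1 0 0 1)) *v c S = c S"
proof -
  have "invertible (m2 1 0 0 1 :: complex^2^2)" by (simp add: m2_invertible_iff)
  from R_V[OF this c_V] show ?thesis by (simp add: rho_1[OF c_V, unfolded mat_m2])
qed

lemma R_p: "R (cm (m2 (1 / pr) 0 0 (1 / pr))) *v c S = pl *s c S"
proof -
  have "mat (1 / pr) ** m2 1 0 0 1 = m2 (1 / pr) 0 0 (1 / pr)" by (simp add: mat_m2)
  moreover have "invertible (cm (m2 1 0 0 1))" by (simp add: m2_invertible_iff)
  ultimately show ?thesis using R_scale[of "m2 1 0 0 1" S] by (simp only: R_1)
qed

text \<open>\<open>\<beta> t\<close> sums the inverse of \<rho>(D) applied to the coefficient at t D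
  D^T over the p + 1 representatives D of the lattices of index \<open>p\<close>:
  \<open>\<beta>1\<close> belongs to diag(1, p), and \<open>\<beta>2\<close> to the matrix with rows
  (p, 0), (y, 1).\<close>

definition \<beta>1 :: "rat \<Rightarrow> complex^'n" where
  "\<beta>1 t = R (cm (m2 1 0 0 (1 / pr))) *v c (m2 t 0 0 (t * pr\<^sup>2))"
definition \<beta>2 :: "rat \<Rightarrow> nat \<Rightarrow> complex^'n" where
  "\<beta>2 t y = R (cm (m2 (1 / pr) 0 (- of_nat y / pr) 1)) *v c (m2 (t * pr\<^sup>2) (t * (pr * of_nat y)) (t * (pr * of_nat y)) (t * ((of_nat y)\<^sup>2 + 1)))"
definition \<beta> :: "rat \<Rightarrow> complex^'n" where "\<beta> t = \<beta>1 t + (\<Sum>y<p. \<beta>2 t y)"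

lemma pr_sq: "pr\<^sup>2 = pr * pr" by (rule power2_eq_square)

text \<open>At scalar matrices all exponentials for this double coset are trivial, so cosets with
  the same D contribute equally.\<close>

lemma I1_terms:
  "hterm pr (1, 0, 1, 0, 0, 0) (mat (pr ^ j)) = c (mat (pr ^ j / pr))"
  "hterm pr (1, 0, pr, 0, 0, of_nat n / pr) (mat (pr ^ j)) = \<beta>1 (pr ^ j / pr)"
  "hterm pr (pr, of_nat y, 1, of_nat n / pr, 0, 0) (mat (pr ^ j)) = \<beta>2 (pr ^ j / pr) y"
  "hterm pr (pr, 0, pr, of_nat n1 / pr, of_nat n2 / pr, of_nat n3 / pr) (mat (pr ^ j)) = pl *s c (mat (pr ^ Suc j))"
proof -
  have i: "pr ^ j * of_nat n \<in> \<int>" for n by simp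
  show "hterm pr (1, 0, 1, 0, 0, 0) (mat (pr ^ j)) = c (mat (pr ^ j / pr))"
    unfolding hterm_mat using R_1 by (simp add: mat_m2)
  show "hterm pr (1, 0, pr, 0, 0, of_nat n / pr) (mat (pr ^ j)) = \<beta>1 (pr ^ j / pr)"
    using ee_rat_int[OF i, of n] unfolding hterm_mat \<beta>1_def by (simp add: pr_sq)
  show "hterm pr (pr, of_nat y, 1, of_nat n / pr, 0, 0) (mat (pr ^ j)) = \<beta>2 (pr ^ j / pr) y"
    using ee_rat_int[OF i, of n] unfolding hterm_mat \<beta>2_def by (simp add: pr_sq)
  have "ee (of_rat (pr ^ j / pr * (pr\<^sup>2 * (of_nat n1 / pr) + 2 * (pr * 0) * (of_nat n2 / pr) + (0\<^sup>2 + pr\<^sup>2) * (of_nat n3 / pr)))) = 1"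
  proof -
    have "pr ^ j / pr * (pr\<^sup>2 * (of_nat n1 / pr) + 2 * (pr * 0) * (of_nat n2 / pr) + (0\<^sup>2 + pr\<^sup>2) * (of_nat n3 / pr)) = pr ^ j * of_nat n1 + pr ^ j * of_nat n3"
      by (simp add: pr_sq field_simps)
    then show ?thesis using ee_rat_int[OF Ints_add[OF i i], of n1 n3] by simp
  qed
  then show "hterm pr (pr, 0, pr, of_nat n1 / pr, of_nat n2 / pr, of_nat n3 / pr) (mat (pr ^ j)) = pl *s c (mat (pr ^ Suc j))"
  proof -
    assume e: "ee (of_rat (pr ^ j / pr * (pr\<^sup>2 * (of_nat n1 / pr) + 2 * (pr * 0) * (of_nat n2 / pr) + (0\<^sup>2 + pr\<^sup>2) * (of_nat n3 / pr)))) = 1"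
    have S: "pr ^ j / pr * pr\<^sup>2 = pr ^ Suc j" "pr ^ j / pr * (0\<^sup>2 + pr\<^sup>2) = pr ^ Suc j" "pr ^ j / pr * (pr * 0) = 0"
      by (simp_all add: pr_sq)
    have D: "- 0 / (pr * pr) = 0" by simp
    have m: "m2 (pr ^ Suc j) 0 0 (pr ^ Suc j) = mat (pr ^ Suc j)" by (simp add: mat_m2)
    show ?thesis unfolding hterm_mat e by (simp only: S D m R_p vec.scale_one)
  qed
qed

lemma sum_image_const:
  fixes h :: "'a \<Rightarrow> complex"
  assumes "inj_on f S" "\<And>x. x \<in> S \<Longrightarrow> h (f x) = v"
  shows "sum h (f ` S) = of_nat (card S) * v"
proof -
  have "sum h (f ` S) = (\<Sum>x\<in>S. v)"
    unfolding sum.reindex[OF assms(1)] o_def by (rule sum.cong[OF refl assms(2)])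
  then show ?thesis by simp
qed

lemma I1_sum:
  "(\<Sum>s\<in>I1. hterm pr s (mat (pr ^ j)) $ i) = c (mat (pr ^ j / pr)) $ i + of_nat p * \<beta> (pr ^ j / pr) $ i
     + of_nat p ^ 3 * pl * c (mat (pr ^ Suc j)) $ i"
proof -
  let ?h = "\<lambda>s. hterm pr s (mat (pr ^ j)) $ i"
  let ?A = "{(1, 0, 1, 0, 0, 0)} :: idx set" and ?B = "(\<lambda>n. (1, 0, pr, 0, 0, of_nat n / pr)) ` {..<p} :: idx set"
    and ?C = "(\<lambda>(y, n). (pr, of_nat y, 1, of_nat n / pr, 0, 0)) ` ({..<p} \<times> {..<p}) :: idx set"
    and ?D = "(\<lambda>(n1, n2, n3). (pr, 0, pr, of_nat n1 / pr, of_nat n2 / pr, of_nat n3 / pr)) ` ({..<p} \<times> {..<p} \<times> {..<p}) :: idx set"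
  have B: "sum ?h ?B = of_nat p * \<beta>1 (pr ^ j / pr) $ i"
    by (subst sum.reindex) (auto simp: inj_on_def I1_terms)
  have C: "sum ?h ?C = of_nat p * (\<Sum>y<p. \<beta>2 (pr ^ j / pr) y $ i)"
  proof -
    have "sum ?h ?C = (\<Sum>(y, n)\<in>{..<p} \<times> {..<p}. \<beta>2 (pr ^ j / pr) y $ i)"
      by (subst sum.reindex) (auto simp: inj_on_def I1_terms case_prod_beta intro!: sum.cong)
    also have "\<dots> = (\<Sum>y<p. \<Sum>n<p. \<beta>2 (pr ^ j / pr) y $ i)" by (rule sum.cartesian_product[symmetric])
    finally show ?thesis by (simp add: sum_distrib_left)
  qed
  have D: "sum ?h ?D = of_nat p ^ 3 * (pl * c (mat (pr ^ Suc j)) $ i)"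
  proof -
    have "sum ?h ?D = of_nat (card ({..<p} \<times> {..<p} \<times> {..<p})) * (pl * c (mat (pr ^ Suc j)) $ i)"
      by (rule sum_image_const) (auto simp: inj_on_def I1_terms simp del: power_Suc)
    then show ?thesis by (simp add: power3_eq_cube mult.assoc del: power_Suc)
  qed
  have "sum ?h I1 = sum ?h ?A + sum ?h ?B + sum ?h ?C + sum ?h ?D"
    unfolding I1_def by (subst sum.union_disjoint, simp, simp, force)+ simp
  then show ?thesis unfolding B C D by (simp add: I1_terms \<beta>_def sum_component distrib_left mult.assoc del: power_Suc)
qed

text \<open>In the third and fourth families D is \<open>p\<close> times a matrix of determinant
  \<open>p\<close>, which brings in the central character. Only the families with D equal to
  \<open>p\<close> times the identity keep an exponential.\<close>

lemma I2_terms: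
  "hterm (pr\<^sup>2) (1, 0, pr, 0, 0, 0) (mat (pr ^ j)) = \<beta>1 (pr ^ j / pr\<^sup>2)"
  "hterm (pr\<^sup>2) (pr, of_nat y, 1, 0, 0, 0) (mat (pr ^ j)) = \<beta>2 (pr ^ j / pr\<^sup>2) y"
  "hterm (pr\<^sup>2) (pr, 0, pr\<^sup>2, 0, of_nat n2 / pr, of_nat n3 / pr\<^sup>2) (mat (pr ^ j)) = pl *s \<beta>1 (pr ^ j)"
  "hterm (pr\<^sup>2) (pr\<^sup>2, pr * of_nat y, pr, of_nat n1 / pr\<^sup>2, of_nat n2 / pr, 0) (mat (pr ^ j)) = pl *s \<beta>2 (pr ^ j) y"
  "hterm (pr\<^sup>2) (pr, 0, pr, of_nat e / pr, of_nat e * of_nat y / pr, of_nat e * (of_nat y)\<^sup>2 / pr) (mat (pr ^ j)) =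
     (ee (of_rat (pr ^ j * of_nat (e * (1 + y\<^sup>2)) / pr)) * pl) *s c (mat (pr ^ j))"
  "hterm (pr\<^sup>2) (pr, 0, pr, 0, 0, of_nat e / pr) (mat (pr ^ j)) = (ee (of_rat (pr ^ j * of_nat e / pr)) * pl) *s c (mat (pr ^ j))"
proof -
  have i: "pr ^ j * of_nat n \<in> \<int>" for n by simp
  show "hterm (pr\<^sup>2) (1, 0, pr, 0, 0, 0) (mat (pr ^ j)) = \<beta>1 (pr ^ j / pr\<^sup>2)"
    unfolding hterm_mat \<beta>1_def by simp
  show "hterm (pr\<^sup>2) (pr, of_nat y, 1, 0, 0, 0) (mat (pr ^ j)) = \<beta>2 (pr ^ j / pr\<^sup>2) y"
    unfolding hterm_mat \<beta>2_def by simp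
  show "hterm (pr\<^sup>2) (pr, 0, pr\<^sup>2, 0, of_nat n2 / pr, of_nat n3 / pr\<^sup>2) (mat (pr ^ j)) = pl *s \<beta>1 (pr ^ j)"
  proof -
    have "mat (1 / pr) ** m2 1 0 0 (1 / pr) = m2 (1 / pr) 0 (- 0 / (pr * pr\<^sup>2)) (1 / pr\<^sup>2)" by (simp add: mat_m2 pr_sq)
    moreover have "invertible (cm (m2 1 0 0 (1 / pr)))" by (simp add: m2_invertible_iff)
    moreover have "pr ^ j / pr\<^sup>2 * (pr\<^sup>2 * 0 + 2 * (pr * 0) * (of_nat n2 / pr) + (0\<^sup>2 + (pr\<^sup>2)\<^sup>2) * (of_nat n3 / pr\<^sup>2)) = pr ^ j * of_nat n3"
      by (simp add: power2_eq_square)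
    moreover have "pr ^ j / pr\<^sup>2 * (0\<^sup>2 + (pr\<^sup>2)\<^sup>2) = pr ^ j * pr\<^sup>2" "pr ^ j / pr\<^sup>2 * pr\<^sup>2 = pr ^ j" by (simp_all add: power2_eq_square)
    ultimately show ?thesis unfolding hterm_mat \<beta>1_def
      using ee_rat_int[OF i, of n3] R_scale[of "m2 1 0 0 (1 / pr)"] by simp
  qed
  show "hterm (pr\<^sup>2) (pr\<^sup>2, pr * of_nat y, pr, of_nat n1 / pr\<^sup>2, of_nat n2 / pr, 0) (mat (pr ^ j)) = pl *s \<beta>2 (pr ^ j) y"
  proof -
    have "mat (1 / pr) ** m2 (1 / pr) 0 (- of_nat y / pr) 1 = m2 (1 / pr\<^sup>2) 0 (- (pr * of_nat y) / (pr\<^sup>2 * pr)) (1 / pr)"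
      by (simp add: mat_m2 pr_sq)
    moreover have "invertible (cm (m2 (1 / pr) 0 (- of_nat y / pr) 1))" by (simp add: m2_invertible_iff)
    moreover have "pr ^ j / pr\<^sup>2 * ((pr\<^sup>2)\<^sup>2 * (of_nat n1 / pr\<^sup>2) + 2 * (pr\<^sup>2 * (pr * of_nat y)) * (of_nat n2 / pr) + ((pr * of_nat y)\<^sup>2 + pr\<^sup>2) * 0)
       = pr ^ j * of_nat (n1 + 2 * y * n2)"
      by (simp add: pr_sq field_simps)
    moreover have "pr ^ j / pr\<^sup>2 * (pr\<^sup>2)\<^sup>2 = pr ^ j * pr\<^sup>2" "pr ^ j / pr\<^sup>2 * (pr\<^sup>2 * (pr * of_nat y)) = pr ^ j * (pr * of_nat y)"
       "pr ^ j / pr\<^sup>2 * ((pr * of_nat y)\<^sup>2 + pr\<^sup>2) = pr ^ j * ((of_nat y)\<^sup>2 + 1)"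
      by (simp_all add: power2_eq_square field_simps)
    ultimately show ?thesis unfolding hterm_mat \<beta>2_def
      using ee_rat_int[OF i, of "n1 + 2 * y * n2"] R_scale[of "m2 (1 / pr) 0 (- of_nat y / pr) 1"] by (simp only: vec.scale_one)
  qed
  have S: "pr ^ j / pr\<^sup>2 * pr\<^sup>2 = pr ^ j" "pr ^ j / pr\<^sup>2 * (0\<^sup>2 + pr\<^sup>2) = pr ^ j" "pr ^ j / pr\<^sup>2 * (pr * 0) = 0" by simp_all
  have D: "- 0 / (pr * pr) = 0" by simp
  have m: "m2 (pr ^ j) 0 0 (pr ^ j) = mat (pr ^ j)" by (simp add: mat_m2)
  have "pr ^ j / pr\<^sup>2 * (pr\<^sup>2 * (of_nat e / pr) + 2 * (pr * 0) * (of_nat e * of_nat y / pr) + (0\<^sup>2 + pr\<^sup>2) * (of_nat e * (of_nat y)\<^sup>2 / pr))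
     = pr ^ j * of_nat (e * (1 + y\<^sup>2)) / pr"
    by (simp add: pr_sq field_simps)
  then show "hterm (pr\<^sup>2) (pr, 0, pr, of_nat e / pr, of_nat e * of_nat y / pr, of_nat e * (of_nat y)\<^sup>2 / pr) (mat (pr ^ j)) =
     (ee (of_rat (pr ^ j * of_nat (e * (1 + y\<^sup>2)) / pr)) * pl) *s c (mat (pr ^ j))"
    unfolding hterm_mat by (simp only: S D m R_p vec.scale_scale)
  have "pr ^ j / pr\<^sup>2 * (pr\<^sup>2 * 0 + 2 * (pr * 0) * 0 + (0\<^sup>2 + pr\<^sup>2) * (of_nat e / pr)) = pr ^ j * of_nat e / pr"
    by (simp add: pr_sq field_simps)
  then show "hterm (pr\<^sup>2) (pr, 0, pr, 0, 0, of_nat e / pr) (mat (pr ^ j)) = (ee (of_rat (pr ^ j * of_nat e / pr)) * pl) *s c (mat (pr ^ j))"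
    unfolding hterm_mat by (simp only: S D m R_p vec.scale_scale)
qed

text \<open>Sum of exp(2 pi i p^j tr X) over the matrices X of the last two families of
  \<open>I2\<close>.\<close>

definition G :: "nat \<Rightarrow> complex" where
  "G j = (\<Sum>y<p. \<Sum>e=1..<p. ee (of_rat (pr ^ j * of_nat (e * (1 + y\<^sup>2)) / pr))) + (\<Sum>e=1..<p. ee (of_rat (pr ^ j * of_nat e / pr)))"

lemma I2_sum:
  "(\<Sum>s\<in>I2. hterm (pr\<^sup>2) s (mat (pr ^ j)) $ i) = \<beta> (pr ^ j / pr\<^sup>2) $ i + of_nat p ^ 3 * pl * \<beta> (pr ^ j) $ i + G j * pl * c (mat (pr ^ j)) $ i"
proof -
  let ?h = "\<lambda>s. hterm (pr\<^sup>2) s (mat (pr ^ j)) $ i"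
  let ?A = "{(1, 0, pr, 0, 0, 0)} :: idx set" and ?B = "(\<lambda>y. (pr, of_nat y, 1, 0, 0, 0)) ` {..<p} :: idx set"
    and ?C = "(\<lambda>(n2, n3). (pr, 0, pr\<^sup>2, 0, of_nat n2 / pr, of_nat n3 / pr\<^sup>2)) ` ({..<p} \<times> {..<p\<^sup>2}) :: idx set"
    and ?D = "(\<lambda>(y, n1, n2). (pr\<^sup>2, pr * of_nat y, pr, of_nat n1 / pr\<^sup>2, of_nat n2 / pr, 0)) ` ({..<p} \<times> {..<p\<^sup>2} \<times> {..<p}) :: idx set"
    and ?E = "(\<lambda>(e, y). (pr, 0, pr, of_nat e / pr, of_nat e * of_nat y / pr, of_nat e * (of_nat y)\<^sup>2 / pr)) ` ({1..<p} \<times> {..<p}) :: idx set"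
    and ?F = "(\<lambda>e. (pr, 0, pr, 0, 0, of_nat e / pr)) ` {1..<p} :: idx set"
  have B: "sum ?h ?B = (\<Sum>y<p. \<beta>2 (pr ^ j / pr\<^sup>2) y $ i)"
    by (subst sum.reindex) (auto simp: inj_on_def I2_terms)
  have C: "sum ?h ?C = of_nat p ^ 3 * (pl * \<beta>1 (pr ^ j) $ i)"
  proof -
    have "sum ?h ?C = of_nat (card ({..<p} \<times> {..<p\<^sup>2})) * (pl * \<beta>1 (pr ^ j) $ i)"
      by (rule sum_image_const) (auto simp: inj_on_def I2_terms)
    then show ?thesis by (simp add: power3_eq_cube power2_eq_square mult.assoc)
  qed
  have D: "sum ?h ?D = of_nat p ^ 3 * (pl * (\<Sum>y<p. \<beta>2 (pr ^ j) y $ i))"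
  proof -
    have "sum ?h ?D = (\<Sum>(y, q)\<in>{..<p} \<times> {..<p\<^sup>2} \<times> {..<p}. pl * \<beta>2 (pr ^ j) y $ i)"
      by (subst sum.reindex) (auto simp: inj_on_def I2_terms case_prod_beta intro!: sum.cong)
    also have "\<dots> = (\<Sum>y<p. \<Sum>q\<in>{..<p\<^sup>2} \<times> {..<p}. pl * \<beta>2 (pr ^ j) y $ i)" by (rule sum.cartesian_product[symmetric])
    finally show ?thesis by (simp add: sum_distrib_left power3_eq_cube power2_eq_square mult.assoc)
  qed
  have E: "sum ?h ?E = (\<Sum>y<p. \<Sum>e=1..<p. ee (of_rat (pr ^ j * of_nat (e * (1 + y\<^sup>2)) / pr))) * (pl * c (mat (pr ^ j)) $ i)"
  proof -
    have "sum ?h ?E = (\<Sum>(e, y)\<in>{1..<p} \<times> {..<p}. ee (of_rat (pr ^ j * of_nat (e * (1 + y\<^sup>2)) / pr)) * pl * c (mat (pr ^ j)) $ i)"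
      by (subst sum.reindex) (auto simp: inj_on_def I2_terms simp del: of_nat_mult of_nat_add intro!: sum.cong)
    also have "\<dots> = (\<Sum>e=1..<p. \<Sum>y<p. ee (of_rat (pr ^ j * of_nat (e * (1 + y\<^sup>2)) / pr)) * pl * c (mat (pr ^ j)) $ i)" by (rule sum.cartesian_product[symmetric])
    also have "\<dots> = (\<Sum>y<p. \<Sum>e=1..<p. ee (of_rat (pr ^ j * of_nat (e * (1 + y\<^sup>2)) / pr)) * pl * c (mat (pr ^ j)) $ i)" by (rule sum.swap)
    finally show ?thesis by (simp only: sum_distrib_right mult.assoc)
  qed
  have F: "sum ?h ?F = (\<Sum>e=1..<p. ee (of_rat (pr ^ j * of_nat e / pr))) * (pl * c (mat (pr ^ j)) $ i)"
    unfolding sum_distrib_right by (subst sum.reindex) (auto simp: inj_on_def I2_terms intro!: sum.cong)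
  have "sum ?h I2 = sum ?h ?A + sum ?h ?B + sum ?h ?C + sum ?h ?D + sum ?h ?E + sum ?h ?F"
  proof -
    have pp: "p \<noteq> p\<^sup>2" using pr_distinct(3) of_nat_power[of p 2, where 'a = rat] by (intro notI) simp
    have d: "(?A \<union> ?B \<union> ?C \<union> ?D \<union> ?E) \<inter> ?F = {}" "(?A \<union> ?B \<union> ?C \<union> ?D) \<inter> ?E = {}" "(?A \<union> ?B \<union> ?C) \<inter> ?D = {}"
      "(?A \<union> ?B) \<inter> ?C = {}" "?A \<inter> ?B = {}" using pp by auto
    have f: "finite ?A" "finite ?B" "finite ?C" "finite ?D" "finite ?E" "finite ?F" by simp_all
    note u = sum.union_disjoint[of _ _ ?h]
    show ?thesis unfolding I2_def
      by (simp only: u[OF _ f(6) d(1)] u[OF _ f(5) d(2)] u[OF _ f(4) d(3)] u[OF _ f(3) d(4)] u[OF f(1) f(2) d(5)] finite_UnI f)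
  qed
  then show ?thesis unfolding B C D E F by (simp add: I2_terms \<beta>_def G_def sum_component distrib_left distrib_right mult.assoc)
qed

text \<open>The full geometric sum over the powers of a nontrivial \<open>p\<close>-th root of unity
  vanishes; omitting the exponent 0 leaves -1.\<close>

lemma root_of_unity_sum:
  assumes "\<not> p dvd m" shows "(\<Sum>e=1..<p. ee (of_rat (of_nat (e * m) / pr))) = - 1"
proof -
  define w where "w = ee (of_rat (of_nat m / pr))"
  have we: "ee (of_rat (of_nat (e * m) / pr)) = w ^ e" for e
  proof (induction e)
    case (Suc e)
    have "of_nat (Suc e * m) / pr = of_nat m / pr + of_nat (e * m) / pr" by (simp add: field_simps)
    then have "ee (of_rat (of_nat (Suc e * m) / pr)) = w * ee (of_rat (of_nat (e * m) / pr))"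
      unfolding w_def ee_add[symmetric] of_rat_add[symmetric] by simp
    then show ?case using Suc by simp
  qed simp
  have "w \<noteq> 1"
  proof
    assume "w = 1"
    then have "ee (of_real (real_of_rat (of_nat m / pr))) = ee (of_real 0)" by (simp add: w_def of_real_of_rat)
    then obtain k where "real_of_rat (of_nat m / pr) = of_int k" unfolding ee_eq_iff by auto
    then have "real m = of_int k * real p" by (simp add: of_rat_divide field_simps)
    then have "real_of_int (int m) = real_of_int (k * int p)" by simp
    then have "int m = k * int p" by (simp only: of_int_eq_iff)
    then have "int p dvd int m" by simp
    then show False using assms by (simp only: of_nat_dvd_iff)
  qed
  moreover have "w ^ p = 1" using we[of p] ee_rat_int[of "of_nat m"] by simp
  ultimately have z: "(\<Sum>e<p. w ^ e) = 0" using sum_gp_strict[of w p] by simp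
  have "{..<p} = insert 0 {1..<p}" using p_nz by auto
  then have "(\<Sum>e<p. w ^ e) = 1 + (\<Sum>e=1..<p. w ^ e)" by simp
  then have "(\<Sum>e=1..<p. w ^ e) = - 1" using z by (simp add: eq_neg_iff_add_eq_0 add.commute)
  then show ?thesis by (simp only: we)
qed

text \<open>Since \<open>p\<close> divides no 1 + y^2, each of the p + 1 sums over nonzero residues
  equals -1.\<close>

lemma G_0: "G 0 = - (of_nat p + 1)"
proof -
  have "(\<Sum>e=1..<p. ee (of_rat (of_nat (e * (1 + y\<^sup>2)) / pr))) = - 1" for y
    by (rule root_of_unity_sum) (use not_dvd_sum_squares[of y] in \<open>simp add: add.commute\<close>)
  moreover have "(\<Sum>e=1..<p. ee (of_rat (of_nat (e * 1) / pr))) = - 1"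
    by (rule root_of_unity_sum) (use p_nz in simp)
  ultimately show ?thesis unfolding G_def by (simp del: of_nat_mult of_nat_add)
qed

lemma G_Suc: "G (Suc j) = (of_nat p)\<^sup>2 - 1"
proof -
  have "ee (of_rat (pr ^ Suc j * of_nat n / pr)) = 1" for n
  proof -
    have "pr ^ Suc j * of_nat n / pr = pr ^ j * of_nat n" by simp
    moreover have "pr ^ j * of_nat n \<in> \<int>" by simp
    ultimately show ?thesis using ee_rat_int by simp
  qed
  then have "G (Suc j) = (\<Sum>y<p. \<Sum>e=1..<p. 1) + (\<Sum>e=1..<p. 1)" unfolding G_def by (simp only:)
  also have "\<dots> = (of_nat p)\<^sup>2 - 1"
  proof -
    obtain k where "p = Suc k" using p_nz(1) gr0_implies_Suc by blast
    then show ?thesis by (simp add: power2_eq_square algebra_simps)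
  qed
  finally show ?thesis .
qed

lemma c_nonint: "s \<notin> \<int> \<Longrightarrow> c (m2 s a b d) = 0" "s \<notin> \<int> \<Longrightarrow> c (m2 a b d s) = 0"
proof -
  have "s \<in> \<int> \<and> d \<in> \<int>" if "c (m2 s a b d) \<noteq> 0" for s a b d
    using fourier_coeff_half_integral[OF that] by (auto simp: half_integral_def)
  then show "s \<notin> \<int> \<Longrightarrow> c (m2 s a b d) = 0" "s \<notin> \<int> \<Longrightarrow> c (m2 a b d s) = 0" by blast+
qed

lemma not_int: "\<not> p dvd n \<Longrightarrow> of_nat n / pr \<notin> \<int>" "\<not> p dvd n \<Longrightarrow> of_nat n / pr\<^sup>2 \<notin> \<int>"
proof -
  assume n: "\<not> p dvd n"
  have *: "of_nat n / pr ^ k \<notin> \<int>" if "k > 0" for k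
  proof
    assume "of_nat n / pr ^ k \<in> \<int>"
    then have "of_int (int n) / pr ^ k \<in> Zp" by (auto elim!: Ints_cases)
    then have "int p ^ k dvd int n" by (simp only: Zp_int_div_power)
    then have "int p dvd int n" using that dvd_power[of k "int p"] dvd_trans by blast
    then show False using n by (simp only: of_nat_dvd_iff)
  qed
  show "of_nat n / pr \<notin> \<int>" "of_nat n / pr\<^sup>2 \<notin> \<int>" using *[of 1] *[of 2] by simp_all
qed

text \<open>Every coefficient involved has a diagonal entry 1 or y^2 + 1 divided by \<open>p\<close>
  or its square. These are the terms that would precede the start of the recursion.\<close>

lemma vanish: "c (mat (1 / pr)) = 0" "\<beta> (1 / pr) = 0" "\<beta> (1 / pr\<^sup>2) = 0"
proof -
  have p1: "1 / pr \<notin> \<int>" "1 / pr\<^sup>2 \<notin> \<int>" using not_int[of 1] p_nz by simp_all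
  have py: "1 / pr * ((of_nat y)\<^sup>2 + 1) \<notin> \<int>" "1 / pr\<^sup>2 * ((of_nat y)\<^sup>2 + 1) \<notin> \<int>" for y
  proof -
    have e: "1 / pr * ((of_nat y)\<^sup>2 + 1) = of_nat (y\<^sup>2 + 1) / pr" "1 / pr\<^sup>2 * ((of_nat y)\<^sup>2 + 1) = of_nat (y\<^sup>2 + 1) / pr\<^sup>2"
      by simp_all
    show "1 / pr * ((of_nat y)\<^sup>2 + 1) \<notin> \<int>" "1 / pr\<^sup>2 * ((of_nat y)\<^sup>2 + 1) \<notin> \<int>"
      unfolding e by (rule not_int[OF not_dvd_sum_squares])+
  qed
  show "c (mat (1 / pr)) = 0" unfolding mat_m2 by (intro c_nonint p1)
  show "\<beta> (1 / pr) = 0" "\<beta> (1 / pr\<^sup>2) = 0"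
    unfolding \<beta>_def \<beta>1_def \<beta>2_def by (simp_all only: c_nonint p1 py matrix_vector_mult_0_right not_False_eq_True sum.neutral_const add_0)
qed

abbreviation q :: complex where "q \<equiv> of_nat p powi (l1 + l2 - 3)"

text \<open>The normalising exponent \<open>l1 + l2 - 3\<close> exactly offsets the central
  character and the multiplicity p^3 of the cosets whose D is divisible by \<open>p\<close>.\<close>

lemma q_pl: "q * (of_nat p ^ 3 * pl) = 1"
proof -
  have "pl = 1 / of_nat p powi (l1 + l2)" by (simp add: power_int_divide_distrib)
  moreover have "q = of_nat p powi (l1 + l2) / of_nat p ^ 3" by (simp add: power_int_diff)
  ultimately show ?thesis by simp
qed

lemma q2: "(of_nat p ^ 2) powi (l1 + l2 - 3) = q * q"
  by (simp add: power2_eq_square power_int_mult_distrib)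

lemma I1_ok: "s \<in> I1 \<Longrightarrow> idx_ok s"
  using pr_powers Z_inverted_int[of 0] Z_inverted_int[of "int n" for n] Z_inverted_frac[of "int n" 1 for n]
  by (auto simp: I1_def idx_ok_def)

lemma I2_ok: "s \<in> I2 \<Longrightarrow> idx_ok s"
  using pr_powers Z_inverted_int[of 0] Z_inverted_int[of "int n" for n] Z_inverted_frac[of "int n" 1 for n]
    Z_inverted_frac[of "int n" 2 for n] Z_inverted_int[of "int p * int n" for n]
    Z_inverted_frac[of "int e * int n" 1 for e n] Z_inverted_frac[of "int e * (int n)\<^sup>2" 1 for e n]
  by (auto simp: I2_def idx_ok_def)

text \<open>Only scalars and the sums \<open>\<beta>\<close> enter at scalar matrices, so one
  coordinate can be isolated. Indices 0 and 1 are separate because of the vanishing initial terms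
  and the exceptional value \<open>G 0\<close>.\<close>

theorem hecke_relations:
  fixes i :: 'n
  defines "A \<equiv> \<lambda>j. c (mat (pr ^ j)) $ i" and "P \<equiv> of_nat p :: complex"
  shows "\<exists>lam m b. lam * A 0 = A 1 \<and> (\<forall>j. lam * A (Suc j) = q * A j + b j + A (Suc (Suc j))) \<and>
    m * A 0 = P\<^sup>2 * b 0 - q * (P + 1) * A 0 \<and> m * A 1 = P\<^sup>2 * b 1 + q * (P\<^sup>2 - 1) * A 1 \<and>
    (\<forall>j. m * A (Suc (Suc j)) = P\<^sup>2 * q * b j + P\<^sup>2 * b (Suc (Suc j)) + q * (P\<^sup>2 - 1) * A (Suc (Suc j)))"
proof -
  have P: "P \<noteq> 0" by (simp add: P_def)
  obtain lam where lam: "\<And>T. lam *s c T = (of_nat p ^ 1) powi (l1 + l2 - 3) *s (\<Sum>s\<in>I1. hterm (pr ^ 1) s T)"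
    using hecke_coefficients[of \<gamma>1 1 I1] \<gamma>1_cosets I1_inj finite_I1 I1_ok rp_similitude[of pr pr pr 0 0 0 0]
    by (auto simp: \<gamma>1_def)
  obtain mu where mu: "\<And>T. mu *s c T = (of_nat p ^ 2) powi (l1 + l2 - 3) *s (\<Sum>s\<in>I2. hterm (pr ^ 2) s T)"
    using hecke_coefficients[of \<gamma>2 2 I2] \<gamma>2_cosets I2_inj finite_I2 I2_ok rp_similitude[of 1 pr "pr\<^sup>2" 0 0 0 0]
    by (auto simp: \<gamma>2_def)
  define B where "B t = \<beta> t $ i" for t
  have E1: "lam * A j = q * c (mat (pr ^ j / pr)) $ i + q * P * B (pr ^ j / pr) + A (Suc j)" for j
  proof -
    have "lam * A j = q * (\<Sum>s\<in>I1. hterm pr s (mat (pr ^ j)) $ i)"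
      using arg_cong[OF lam[of "mat (pr ^ j)"], of "\<lambda>v. v $ i"] by (simp add: A_def sum_component)
    also have "\<dots> = q * c (mat (pr ^ j / pr)) $ i + q * P * B (pr ^ j / pr) + q * (of_nat p ^ 3 * pl) * A (Suc j)"
      unfolding I1_sum by (simp add: A_def B_def P_def algebra_simps)
    finally show ?thesis unfolding q_pl by simp
  qed
  have E2: "mu * A j = q * q * B (pr ^ j / pr\<^sup>2) + q * B (pr ^ j) + q * G j / P ^ 3 * A j" for j
  proof -
    have "mu * A j = q * q * (\<Sum>s\<in>I2. hterm (pr\<^sup>2) s (mat (pr ^ j)) $ i)"
      using arg_cong[OF mu[of "mat (pr ^ j)"], of "\<lambda>v. v $ i"] by (simp only: A_def sum_component vector_smult_component q2)
    also have "\<dots> = q * q * B (pr ^ j / pr\<^sup>2) + q * (q * (of_nat p ^ 3 * pl)) * B (pr ^ j) + q * G j * (q * (of_nat p ^ 3 * pl)) / P ^ 3 * A j"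
      unfolding I2_sum using P by (simp add: A_def B_def P_def algebra_simps)
    finally show ?thesis unfolding q_pl by simp
  qed
  have B0: "B (1 / pr) = 0" "B (1 / pr\<^sup>2) = 0" and c0: "c (mat (1 / pr)) $ i = 0" using vanish by (simp_all add: B_def)
  \<comment> \<open>The factor \<open>P * q\<close> gives \<open>b\<close> the coefficient 1 in the
    first relation; multiplying the second eigenvalue by \<open>P ^ 3\<close> clears the
    denominators.\<close>
  define b where "b j = P * q * B (pr ^ j)" for j
  have "lam * A 0 = A 1" using E1[of 0] by (simp add: B0 c0)
  moreover have "lam * A (Suc j) = q * A j + b j + A (Suc (Suc j))" for j
    using E1[of "Suc j"] by (simp add: A_def b_def mult_ac)
  moreover have "(P ^ 3 * mu) * A 0 = P\<^sup>2 * b 0 - q * (P + 1) * A 0"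
  proof -
    have "mu * A 0 = q * B (pr ^ 0) + q * (- (P + 1)) / P ^ 3 * A 0" using E2[of 0] by (simp add: B0 G_0 P_def)
    moreover have "(P ^ 3 * mu) * A 0 = P ^ 3 * (mu * A 0)" by simp
    ultimately show ?thesis using P by (simp add: b_def power3_eq_cube power2_eq_square field_simps)
  qed
  moreover have "(P ^ 3 * mu) * A 1 = P\<^sup>2 * b 1 + q * (P\<^sup>2 - 1) * A 1"
  proof -
    have "pr ^ 1 / pr\<^sup>2 = 1 / pr" by (simp add: power2_eq_square)
    then have "mu * A 1 = q * B (pr ^ 1) + q * (P\<^sup>2 - 1) / P ^ 3 * A 1" using E2[of 1] G_Suc[of 0] by (simp add: B0 P_def)
    moreover have "(P ^ 3 * mu) * A 1 = P ^ 3 * (mu * A 1)" by simp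
    ultimately show ?thesis using P by (simp add: b_def power3_eq_cube power2_eq_square field_simps)
  qed
  moreover have "(P ^ 3 * mu) * A (Suc (Suc j)) = P\<^sup>2 * q * b j + P\<^sup>2 * b (Suc (Suc j)) + q * (P\<^sup>2 - 1) * A (Suc (Suc j))" for j
  proof -
    have "pr ^ Suc (Suc j) / pr\<^sup>2 = pr ^ j" by (simp add: power2_eq_square)
    then have "mu * A (Suc (Suc j)) = q * q * B (pr ^ j) + q * B (pr ^ Suc (Suc j)) + q * (P\<^sup>2 - 1) / P ^ 3 * A (Suc (Suc j))"
      using E2[of "Suc (Suc j)"] G_Suc[of "Suc j"] by (simp only: P_def)
    moreover have "(P ^ 3 * mu) * A (Suc (Suc j)) = P ^ 3 * (mu * A (Suc (Suc j)))" by simp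
    ultimately show ?thesis using P by (simp add: b_def power3_eq_cube power2_eq_square field_simps)
  qed
  ultimately show ?thesis by (intro exI[of _ lam] exI[of _ "P ^ 3 * mu"] exI[of _ b]) simp
qed

end

text \<open>
  The coefficients at \<open>p^2\<close>, \<open>p^3\<close>, \<open>p^4\<close> and \<open>p^6\<close> are polynomials in the previous ones and in
  \<open>q\<close>; comparing two different values of \<open>q\<close> forces \<open>lam = 0\<close>,
  then \<open>A 2 = P (q + q')\<close>, then \<open>A 4 = (A 2)\<^sup>2\<close> and finally \<open>q q' = 0\<close>.
\<close>

lemma hecke_recursion:
  fixes A b :: "nat \<Rightarrow> complex"
  assumes P: "P \<noteq> 0" and A0: "A 0 = 1" and l0: "lam * A 0 = A 1"
    and l: "\<And>j. lam * A (Suc j) = q * A j + b j + A (Suc (Suc j))"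
    and m0: "m * A 0 = P\<^sup>2 * b 0 - q * (P + 1) * A 0" and m1: "m * A 1 = P\<^sup>2 * b 1 + q * (P\<^sup>2 - 1) * A 1"
    and m2: "\<And>j. m * A (Suc (Suc j)) = P\<^sup>2 * q * b j + P\<^sup>2 * b (Suc (Suc j)) + q * (P\<^sup>2 - 1) * A (Suc (Suc j))"
  shows "P\<^sup>2 * A 3 = P\<^sup>2 * (2 * A 1 * A 2 - A 1 ^ 3) + q * (A 1 * (P\<^sup>2 + P))"
    and "A 1 = 0 \<Longrightarrow> P * A 4 = P * (A 2)\<^sup>2 - P * q\<^sup>2 + q * A 2"
    and "A 1 = 0 \<Longrightarrow> P * A 6 = P * A 2 * A 4 - P * q\<^sup>2 * A 2 + q * A 4"
proof -
  have lam: "lam = A 1" using l0 A0 by simp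
  \<comment> \<open>The first relation eliminates all \<open>b j\<close>, and the second at index 0
    then determines \<open>m\<close>; its instances at 1, 2 and 4 yield the three claims.\<close>
  have b: "b j = lam * A (Suc j) - q * A j - A (Suc (Suc j))" for j using l[of j] by (simp add: algebra_simps)
  have m: "m = P\<^sup>2 * (A 1 * A 1 - q - A 2) - q * (P + 1)"
    using m0 by (simp add: A0 b lam numeral_2_eq_2)
  have "P\<^sup>2 * A 3 = P\<^sup>2 * (A 1 * A 2 - q * A 1) + q * (P\<^sup>2 - 1) * A 1 - m * A 1"
  proof -
    have b1: "b 1 = A 1 * A 2 - q * A 1 - A 3" using b[of 1] by (simp add: lam numeral_2_eq_2 numeral_3_eq_3)
    show ?thesis using m1 unfolding b1 by (simp add: algebra_simps)
  qed
  then show "P\<^sup>2 * A 3 = P\<^sup>2 * (2 * A 1 * A 2 - A 1 ^ 3) + q * (A 1 * (P\<^sup>2 + P))"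
    unfolding m by (simp add: algebra_simps power2_eq_square power3_eq_cube)
  assume A1: "A 1 = 0"
  have b': "b j = - q * A j - A (Suc (Suc j))" for j using b[of j] lam A1 by simp
  have s: "Suc (Suc 0) = 2" "Suc (Suc 2) = 4" "Suc (Suc 4) = 6" by simp_all
  have "P * (P * A 4) = P * (P * (A 2)\<^sup>2 - P * q\<^sup>2 + q * A 2)"
  proof -
    have "(P\<^sup>2 * (0 * 0 - q - A 2) - q * (P + 1)) * A 2 = P\<^sup>2 * q * (- q * 1 - A 2) + P\<^sup>2 * (- q * A 2 - A 4) + q * (P\<^sup>2 - 1) * A 2"
      using m2[of 0] unfolding b' s m A1 A0 .
    then show ?thesis by (simp add: algebra_simps power2_eq_square)
  qed
  then show "P * A 4 = P * (A 2)\<^sup>2 - P * q\<^sup>2 + q * A 2" using P by simp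
  have "P * (P * A 6) = P * (P * A 2 * A 4 - P * q\<^sup>2 * A 2 + q * A 4)"
  proof -
    have "(P\<^sup>2 * (0 * 0 - q - A 2) - q * (P + 1)) * A 4 = P\<^sup>2 * q * (- q * A 2 - A 4) + P\<^sup>2 * (- q * A 4 - A 6) + q * (P\<^sup>2 - 1) * A 4"
      using m2[of 2] unfolding b' s m A1 .
    then show ?thesis by (simp add: algebra_simps power2_eq_square)
  qed
  then show "P * A 6 = P * A 2 * A 4 - P * q\<^sup>2 * A 2 + q * A 4" using P by simp
qed

lemma hecke_recursion_determines:
  fixes A :: "nat \<Rightarrow> complex"
  assumes P: "P \<noteq> 0" "P + 1 \<noteq> 0" and q: "q \<noteq> q'" "q \<noteq> 0" "q' \<noteq> 0"
    and 1: "P\<^sup>2 * A 3 = P\<^sup>2 * (2 * A 1 * A 2 - A 1 ^ 3) + q * (A 1 * (P\<^sup>2 + P))"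
      "A 1 = 0 \<Longrightarrow> P * A 4 = P * (A 2)\<^sup>2 - P * q\<^sup>2 + q * A 2"
      "A 1 = 0 \<Longrightarrow> P * A 6 = P * A 2 * A 4 - P * q\<^sup>2 * A 2 + q * A 4"
    and 2: "P\<^sup>2 * A 3 = P\<^sup>2 * (2 * A 1 * A 2 - A 1 ^ 3) + q' * (A 1 * (P\<^sup>2 + P))"
      "A 1 = 0 \<Longrightarrow> P * A 4 = P * (A 2)\<^sup>2 - P * q'\<^sup>2 + q' * A 2"
      "A 1 = 0 \<Longrightarrow> P * A 6 = P * A 2 * A 4 - P * q'\<^sup>2 * A 2 + q' * A 4"
  shows False
proof -
  have d: "q - q' \<noteq> 0" using q by simp
  \<comment> \<open>Subtracting the two relations for \<open>A 3\<close> leaves (q - q') P (P + 1) A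
    1 = 0.\<close>
  have "q * (A 1 * (P\<^sup>2 + P)) = q' * (A 1 * (P\<^sup>2 + P))" using 1(1) 2(1) by (metis add_left_cancel)
  moreover have "P\<^sup>2 + P = P * (P + 1)" by (simp add: power2_eq_square algebra_simps)
  ultimately have A1: "A 1 = 0" using P q by auto
  have "- P * q\<^sup>2 + q * A 2 = - P * q'\<^sup>2 + q' * A 2" using 1(2)[OF A1] 2(2)[OF A1] by (simp add: algebra_simps)
  then have "(q - q') * A 2 = (q - q') * (P * (q + q'))" by (simp add: algebra_simps power2_eq_square)
  then have A2: "A 2 = P * (q + q')" using d by simp
  have "- P * q\<^sup>2 * A 2 + q * A 4 = - P * q'\<^sup>2 * A 2 + q' * A 4" using 1(3)[OF A1] 2(3)[OF A1] by (simp add: algebra_simps)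
  then have "(q - q') * A 4 = (q - q') * (P * (q + q') * A 2)" by (simp add: algebra_simps power2_eq_square)
  then have A4: "A 4 = P * (q + q') * A 2" using d by simp
  have "P * q * q' = 0" using 1(2)[OF A1] unfolding A4 A2 by (simp add: algebra_simps power2_eq_square)
  then show False using P q by simp
qed

theorem theorem6p3:
  fixes N p :: nat
    and l1 l2 m1 m2 :: int
    and V W :: "(complex^'n) set"
    and \<rho> \<sigma> :: "complex^2^2 \<Rightarrow> complex^'n \<Rightarrow> complex^'n"
    and F G :: "complex^2^2 \<Rightarrow> complex^'n"
  assumes "0 < N"
    and "siegel_modular_form N V \<rho> l1 l2 F"
    and "siegel_modular_form N W \<sigma> m1 m2 G"
    and "hecke_eigenform N \<rho> l1 l2 F"
    and "hecke_eigenform N \<sigma> m1 m2 G"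
    and "l1 + l2 \<noteq> m1 + m2"
    and "fourier_coeff F (mat 1) \<noteq> 0 \<or> fourier_coeff G (mat 1) \<noteq> 0"
    and "prime p" and "p mod 4 = 3" and "\<not> p dvd N"
  shows "\<exists>r::nat. r \<le> 6 \<and>
           fourier_coeff F (mat (of_nat p ^ r)) \<noteq> fourier_coeff G (mat (of_nat p ^ r))"
proof (rule ccontr)
  assume "\<not> ?thesis"
  then have eq: "fourier_coeff F (mat (of_nat p ^ r)) = fourier_coeff G (mat (of_nat p ^ r))" if "r \<le> 6" for r
    using that by blast
  interpret f: hecke_form N V \<rho> l1 l2 F p by unfold_locales (use assms in auto)
  interpret g: hecke_form N W \<sigma> m1 m2 G p by unfold_locales (use assms in auto)
  define P where "P = (of_nat p :: complex)"
  define qf qg where "qf = P powi (l1 + l2 - 3)" and "qg = P powi (m1 + m2 - 3)"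
  have "fourier_coeff F (mat 1) \<noteq> 0" using eq[of 0] assms(7) by simp
  \<comment> \<open>The relations hold coordinatewise, so one coordinate suffices; agreement at
    \<open>r = 0\<close> makes it nonzero for both forms.\<close>
  then obtain i where i: "fourier_coeff F (mat 1) $ i \<noteq> 0" by (auto simp: vec_eq_iff)
  \<comment> \<open>The relations are homogeneous in the coefficients and \<open>b\<close> together,
    so division by \<open>B 0\<close> normalises the initial value to 1.\<close>
  have step: "P\<^sup>2 * A 3 = P\<^sup>2 * (2 * A 1 * A 2 - A 1 ^ 3) + q * (A 1 * (P\<^sup>2 + P))"
    "A 1 = 0 \<Longrightarrow> P * A 4 = P * (A 2)\<^sup>2 - P * q\<^sup>2 + q * A 2"
    "A 1 = 0 \<Longrightarrow> P * A 6 = P * A 2 * A 4 - P * q\<^sup>2 * A 2 + q * A 4"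
    if rel: "\<exists>lam m b. lam * B 0 = B 1 \<and> (\<forall>j. lam * B (Suc j) = q * B j + b j + B (Suc (Suc j))) \<and>
      m * B 0 = P\<^sup>2 * b 0 - q * (P + 1) * B 0 \<and> m * B 1 = P\<^sup>2 * b 1 + q * (P\<^sup>2 - 1) * B 1 \<and>
      (\<forall>j. m * B (Suc (Suc j)) = P\<^sup>2 * q * b j + P\<^sup>2 * b (Suc (Suc j)) + q * (P\<^sup>2 - 1) * B (Suc (Suc j)))"
    and B0: "B 0 \<noteq> 0" and A: "A = (\<lambda>j. B j / B 0)" for A B :: "nat \<Rightarrow> complex" and q
  proof -
    obtain lam m b where r: "lam * B 0 = B 1" "\<And>j. lam * B (Suc j) = q * B j + b j + B (Suc (Suc j))"
      "m * B 0 = P\<^sup>2 * b 0 - q * (P + 1) * B 0" "m * B 1 = P\<^sup>2 * b 1 + q * (P\<^sup>2 - 1) * B 1"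
      "\<And>j. m * B (Suc (Suc j)) = P\<^sup>2 * q * b j + P\<^sup>2 * b (Suc (Suc j)) + q * (P\<^sup>2 - 1) * B (Suc (Suc j))"
      using rel by blast
    have h: "x / B 0 = y / B 0" if "x = y" for x y :: complex using that by simp
    have P0: "P \<noteq> 0" by (simp add: P_def)
    show "P\<^sup>2 * A 3 = P\<^sup>2 * (2 * A 1 * A 2 - A 1 ^ 3) + q * (A 1 * (P\<^sup>2 + P))"
      "A 1 = 0 \<Longrightarrow> P * A 4 = P * (A 2)\<^sup>2 - P * q\<^sup>2 + q * A 2"
      "A 1 = 0 \<Longrightarrow> P * A 6 = P * A 2 * A 4 - P * q\<^sup>2 * A 2 + q * A 4"
      using hecke_recursion[OF P0, of A lam q "\<lambda>j. b j / B 0" m] B0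
        h[OF r(1)] h[OF r(2)] h[OF r(3)] h[OF r(4)] h[OF r(5)]
      unfolding A by (simp_all add: add_divide_distrib diff_divide_distrib)
  qed
  define A where "A j = fourier_coeff F (mat (of_nat p ^ j)) $ i / fourier_coeff F (mat (of_nat p ^ 0)) $ i" for j
  define A' where "A' j = fourier_coeff G (mat (of_nat p ^ j)) $ i / fourier_coeff G (mat (of_nat p ^ 0)) $ i" for j
  have AA': "A' j = A j" if "j \<le> 6" for j using eq[OF that] eq[of 0] by (simp add: A_def A'_def)
  have F0: "fourier_coeff F (mat (of_nat p ^ 0)) $ i \<noteq> 0" using i by simp
  have G0: "fourier_coeff G (mat (of_nat p ^ 0)) $ i \<noteq> 0" using i eq[of 0] by simp
  note sf = step[OF f.hecke_relations[of i, folded P_def, folded qf_def] F0 ext[OF A_def]]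
  note sg = step[OF g.hecke_relations[of i, folded P_def, folded qg_def] G0 ext[OF A'_def]]
  have P: "P \<noteq> 0" "P + 1 \<noteq> 0"
    using f.p_nz by (simp_all add: P_def of_nat_Suc[symmetric] add.commute del: of_nat_Suc)
  have "P = of_real (real p)" by (simp add: P_def)
  then have n: "norm qf = real p powi (l1 + l2 - 3)" "norm qg = real p powi (m1 + m2 - 3)"
    by (simp_all add: qf_def qg_def norm_power_int)
  have "real p > 1" using f.p_nz by simp
  then have mono: "real p powi a < real p powi b" if "a < b" for a b :: int
    using that by (intro power_int_strict_increasing)
  \<comment> \<open>Passing to norms reduces the claim to strict monotonicity of the real powers of
    \<open>p\<close>.\<close>
  have "norm qf \<noteq> norm qg"
  proof (cases "l1 + l2 < m1 + m2")
    case True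
    then show ?thesis unfolding n using mono[of "l1 + l2 - 3" "m1 + m2 - 3"] by simp
  next
    case False
    then show ?thesis unfolding n using assms(6) mono[of "m1 + m2 - 3" "l1 + l2 - 3"] by simp
  qed
  then have "qf \<noteq> qg" by auto
  moreover have "qf \<noteq> 0" "qg \<noteq> 0" using P by (simp_all add: qf_def qg_def)
  ultimately show False
    using hecke_recursion_determines[OF P _ _ _ sf, of qg] sg by (simp add: AA')
qed

end
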